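(* Let $\Sigma_\infty=\{\alpha_1,\alpha_2,\ldots\}$ be a countably infinite alphabet, $\Sigma$ a finite alphabet, and $\varphi\colon\Sigma_\infty^*\to\Sigma^*$ a morphism. Suppose that the map $\alpha\mapsto\varphi(\alpha)$ ($\alpha\in\Sigma_\infty$) is computable and that for the language $L_\varphi=\{\varphi(\alpha)\mid\alpha\in\Sigma_\infty\}\subseteq\Sigma^*$ the regular realizability problem $\mathrm{RR}(L_\varphi)$ is decidable. Let $W_\infty$ be a computable infinite word over $\Sigma_\infty$ such that every word of $\Sigma_\infty^*$ is a factor of $W_\infty$, and assume that $W=\varphi(W_\infty)$ is an infinite word over $\Sigma$. Then: 1. the prefix realizability problem $\mathrm{R}_p(W_\infty,\varphi)=\mathrm{R}_p(\varphi(W_\infty))$ is decidable; 2. the Büchi realizability problem $\mathrm{R}_p^\infty(\varphi(W_\infty))$ is decidable; 3. the monadic second-order theory $\mathrm{MT}(\mathbb{N},<,W)$, where $W=\varphi(W_\infty)$, is decidable.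
   Context: An infinite word over a (finite or countable) alphabet is a sequence $w_1w_2\ldots$ of its symbols; it is computable if $n\mapsto w_n$ is computable (symbols $\alpha_i$ being represented by their indices $i$). A factor is a finite word $w_nw_{n+1}\ldots w_m$ (the empty word is also regarded as a factor). $\varphi(W_\infty)$ is the concatenation of the images under $\varphi$ of the symbols of $W_\infty$ in order. For a language $L\subseteq\Sigma^*$, the regular realizability problem $\mathrm{RR}(L)$ is: given a regular language $R\subseteq\Sigma^*$ (described by a deterministic finite automaton), decide whether $L\cap R\neq\varnothing$. For $W\in\Sigma^\infty$ let $\mathrm{Pref}(W)$ be the set of all finite prefixes of $W$. The prefix realizability problem $\mathrm{R}_p(W)$: given a regular $R\subseteq\Sigma^*$, decide whether $R\cap\mathrm{Pref}(W)\neq\varnothing$. The Büchi realizability problem $\mathrm{R}_p^\infty(W)$: given a regular $R\subseteq\Sigma^*$, decide whether $|R\cap\mathrm{Pref}(W)|=\infty$. $\mathrm{MT}(\mathbb{N},<,W)$ is the monadic second-order theory (quantification over numbers and over unary predicates) of the natural numbers (indexing the positions of $W=w_1w_2\ldots$) with the standard order and, for each $a\in\Sigma$, a unary predicate $a(n)$ that is true iff $w_n=a$; it is decidable if truth of sentences in this structure is algorithmically decidable. *)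

theory Defs
  imports Complex_Main "HOL-Library.Omega_Words_Fun" "HOL-Library.Nat_Bijection"
begin

section \<open>Computability\<close>

text \<open>
  The general recursive functions in Kleene's sense: the least class of number-theoretic functions
  that contains zero, successor and the projections and is closed under composition, primitive
  recursion and minimization of regular functions. A function of arity \<open>k\<close> is represented by a
  function on lists, of which only the values on lists of length \<open>k\<close> are meaningful. Regularity
  (every minimization has a witness) keeps all functions total, so that this class consists exactly
  of the total computable functions.
\<close>

inductive recursive :: "nat \<Rightarrow> (nat list \<Rightarrow> nat) \<Rightarrow> bool" where
  zero: "recursive k (\<lambda>xs. 0)"
| succ: "recursive 1 (\<lambda>xs. Suc (xs ! 0))"
| proj: "i < k \<Longrightarrow> recursive k (\<lambda>xs. xs ! i)"
| compose: "recursive (length gs) h \<Longrightarrow> (\<forall>g \<in> set gs. recursive k g) \<Longrightarrow>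
    recursive k (\<lambda>xs. h (map (\<lambda>g. g xs) gs))"
| prim_rec: "recursive k g \<Longrightarrow> recursive (k + 2) h \<Longrightarrow>
    recursive (k + 1) (\<lambda>xs. rec_nat (g (tl xs)) (\<lambda>n r. h (n # r # tl xs)) (hd xs))"
| mu: "recursive (k + 1) f \<Longrightarrow> (\<forall>xs. length xs = k \<longrightarrow> (\<exists>n. f (n # xs) = 0)) \<Longrightarrow>
    recursive k (\<lambda>xs. LEAST n. f (n # xs) = 0)"

definition computable :: "(nat \<Rightarrow> nat) \<Rightarrow> bool" where
  "computable f \<longleftrightarrow> (\<exists>F. recursive 1 F \<and> (\<forall>x. F [x] = f x))"

text \<open>
  A decision problem is given by a set \<open>I\<close> of instances, their numerical encoding, and the set \<open>P\<close>
  of positive instances. For the encodings used below, being the code of an instance is itself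
  a decidable property, so nothing needs to be required on numbers that are not codes.
\<close>

definition decidable_problem :: "('i \<Rightarrow> nat) \<Rightarrow> 'i set \<Rightarrow> ('i \<Rightarrow> bool) \<Rightarrow> bool" where
  "decidable_problem code I P \<longleftrightarrow>
     (\<exists>f. computable f \<and> (\<forall>x \<in> I. f (code x) = (if P x then 1 else 0)))"

section \<open>Alphabets, words and morphisms\<close>

text \<open>
  The countably infinite alphabet is the type \<^typ>\<open>nat\<close>, a symbol being identified with its index.
  A finite alphabet is a finite type, whose letters are numbered by a bijection with an initial
  segment of the natural numbers for the purpose of encoding.
\<close>

definition numbering :: "('a::finite \<Rightarrow> nat) \<Rightarrow> bool" where
  "numbering num \<longleftrightarrow> bij_betw num UNIV {..<card (UNIV :: 'a set)}"

definition code_word :: "('a \<Rightarrow> nat) \<Rightarrow> 'a list \<Rightarrow> nat" where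
  "code_word num w = list_encode (map num w)"

definition morphism :: "('b list \<Rightarrow> 'a list) \<Rightarrow> bool" where
  "morphism \<phi> \<longleftrightarrow> \<phi> [] = [] \<and> (\<forall>u v. \<phi> (u @ v) = \<phi> u @ \<phi> v)"

definition factor :: "'a list \<Rightarrow> 'a word \<Rightarrow> bool" where
  "factor u X \<longleftrightarrow> (\<exists>i j. u = subsequence X i j)"

definition Pref :: "'a word \<Rightarrow> 'a list set" where
  "Pref X = range (\<lambda>n. prefix n X)"

text \<open>
  The concatenation \<open>\<phi>(X 0) \<phi>(X 1) \<phi>(X 2) \<dots>\<close> may be a finite word, as letters can be erased.
\<close>

definition infinite_image :: "('b list \<Rightarrow> 'a list) \<Rightarrow> 'b word \<Rightarrow> bool" where
  "infinite_image \<phi> X \<longleftrightarrow> (\<forall>m. \<exists>n. m < length (\<phi> (prefix n X)))"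

text \<open>If that concatenation is infinite, it is the following word; otherwise the value is junk.\<close>

definition image_word :: "('b list \<Rightarrow> 'a list) \<Rightarrow> 'b word \<Rightarrow> 'a word" where
  "image_word \<phi> X = (\<lambda>i. \<phi> (prefix (LEAST n. i < length (\<phi> (prefix n X))) X) ! i)"

section \<open>Finite automata and realizability problems\<close>

text \<open>The states of an automaton with \<open>size_of\<close> states are the numbers below \<open>size_of\<close>.\<close>

record 'a dfa =
  size_of :: nat
  start :: nat
  delta :: "nat \<Rightarrow> 'a \<Rightarrow> nat"
  final :: "nat set"

definition dfas :: "'a dfa set" where
  "dfas = {A. start A < size_of A \<and> (\<forall>q < size_of A. \<forall>a. delta A q a < size_of A) \<and>
              final A \<subseteq> {..<size_of A}}"

definition lang :: "'a dfa \<Rightarrow> 'a list set" where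
  "lang A = {w. foldl (delta A) (start A) w \<in> final A}"

text \<open>
  The code of an automaton lists its number of states, its initial state, its transition table
  (one row per state, one column per letter) and the characteristic vector of its final states.
\<close>

definition code_dfa :: "('a::finite \<Rightarrow> nat) \<Rightarrow> 'a dfa \<Rightarrow> nat" where
  "code_dfa num A = list_encode
     [size_of A,
      start A,
      list_encode (map (\<lambda>q. list_encode
        (map (\<lambda>i. delta A q (inv num i)) [0..<card (UNIV :: 'a set)])) [0..<size_of A]),
      list_encode (map (\<lambda>q. if q \<in> final A then 1 else 0) [0..<size_of A])]"

definition RR_decidable :: "('a::finite \<Rightarrow> nat) \<Rightarrow> 'a list set \<Rightarrow> bool" where
  "RR_decidable num L \<longleftrightarrow>
     decidable_problem (code_dfa num) dfas (\<lambda>A. L \<inter> lang A \<noteq> {})"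

definition Rp_decidable :: "('a::finite \<Rightarrow> nat) \<Rightarrow> 'a word \<Rightarrow> bool" where
  "Rp_decidable num W \<longleftrightarrow>
     decidable_problem (code_dfa num) dfas (\<lambda>A. lang A \<inter> Pref W \<noteq> {})"

definition Rp_inf_decidable :: "('a::finite \<Rightarrow> nat) \<Rightarrow> 'a word \<Rightarrow> bool" where
  "Rp_inf_decidable num W \<longleftrightarrow>
     decidable_problem (code_dfa num) dfas (\<lambda>A. infinite (lang A \<inter> Pref W))"

section \<open>Monadic second-order logic of infinite words\<close>

text \<open>
  First-order and second-order variables are two disjoint families, each indexed by the natural
  numbers. The other connectives and the universal quantifiers are definable as usual.
\<close>

datatype 'a mso =
    Less nat nat
  | Equal nat nat
  | Letter 'a nat
  | Member nat nat
  | Neg "'a mso"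
  | Conj "'a mso" "'a mso"
  | Ex1 nat "'a mso"
  | Ex2 nat "'a mso"

primrec sat :: "'a word \<Rightarrow> (nat \<Rightarrow> nat) \<Rightarrow> (nat \<Rightarrow> nat set) \<Rightarrow> 'a mso \<Rightarrow> bool" where
  "sat W v V (Less x y) \<longleftrightarrow> v x < v y"
| "sat W v V (Equal x y) \<longleftrightarrow> v x = v y"
| "sat W v V (Letter a x) \<longleftrightarrow> W (v x) = a"
| "sat W v V (Member x X) \<longleftrightarrow> v x \<in> V X"
| "sat W v V (Neg \<psi>) \<longleftrightarrow> \<not> sat W v V \<psi>"
| "sat W v V (Conj \<psi> \<chi>) \<longleftrightarrow> sat W v V \<psi> \<and> sat W v V \<chi>"
| "sat W v V (Ex1 x \<psi>) \<longleftrightarrow> (\<exists>n. sat W (v(x := n)) V \<psi>)"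
| "sat W v V (Ex2 X \<psi>) \<longleftrightarrow> (\<exists>M. sat W v (V(X := M)) \<psi>)"

primrec free1 :: "'a mso \<Rightarrow> nat set" where
  "free1 (Less x y) = {x, y}"
| "free1 (Equal x y) = {x, y}"
| "free1 (Letter a x) = {x}"
| "free1 (Member x X) = {x}"
| "free1 (Neg \<psi>) = free1 \<psi>"
| "free1 (Conj \<psi> \<chi>) = free1 \<psi> \<union> free1 \<chi>"
| "free1 (Ex1 x \<psi>) = free1 \<psi> - {x}"
| "free1 (Ex2 X \<psi>) = free1 \<psi>"

primrec free2 :: "'a mso \<Rightarrow> nat set" where
  "free2 (Less x y) = {}"
| "free2 (Equal x y) = {}"
| "free2 (Letter a x) = {}"
| "free2 (Member x X) = {X}"
| "free2 (Neg \<psi>) = free2 \<psi>"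
| "free2 (Conj \<psi> \<chi>) = free2 \<psi> \<union> free2 \<chi>"
| "free2 (Ex1 x \<psi>) = free2 \<psi>"
| "free2 (Ex2 X \<psi>) = free2 \<psi> - {X}"

definition sentences :: "'a mso set" where
  "sentences = {\<psi>. free1 \<psi> = {} \<and> free2 \<psi> = {}}"

text \<open>The truth value of a sentence does not depend on the valuation, see \<open>sat_cong\<close> below.\<close>

definition true_in :: "'a word \<Rightarrow> 'a mso \<Rightarrow> bool" where
  "true_in W \<psi> \<longleftrightarrow> (\<forall>v V. sat W v V \<psi>)"

primrec code_mso :: "('a \<Rightarrow> nat) \<Rightarrow> 'a mso \<Rightarrow> nat" where
  "code_mso num (Less x y) = list_encode [0, x, y]"
| "code_mso num (Equal x y) = list_encode [1, x, y]"
| "code_mso num (Letter a x) = list_encode [2, num a, x]"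
| "code_mso num (Member x X) = list_encode [3, x, X]"
| "code_mso num (Neg \<psi>) = list_encode [4, code_mso num \<psi>]"
| "code_mso num (Conj \<psi> \<chi>) = list_encode [5, code_mso num \<psi>, code_mso num \<chi>]"
| "code_mso num (Ex1 x \<psi>) = list_encode [6, x, code_mso num \<psi>]"
| "code_mso num (Ex2 X \<psi>) = list_encode [7, X, code_mso num \<psi>]"

definition MT_decidable :: "('a \<Rightarrow> nat) \<Rightarrow> 'a word \<Rightarrow> bool" where
  "MT_decidable num W \<longleftrightarrow> decidable_problem (code_mso num) sentences (true_in W)"

section \<open>Adequacy of the definitions\<close>

lemma morphism_mono:
  assumes "morphism \<phi>" "i \<le> j"
  shows "\<exists>u. \<phi> (prefix j X) = \<phi> (prefix i X) @ u"
proof -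
  have "prefix j X = prefix i X @ subsequence X i j"
    using subsequence_append[where i = i and j = "j - i" and w = X] assms(2) by simp
  then show ?thesis
    using assms(1) by (auto simp: morphism_def)
qed

lemma prefix_image_word:
  assumes "morphism \<phi>"
  shows "prefix (length (\<phi> (prefix n X))) (image_word \<phi> X) = \<phi> (prefix n X)"
proof (rule nth_equalityI)
  fix i assume "i < length (prefix (length (\<phi> (prefix n X))) (image_word \<phi> X))"
  then have i: "i < length (\<phi> (prefix n X))"
    by simp
  define m where "m = (LEAST n. i < length (\<phi> (prefix n X)))"
  have m: "i < length (\<phi> (prefix m X))" "m \<le> n"
    unfolding m_def using i by (rule LeastI, rule Least_le)
  obtain u where "\<phi> (prefix n X) = \<phi> (prefix m X) @ u"
    using morphism_mono[OF assms m(2)] by blast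
  then show "prefix (length (\<phi> (prefix n X))) (image_word \<phi> X) ! i = \<phi> (prefix n X) ! i"
    using i m(1) by (simp add: image_word_def m_def[symmetric] nth_append)
qed simp

lemma code_dfa_determines_lang:
  assumes num: "numbering num" and A: "A \<in> dfas" and B: "B \<in> dfas"
    and eq: "code_dfa num A = code_dfa num B"
  shows "lang A = lang B"
proof -
  have inv_num: "inv num (num a) = a" and num_less: "num a < card (UNIV :: 'a set)" for a
    using num by (auto simp: numbering_def bij_betw_def)
  have n: "size_of A = size_of B" and s: "start A = start B"
    using eq by (auto simp: code_dfa_def)
  have rows: "\<forall>q < size_of A. \<forall>i < card (UNIV :: 'a set). delta A q (inv num i) = delta B q (inv num i)"
    and bits: "\<forall>q < size_of A. (if q \<in> final A then 1 else 0 :: nat) = (if q \<in> final B then 1 else 0)"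
    using eq by (simp_all add: code_dfa_def list_encode_eq n map_eq_conv del: list_encode.simps)
  have d: "delta A q a = delta B q a" if "q < size_of A" for q a
    using rows that num_less[of a] inv_num[of a] by metis
  have f: "q \<in> final A \<longleftrightarrow> q \<in> final B" if "q < size_of A" for q
    using bits that by (metis zero_neq_one)
  have run: "foldl (delta A) q w = foldl (delta B) q w \<and> foldl (delta A) q w < size_of A"
    if "q < size_of A" for q w
    using that
  proof (induction w arbitrary: q)
    case (Cons a w)
    then have "delta A q a < size_of A" "delta A q a = delta B q a"
      using A d by (auto simp: dfas_def)
    then show ?case
      using Cons.IH by (metis foldl_Cons)
  qed simp
  have "start A < size_of A"
    using A by (simp add: dfas_def)
  then have "foldl (delta A) (start A) w \<in> final A \<longleftrightarrow> foldl (delta B) (start B) w \<in> final B" for w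
    using run[of "start A" w] f[of "foldl (delta A) (start A) w"] s by simp
  then show ?thesis
    by (simp add: lang_def)
qed

lemma inj_code_mso:
  assumes "inj num"
  shows "inj (code_mso num)"
proof (rule injI)
  fix \<psi> \<chi> :: "'a mso"
  assume "code_mso num \<psi> = code_mso num \<chi>"
  then show "\<psi> = \<chi>"
  proof (induction \<psi> arbitrary: \<chi>)
    case (Less x y) then show ?case by (cases \<chi>) (auto simp: list_encode_eq simp del: list_encode.simps)
  next
    case (Equal x y) then show ?case by (cases \<chi>) (auto simp: list_encode_eq simp del: list_encode.simps)
  next
    case (Letter a x) then show ?case
      using assms by (cases \<chi>) (auto simp: list_encode_eq inj_eq simp del: list_encode.simps)
  next
    case (Member x X) then show ?case by (cases \<chi>) (auto simp: list_encode_eq simp del: list_encode.simps)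
  next
    case (Neg \<psi>) then show ?case by (cases \<chi>) (auto simp: list_encode_eq simp del: list_encode.simps)
  next
    case (Conj \<psi>1 \<psi>2) then show ?case by (cases \<chi>) (auto simp: list_encode_eq simp del: list_encode.simps)
  next
    case (Ex1 x \<psi>) then show ?case by (cases \<chi>) (auto simp: list_encode_eq simp del: list_encode.simps)
  next
    case (Ex2 X \<psi>) then show ?case by (cases \<chi>) (auto simp: list_encode_eq simp del: list_encode.simps)
  qed
qed

lemma sat_cong:
  assumes "\<forall>x \<in> free1 \<psi>. v x = v' x" "\<forall>X \<in> free2 \<psi>. V X = V' X"
  shows "sat W v V \<psi> \<longleftrightarrow> sat W v' V' \<psi>"
  using assms
proof (induction \<psi> arbitrary: v v' V V')
  case (Neg \<psi>)
  from Neg.IH[of v v' V V'] Neg.prems show ?case by simp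
next
  case (Conj \<psi>1 \<psi>2)
  from Conj.IH(1)[of v v' V V'] Conj.IH(2)[of v v' V V'] Conj.prems show ?case by simp
next
  case (Ex1 x \<psi>)
  have "sat W (v(x := n)) V \<psi> \<longleftrightarrow> sat W (v'(x := n)) V' \<psi>" for n
    by (rule Ex1.IH) (use Ex1.prems in auto)
  then show ?case by simp
next
  case (Ex2 X \<psi>)
  have "sat W v (V(X := M)) \<psi> \<longleftrightarrow> sat W v' (V'(X := M)) \<psi>" for M
    by (rule Ex2.IH) (use Ex2.prems in auto)
  then show ?case by simp
qed simp_all

end

theory Submission
  imports Defs "HOL-Library.Ramsey"
begin

text \<open>
  The positive and the negative instances are certified by recursively enumerable conditions. As
  every word is a factor of \<open>X = W_inf\<close>, the run of a finite automaton along \<open>\<phi>(X)\<close> enters a terminal strongly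
  connected component \<open>C\<close> of the graph whose edges are the actions of the words \<open>\<phi>(\<alpha>)\<close>, and
  every finite path in \<open>C\<close> is followed infinitely often. Whether \<open>C\<close> is closed under all these
  actions, and whether a final state is visited on the way, are regular questions about the
  language of the words \<open>\<phi>(\<alpha>)\<close>.

  For the monadic theory, a formula \<open>\<psi>\<close> induces a congruence of finite index on labelled words that
  is compatible with infinite products (the composition method). The automaton of its classes is
  found by search, and its terminal components yield a prefix \<open>s\<close> of \<open>\<phi>(X)\<close> whose class is in the minimal
  ideal of the monoid generated by the classes of the words \<open>\<phi>(\<alpha>)\<close>. If \<open>e\<close> is an idempotent power
  of \<open>s\<close>, then Ramsey's theorem and the maximal subgroup with unit \<open>e\<close> show that \<open>\<phi>(X)\<close> satisfies \<open>\<psi>\<close>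
  if and only if \<open>e e e \<dots>\<close> does. The latter is decided by induction on \<open>\<psi>\<close>: by Ramsey's theorem again,
  a quantifier only ranges over the labellings of finite words.
\<close>

subsection \<open>Recursive functions\<close>

text \<open>Two obstacles shape the proof. The oracle only settles statements of the form: no word
  \<open>\<phi>(\<alpha>)\<close> leads from this state into that set. That some concatenation of
  such words returns to a given state, or visits a final one, is witnessed by the concatenation
  itself. Every condition is therefore split into closure tests and explicit paths, and the search
  ends because each input has a certificate for one of the two answers.

  Moreover, the truth of \<open>\<psi>\<close> depends on all of \<open>\<phi>(X)\<close>, and no
  finite part of \<open>X\<close> determines how it continues. Ramsey's theorem leaves a word
  \<open>t (p e q) (p e q) ...\<close> with unknown \<open>t\<close>, \<open>p\<close>,
  \<open>q\<close>. In the minimal ideal these unknowns disappear: after a rotation the period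
  becomes an element \<open>e x e\<close> of a finite group with unit \<open>e\<close>, some power
  of which is \<open>e\<close>, and replacing a period by a power of it does not change the infinite
  word. The preperiod is absorbed in the same way, by means of a right inverse of it with respect to
  \<open>e\<close>.\<close>

text \<open>Values on lists of another length than the arity, to which \<open>recursive\<close> is sensitive, are ignored.\<close>

definition rc :: "nat \<Rightarrow> (nat list \<Rightarrow> nat) \<Rightarrow> bool" where
  "rc k f \<longleftrightarrow> (\<exists>F. recursive k F \<and> (\<forall>xs. length xs = k \<longrightarrow> F xs = f xs))"

lemma rcI: "recursive k f \<Longrightarrow> rc k f"
  by (auto simp: rc_def)

lemma rc_cong: "rc k f \<Longrightarrow> (\<And>xs. length xs = k \<Longrightarrow> f xs = g xs) \<Longrightarrow> rc k g"
  by (auto simp: rc_def)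

lemma rc_compose:
  assumes "rc (length gs) h" "\<forall>g \<in> set gs. rc k g"
  shows "rc k (\<lambda>xs. h (map (\<lambda>g. g xs) gs))"
proof -
  obtain H where H: "recursive (length gs) H" "\<And>xs. length xs = length gs \<Longrightarrow> H xs = h xs"
    using assms(1) by (auto simp: rc_def)
  obtain G where G: "\<And>g. g \<in> set gs \<Longrightarrow> recursive k (G g) \<and> (\<forall>xs. length xs = k \<longrightarrow> G g xs = g xs)"
    using assms(2) unfolding rc_def by metis
  have "recursive k (\<lambda>xs. H (map (\<lambda>g. g xs) (map G gs)))"
    by (rule recursive.compose) (use H G in auto)
  moreover have "H (map (\<lambda>g. g xs) (map G gs)) = h (map (\<lambda>g. g xs) gs)" if "length xs = k" for xs
    using that G H(2) by (simp add: o_def cong: map_cong)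
  ultimately show ?thesis
    unfolding rc_def by blast
qed

lemma rc_prim_rec:
  assumes "rc k g" "rc (k + 2) h"
  shows "rc (k + 1) (\<lambda>xs. rec_nat (g (tl xs)) (\<lambda>n r. h (n # r # tl xs)) (hd xs))"
proof -
  obtain G H where G: "recursive k G" "\<And>xs. length xs = k \<Longrightarrow> G xs = g xs"
    and H: "recursive (k + 2) H" "\<And>xs. length xs = k + 2 \<Longrightarrow> H xs = h xs"
    using assms by (auto simp: rc_def)
  have "rec_nat (G (tl xs)) (\<lambda>n r. H (n # r # tl xs)) n = rec_nat (g (tl xs)) (\<lambda>n r. h (n # r # tl xs)) n"
    if "length xs = k + 1" for xs n
    using that by (induction n) (simp_all add: G H)
  then show ?thesis
    unfolding rc_def using recursive.prim_rec[OF G(1) H(1)] by blast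
qed

lemma rc_mu:
  assumes "rc (k + 1) f" "\<And>xs. length xs = k \<Longrightarrow> \<exists>n. f (n # xs) = 0"
  shows "rc k (\<lambda>xs. LEAST n. f (n # xs) = 0)"
proof -
  obtain F where F: "recursive (k + 1) F" "\<And>xs. length xs = k + 1 \<Longrightarrow> F xs = f xs"
    using assms(1) by (auto simp: rc_def)
  have "recursive k (\<lambda>xs. LEAST n. F (n # xs) = 0)"
    by (rule recursive.mu[OF F(1)]) (use assms(2) F in simp)
  then show ?thesis
    unfolding rc_def using F(2) by (intro exI conjI) auto
qed

lemma rc1:
  assumes "rc 1 (\<lambda>xs. f (xs ! 0))" "rc k g"
  shows "rc k (\<lambda>xs. f (g xs))"
  using rc_compose[of "[g]" "\<lambda>xs. f (xs ! 0)" k] assms by simp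

lemma rc2:
  assumes "rc 2 (\<lambda>xs. f (xs ! 0) (xs ! 1))" "rc k g" "rc k h"
  shows "rc k (\<lambda>xs. f (g xs) (h xs))"
  using rc_compose[of "[g, h]" "\<lambda>xs. f (xs ! 0) (xs ! 1)" k] assms by (simp add: numeral_2_eq_2)

lemma computable_iff_rc: "computable f \<longleftrightarrow> rc 1 (\<lambda>xs. f (xs ! 0))"
proof
  assume "rc 1 (\<lambda>xs. f (xs ! 0))"
  then obtain F where F: "recursive 1 F" "\<And>xs. length xs = 1 \<Longrightarrow> F xs = f (xs ! 0)"
    by (auto simp: rc_def)
  then have "F [x] = f x" for x
    by (simp add: F(2))
  with F show "computable f"
    by (auto simp: computable_def)
next
  assume "computable f"
  then obtain F where F: "recursive 1 F" "\<And>x. F [x] = f x"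
    by (auto simp: computable_def)
  have "F xs = f (xs ! 0)" if "length xs = 1" for xs
    using that F(2) by (cases xs) auto
  with F show "rc 1 (\<lambda>xs. f (xs ! 0))"
    by (auto simp: rc_def)
qed

section \<open>Arithmetic and the Cantor pairing function\<close>

lemma rc_proj: "i < k \<Longrightarrow> rc k (\<lambda>xs. xs ! i)"
  by (rule rcI, rule recursive.proj)

lemma rc_Suc: "rc k f \<Longrightarrow> rc k (\<lambda>xs. Suc (f xs))"
  by (rule rc1[OF rcI[OF recursive.succ]])

lemma rc_const: "rc k (\<lambda>xs. c)"
proof (induction c)
  case 0 show ?case by (rule rcI, rule recursive.zero)
next
  case (Suc c) then show ?case by (rule rc_Suc)
qed

text \<open>The parameters of the recursion are passed as the single number \<open>g xs\<close>;
  several parameters are later paired into one.\<close>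

lemma rc_rec:
  assumes "rc k g" "rc 3 (\<lambda>xs. h (xs ! 0) (xs ! 1) (xs ! 2))" "rc k a" "rc 1 (\<lambda>xs. b (xs ! 0))"
  shows "rc k (\<lambda>xs. rec_nat (b (g xs)) (\<lambda>n r. h n r (g xs)) (a xs))"
proof -
  have three: "(1 :: nat) + 2 = 3"
    by simp
  let ?b = "\<lambda>xs. b (xs ! 0)" and ?h = "\<lambda>xs. h (xs ! 0) (xs ! 1) (xs ! 2)"
  have "rc (1 + 1) (\<lambda>xs. rec_nat (?b (tl xs)) (\<lambda>n r. ?h (n # r # tl xs)) (hd xs))"
  proof (rule rc_prim_rec)
    show "rc 1 ?b" "rc (1 + 2) ?h"
      using assms by (simp_all only: three)
  qed
  then have "rc 2 (\<lambda>xs. rec_nat (?b (tl xs)) (\<lambda>n r. ?h (n # r # tl xs)) (hd xs))"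
    by (simp only: one_add_one)
  then have "rc 2 (\<lambda>xs. rec_nat (b (xs ! 1)) (\<lambda>n r. h n r (xs ! 1)) (xs ! 0))"
    by (rule rc_cong) (auto simp: length_Suc_conv numeral_2_eq_2)
  from rc2[OF this assms(3) assms(1)] show ?thesis .
qed

lemma rc_add: "rc k f \<Longrightarrow> rc k g \<Longrightarrow> rc k (\<lambda>xs. f xs + g xs)"
proof -
  assume *: "rc k f" "rc k g"
  have "rc k (\<lambda>xs. rec_nat (g xs) (\<lambda>n r. Suc r) (f xs))"
    by (rule rc_rec[where b = "\<lambda>x. x" and h = "\<lambda>n r x. Suc r"]) (intro * rc_Suc rc_proj; simp)+
  moreover have "rec_nat y (\<lambda>n r. Suc r) x = x + y" for x y
    by (induction x) auto
  ultimately show ?thesis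
    by simp
qed

lemma rc_pred: "rc k f \<Longrightarrow> rc k (\<lambda>xs. f xs - 1)"
proof -
  assume *: "rc k f"
  have "rc k (\<lambda>xs. rec_nat 0 (\<lambda>n r. n) (f xs))"
    by (rule rc_rec[where b = "\<lambda>x. 0" and h = "\<lambda>n r x. n" and g = f]) (intro * rc_const rc_proj; simp)+
  moreover have "rec_nat 0 (\<lambda>n r. n) x = x - 1" for x :: nat
    by (cases x) auto
  ultimately show ?thesis
    by simp
qed

lemma rc_diff: "rc k f \<Longrightarrow> rc k g \<Longrightarrow> rc k (\<lambda>xs. f xs - g xs)"
proof -
  assume *: "rc k f" "rc k g"
  have "rc k (\<lambda>xs. rec_nat (f xs) (\<lambda>n r. r - 1) (g xs))"
    by (rule rc_rec[where b = "\<lambda>x. x" and h = "\<lambda>n r x. r - 1"]) (intro * rc_pred rc_proj; simp)+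
  moreover have "rec_nat y (\<lambda>n r. r - 1) x = y - x" for x y :: nat
    by (induction x) auto
  ultimately show ?thesis
    by simp
qed

lemma rc_triangle: "rc k f \<Longrightarrow> rc k (\<lambda>xs. triangle (f xs))"
proof -
  assume *: "rc k f"
  have "rc k (\<lambda>xs. rec_nat 0 (\<lambda>n r. r + Suc n) (f xs))"
    by (rule rc_rec[where b = "\<lambda>x. 0" and h = "\<lambda>n r x. r + Suc n" and g = f]) (intro * rc_const rc_add rc_Suc rc_proj; simp)+
  moreover have "rec_nat 0 (\<lambda>n r. r + Suc n) x = triangle x" for x :: nat
    by (induction x) auto
  ultimately show ?thesis
    by simp
qed

lemma rc_prod_encode: "rc k f \<Longrightarrow> rc k g \<Longrightarrow> rc k (\<lambda>xs. prod_encode (f xs, g xs))"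
  unfolding prod_encode_def by (simp add: rc_add rc_triangle)

lemma le_triangle: "n \<le> triangle n"
  by (induction n) auto

lemma triangle_mono: "m \<le> n \<Longrightarrow> triangle m \<le> triangle n"
  by (induction n) (auto simp: le_Suc_eq)

lemma prod_decode_eqD: "prod_decode n = (a, b) \<Longrightarrow> n = triangle (a + b) + a"
proof -
  assume "prod_decode n = (a, b)"
  then have "prod_encode (a, b) = n"
    by (metis prod_decode_inverse)
  then show ?thesis
    by (simp add: prod_encode_def)
qed

text \<open>The codes on the diagonal with sum \<open>d\<close> run from \<open>triangle d\<close>
  to \<open>triangle d + d\<close>, just below \<open>triangle (Suc d)\<close>. Truncated
  subtraction expresses the comparison as an equation with 0, the form that minimization
  requires.\<close>

lemma diagonal_prod_decode:
  assumes "prod_decode n = (a, b)"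
  shows "(LEAST k. Suc n - triangle (Suc k) = 0) = a + b"
proof (rule Least_equality)
  have n: "n = triangle (a + b) + a"
    using assms by (rule prod_decode_eqD)
  show "Suc n - triangle (Suc (a + b)) = 0"
    by (simp add: n)
  fix k assume "Suc n - triangle (Suc k) = 0"
  then have "triangle (a + b) < triangle (Suc k)"
    by (simp add: n)
  then show "a + b \<le> k"
    by (metis not_less_eq_eq triangle_mono leD)
qed

lemma rc_diagonal: "rc k f \<Longrightarrow> rc k (\<lambda>xs. LEAST m. Suc (f xs) - triangle (Suc m) = 0)"
proof (rule rc1[where f = "\<lambda>n. LEAST m. Suc n - triangle (Suc m) = 0"])
  have "rc 1 (\<lambda>xs. LEAST n. (\<lambda>ys. Suc (ys ! 1) - triangle (Suc (ys ! 0))) (n # xs) = 0)"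
  proof (rule rc_mu)
    show "rc (1 + 1) (\<lambda>ys. Suc (ys ! 1) - triangle (Suc (ys ! 0)))"
      by (intro rc_diff rc_Suc rc_triangle rc_proj) auto
    show "\<exists>n. Suc ((n # xs) ! 1) - triangle (Suc ((n # xs) ! 0)) = 0" for xs
      by (rule exI[of _ "xs ! 0"]) (use le_triangle[of "xs ! 0"] in auto)
  qed
  then show "rc 1 (\<lambda>xs. LEAST m. Suc (xs ! 0) - triangle (Suc m) = 0)"
    by simp
qed

lemma rc_fst_decode: "rc k f \<Longrightarrow> rc k (\<lambda>xs. fst (prod_decode (f xs)))"
proof -
  assume *: "rc k f"
  have "fst (prod_decode n) = n - triangle (LEAST k. Suc n - triangle (Suc k) = 0)" for n
  proof -
    obtain a b where ab: "prod_decode n = (a, b)" by force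
    then have "n = triangle (a + b) + a"
      by (rule prod_decode_eqD)
    then show ?thesis
      using diagonal_prod_decode[OF ab] ab by simp
  qed
  then show ?thesis
    by (simp only:) (intro rc_diff rc_triangle rc_diagonal *)
qed

lemma rc_snd_decode: "rc k f \<Longrightarrow> rc k (\<lambda>xs. snd (prod_decode (f xs)))"
proof -
  assume *: "rc k f"
  have "snd (prod_decode n) = (LEAST k. Suc n - triangle (Suc k) = 0) - fst (prod_decode n)" for n
    using diagonal_prod_decode[of n] by (cases "prod_decode n") simp
  then show ?thesis
    by (simp only:) (intro rc_diff rc_fst_decode rc_diagonal *)
qed

subsection \<open>Computability over encoded types\<close>

text \<open>Encodings are bijections with \<open>nat\<close>, not mere injections: every number is a
  code, and computability is a statement about a total function on numbers. The price is that finite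
  types such as \<open>bool\<close> cannot be instances, so predicates get the notion
  \<open>dc\<close> of their own.\<close>

class enc =
  fixes enc :: "'a \<Rightarrow> nat" and denc :: "nat \<Rightarrow> 'a"
  assumes denc_enc [simp]: "denc (enc x) = x" and enc_denc [simp]: "enc (denc n) = n"

lemma enc_eq_iff [simp]: "enc x = enc y \<longleftrightarrow> x = y"
  by (metis denc_enc)

instantiation nat :: enc
begin
definition enc_nat :: "nat \<Rightarrow> nat" where [simp]: "enc_nat n = n"
definition denc_nat :: "nat \<Rightarrow> nat" where [simp]: "denc_nat n = n"
instance by standard simp_all
end

instantiation prod :: (enc, enc) enc
begin
definition enc_prod :: "'a \<times> 'b \<Rightarrow> nat" where "enc_prod p = prod_encode (enc (fst p), enc (snd p))"
definition denc_prod :: "nat \<Rightarrow> 'a \<times> 'b" where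
  "denc_prod n = (denc (fst (prod_decode n)), denc (snd (prod_decode n)))"
instance by standard (simp_all add: enc_prod_def denc_prod_def)
end

instantiation list :: (enc) enc
begin
definition enc_list :: "'a list \<Rightarrow> nat" where "enc_list xs = list_encode (map enc xs)"
definition denc_list :: "nat \<Rightarrow> 'a list" where "denc_list n = map denc (list_decode n)"
instance by standard (simp_all add: enc_list_def denc_list_def o_def)
end

definition cpt :: "('a::enc \<Rightarrow> 'b::enc) \<Rightarrow> bool" where
  "cpt f \<longleftrightarrow> computable (\<lambda>n. enc (f (denc n)))"

definition dc :: "('a::enc \<Rightarrow> bool) \<Rightarrow> bool" where
  "dc P \<longleftrightarrow> cpt (\<lambda>x. of_bool (P x) :: nat)"

named_theorems cpt_intros

lemma cpt_iff_rc: "cpt f \<longleftrightarrow> rc 1 (\<lambda>xs. enc (f (denc (xs ! 0))))"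
  by (simp add: cpt_def computable_iff_rc)

lemma cpt_comp: "cpt f \<Longrightarrow> cpt g \<Longrightarrow> cpt (\<lambda>x. f (g x))"
  unfolding cpt_iff_rc using rc1[of "\<lambda>n. enc (f (denc n))" 1 "\<lambda>xs. enc (g (denc (xs ! 0)))"] by simp

lemma cpt_computable: "computable f \<Longrightarrow> cpt f"
  by (simp add: cpt_def)

lemma cpt_id [cpt_intros]: "cpt (\<lambda>x. x)"
  by (simp add: cpt_iff_rc rc_proj)

lemma cpt_const [cpt_intros]: "cpt (\<lambda>x. c)"
  by (simp add: cpt_iff_rc rc_const)

lemma cpt_enc [cpt_intros]: "cpt f \<Longrightarrow> cpt (\<lambda>x. enc (f x))"
  by (simp add: cpt_def)

lemma cpt_denc [cpt_intros]: "cpt f \<Longrightarrow> cpt (\<lambda>x. denc (f x))"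
  by (simp add: cpt_def)

lemma cpt_enc_iff: "cpt (\<lambda>x. enc (f x)) \<longleftrightarrow> cpt f"
  by (simp add: cpt_def)

lemma cpt_Pair [cpt_intros]: "cpt f \<Longrightarrow> cpt g \<Longrightarrow> cpt (\<lambda>x. (f x, g x))"
  by (simp add: cpt_iff_rc enc_prod_def rc_prod_encode)

lemma cpt_fst [cpt_intros]: "cpt f \<Longrightarrow> cpt (\<lambda>x. fst (f x))"
  using rc_fst_decode[of 1 "\<lambda>xs. enc (f (denc (xs ! 0)))"] by (simp add: cpt_iff_rc enc_prod_def)

lemma cpt_snd [cpt_intros]: "cpt f \<Longrightarrow> cpt (\<lambda>x. snd (f x))"
  using rc_snd_decode[of 1 "\<lambda>xs. enc (f (denc (xs ! 0)))"] by (simp add: cpt_iff_rc enc_prod_def)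

lemma cpt_Suc [cpt_intros]: "cpt f \<Longrightarrow> cpt (\<lambda>x. Suc (f x))"
  by (simp add: cpt_iff_rc rc_Suc)

lemma cpt_add [cpt_intros]: "cpt f \<Longrightarrow> cpt g \<Longrightarrow> cpt (\<lambda>x. f x + g x :: nat)"
  by (simp add: cpt_iff_rc rc_add)

lemma cpt_diff [cpt_intros]: "cpt f \<Longrightarrow> cpt g \<Longrightarrow> cpt (\<lambda>x. f x - g x :: nat)"
  by (simp add: cpt_iff_rc rc_diff)

text \<open>The step function enters as a function of one nested pair. Functions of several
  arguments and bodies under a binder have this uncurried form throughout, with the surrounding
  argument \<open>x\<close> as the last component.\<close>

lemma cpt_rec_nat [cpt_intros]:
  assumes "cpt a" "cpt b" "cpt (\<lambda>p. h (fst p) (fst (snd p)) (snd (snd p)))"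
  shows "cpt (\<lambda>x. rec_nat (a x) (\<lambda>m r. h m r x) (b x))"
proof -
  let ?h = "\<lambda>n r x. enc (h n (denc r) (denc x))"
  have h: "rc 3 (\<lambda>xs. ?h (xs ! 0) (xs ! 1) (xs ! 2))"
  proof -
    have "rc 1 (\<lambda>xs. enc ((\<lambda>p. h (fst p) (fst (snd p)) (snd (snd p))) (denc (xs ! 0))))"
      using assms(3) unfolding cpt_iff_rc .
    then have "rc 3 (\<lambda>xs. enc ((\<lambda>p. h (fst p) (fst (snd p)) (snd (snd p))) (denc (prod_encode (xs ! 0, prod_encode (xs ! 1, xs ! 2))))))"
      by (rule rc1) (intro rc_prod_encode rc_proj; simp)
    then show ?thesis
      by (simp only: denc_prod_def prod_encode_inverse fst_conv snd_conv denc_nat_def)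
  qed
  have "rc 1 (\<lambda>xs. rec_nat (enc (a (denc (xs ! 0)))) (\<lambda>n r. ?h n r (xs ! 0)) (enc (b (denc (xs ! 0)))))"
  proof (rule rc_rec[where h = ?h and b = "\<lambda>n. enc (a (denc n))"])
    show "rc 1 (\<lambda>xs. xs ! 0)"
      by (rule rc_proj) simp
    show "rc 1 (\<lambda>xs. enc (a (denc (xs ! 0))))" "rc 1 (\<lambda>xs. enc (b (denc (xs ! 0))))"
      using assms by (simp_all only: cpt_iff_rc)
  qed (rule h)
  moreover have "rec_nat (enc (a x)) (\<lambda>n r. enc (h n (denc r) x)) m = enc (rec_nat (a x) (\<lambda>m r. h m r x) m)" for x m
    by (induction m) auto
  ultimately show ?thesis
    by (simp add: cpt_iff_rc)
qed

section \<open>Decidable predicates, bounded quantifiers and search\<close>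

lemma cpt_of_bool [cpt_intros]: "dc P \<Longrightarrow> cpt (\<lambda>x. of_bool (P x) :: nat)"
  by (simp add: dc_def)

lemma dc_bool_fun: "cpt f \<Longrightarrow> dc (\<lambda>x. f x \<noteq> (0 :: nat))"
proof -
  assume "cpt f"
  then have "cpt (\<lambda>x. 1 - (1 - f x))"
    by (intro cpt_intros)
  moreover have "1 - (1 - f x) = of_bool (f x \<noteq> 0)" for x
    by simp
  ultimately show ?thesis
    by (simp add: dc_def)
qed

lemma cpt_If [cpt_intros]:
  assumes "dc P" "cpt f" "cpt g"
  shows "cpt (\<lambda>x. if P x then f x else g x)"
proof -
  have "cpt (\<lambda>x. rec_nat (g x) (\<lambda>_ _. f x) (of_bool (P x)))"
    by (intro cpt_intros assms cpt_comp[OF assms(2)])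
  moreover have "rec_nat (g x) (\<lambda>_ _. f x) (of_bool (P x)) = (if P x then f x else g x)" for x
    by simp
  ultimately show ?thesis
    by simp
qed

lemma dc_If [cpt_intros]: "dc P \<Longrightarrow> dc Q \<Longrightarrow> dc R \<Longrightarrow> dc (\<lambda>x. if P x then Q x else R x)"
  using cpt_If[of P "\<lambda>x. of_bool (Q x) :: nat" "\<lambda>x. of_bool (R x)"]
  by (simp add: dc_def if_distrib cong: if_cong)

lemma dc_const [cpt_intros]: "dc (\<lambda>x. b)"
  by (simp add: dc_def cpt_const)

lemma dc_Not [cpt_intros]: "dc P \<Longrightarrow> dc (\<lambda>x. \<not> P x)"
proof -
  assume "dc P"
  then have "cpt (\<lambda>x. 1 - of_bool (P x) :: nat)"
    by (intro cpt_intros)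
  moreover have "(\<lambda>x. 1 - of_bool (P x)) = (\<lambda>x. of_bool (\<not> P x) :: nat)"
    by auto
  ultimately show ?thesis
    by (simp only: dc_def)
qed

lemma dc_conj [cpt_intros]: "dc P \<Longrightarrow> dc Q \<Longrightarrow> dc (\<lambda>x. P x \<and> Q x)"
proof -
  assume *: "dc P" "dc Q"
  have "(\<lambda>x. P x \<and> Q x) = (\<lambda>x. if P x then Q x else False)"
    by auto
  then show ?thesis
    by (simp only:) (intro dc_If * dc_const)
qed

lemma dc_disj [cpt_intros]: "dc P \<Longrightarrow> dc Q \<Longrightarrow> dc (\<lambda>x. P x \<or> Q x)"
proof -
  assume *: "dc P" "dc Q"
  have "(\<lambda>x. P x \<or> Q x) = (\<lambda>x. if P x then True else Q x)"
    by auto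
  then show ?thesis
    by (simp only:) (intro dc_If * dc_const)
qed

lemma dc_imp [cpt_intros]: "dc P \<Longrightarrow> dc Q \<Longrightarrow> dc (\<lambda>x. P x \<longrightarrow> Q x)"
  unfolding imp_conv_disj by (intro dc_disj dc_Not)

lemma dc_zero: "cpt f \<Longrightarrow> dc (\<lambda>x. f x = (0 :: nat))"
  using dc_Not[OF dc_bool_fun[of f]] by simp

lemma dc_le [cpt_intros]: "cpt f \<Longrightarrow> cpt g \<Longrightarrow> dc (\<lambda>x. f x \<le> (g x :: nat))"
  using dc_zero[of "\<lambda>x. f x - g x"] by (simp add: cpt_diff)

lemma dc_less [cpt_intros]: "cpt f \<Longrightarrow> cpt g \<Longrightarrow> dc (\<lambda>x. f x < (g x :: nat))"
  using dc_Not[OF dc_le[of g f]] by (simp add: not_le)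

lemma dc_eq [cpt_intros]: "cpt f \<Longrightarrow> cpt g \<Longrightarrow> dc (\<lambda>x. f x = g x)"
proof -
  assume *: "cpt f" "cpt g"
  have "(\<lambda>x. f x = g x) = (\<lambda>x. enc (f x) \<le> enc (g x) \<and> enc (g x) \<le> enc (f x))"
    by (rule ext) (metis antisym enc_eq_iff order_refl)
  then show ?thesis
    by (simp only:) (intro cpt_intros *)
qed

lemma dc_iff [cpt_intros]: "dc P \<Longrightarrow> dc Q \<Longrightarrow> dc (\<lambda>x. P x \<longleftrightarrow> Q x)"
proof -
  assume *: "dc P" "dc Q"
  have "(\<lambda>x. P x \<longleftrightarrow> Q x) = (\<lambda>x. if P x then Q x else \<not> Q x)"
    by auto
  then show ?thesis
    by (simp only:) (intro dc_If * dc_Not)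
qed

lemma dc_comp: "dc P \<Longrightarrow> cpt f \<Longrightarrow> dc (\<lambda>x. P (f x))"
  unfolding dc_def by (rule cpt_comp)

lemma dc_Ex_less [cpt_intros]:
  fixes P :: "nat \<Rightarrow> 'a::enc \<Rightarrow> bool"
  assumes "cpt b" "dc (\<lambda>p. P (fst p) (snd p))"
  shows "dc (\<lambda>x. \<exists>y<b x. P y x)"
proof -
  have "cpt (\<lambda>x. rec_nat (0 :: nat) (\<lambda>m r. if P m x then 1 else r) (b x))"
    by (intro cpt_intros assms dc_comp[OF assms(2), of "\<lambda>p. (fst p, snd (snd p))", simplified])
  moreover have "rec_nat (0 :: nat) (\<lambda>m r. if P m x then 1 else r) n = of_bool (\<exists>y<n. P y x)" for x n
    by (induction n) (auto simp: less_Suc_eq)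
  ultimately show ?thesis
    by (simp add: dc_def)
qed

lemma dc_All_less [cpt_intros]:
  fixes P :: "nat \<Rightarrow> 'a::enc \<Rightarrow> bool"
  assumes "cpt b" "dc (\<lambda>p. P (fst p) (snd p))"
  shows "dc (\<lambda>x. \<forall>y<b x. P y x)"
proof -
  have "dc (\<lambda>x. \<not> (\<exists>y<b x. \<not> P y x))"
    by (intro cpt_intros assms)
  then show ?thesis
    by simp
qed

lemma cpt_Least:
  fixes P :: "nat \<Rightarrow> 'a::enc \<Rightarrow> bool"
  assumes "dc (\<lambda>p. P (fst p) (snd p))" "\<And>x. \<exists>n. P n x"
  shows "cpt (\<lambda>x. LEAST n. P n x)"
proof -
  let ?f = "\<lambda>n x. of_bool (\<not> P n (denc x)) :: nat"
  have "cpt (\<lambda>p. of_bool (\<not> P (fst p) (snd p)) :: nat)"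
    by (intro cpt_intros assms)
  then have "rc 1 (\<lambda>xs. (\<lambda>n. ?f (fst (prod_decode n)) (snd (prod_decode n))) (xs ! 0))"
    by (simp add: cpt_iff_rc denc_prod_def)
  then have "rc (1 + 1) (\<lambda>xs. ?f (fst (prod_decode (prod_encode (xs ! 0, xs ! 1)))) (snd (prod_decode (prod_encode (xs ! 0, xs ! 1)))))"
    by (rule rc1) (intro rc_prod_encode rc_proj; simp)
  then have "rc (1 + 1) (\<lambda>xs. ?f (xs ! 0) (xs ! 1))"
    by simp
  then have "rc 1 (\<lambda>xs. LEAST n. ?f ((n # xs) ! 0) ((n # xs) ! 1) = 0)"
    by (rule rc_mu) (use assms(2) in simp)
  then show ?thesis
    by (simp add: cpt_iff_rc)
qed

lemma cpt_mult [cpt_intros]: "cpt f \<Longrightarrow> cpt g \<Longrightarrow> cpt (\<lambda>x. f x * (g x :: nat))"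
proof -
  assume *: "cpt f" "cpt g"
  have "cpt (\<lambda>x. rec_nat 0 (\<lambda>_ r. r + g x) (f x))"
    by (intro cpt_intros * cpt_comp[OF *(2)])
  moreover have "rec_nat 0 (\<lambda>_ r. r + y) n = n * y" for y n :: nat
    by (induction n) auto
  ultimately show ?thesis
    by simp
qed

lemma cpt_power [cpt_intros]: "cpt f \<Longrightarrow> cpt g \<Longrightarrow> cpt (\<lambda>x. f x ^ g x :: nat)"
proof -
  assume *: "cpt f" "cpt g"
  have "cpt (\<lambda>x. rec_nat 1 (\<lambda>_ r. r * f x) (g x))"
    by (intro cpt_intros * cpt_comp[OF *(1)])
  moreover have "rec_nat 1 (\<lambda>_ r. r * y) n = y ^ n" for y n :: nat
    by (induction n) auto
  ultimately show ?thesis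
    by simp
qed

lemma cpt_div [cpt_intros]: "cpt f \<Longrightarrow> cpt g \<Longrightarrow> cpt (\<lambda>x. f x div g x :: nat)"
proof -
  assume *: "cpt f" "cpt g"
  \<comment> \<open>Minimization needs a witness for every argument; the implication inside it
    supplies one when the divisor is 0.\<close>
  have "cpt (\<lambda>x. if g x = 0 then 0 else LEAST q. g x \<noteq> 0 \<longrightarrow> f x < Suc q * g x)"
  proof (intro cpt_intros *)
    show "cpt (\<lambda>x. LEAST q. g x \<noteq> 0 \<longrightarrow> f x < Suc q * g x)"
    proof (rule cpt_Least)
      show "dc (\<lambda>p. g (snd p) \<noteq> 0 \<longrightarrow> f (snd p) < Suc (fst p) * g (snd p))"
        by (intro cpt_intros cpt_comp[OF *(1)] cpt_comp[OF *(2)])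
      show "\<exists>q. g x \<noteq> 0 \<longrightarrow> f x < Suc q * g x" for x
        by (cases "g x") (auto intro!: exI[of _ "f x"])
    qed
  qed
  moreover have "(if b = 0 then 0 else LEAST q. b \<noteq> 0 \<longrightarrow> a < Suc q * b) = a div b" for a b :: nat
  proof (cases "b = 0")
    case False
    then have "(LEAST q. b \<noteq> 0 \<longrightarrow> a < Suc q * b) = a div b"
      by (intro Least_equality) (auto simp: dividend_less_times_div dividend_less_div_times less_mult_imp_div_less less_Suc_eq_le[symmetric])
    with False show ?thesis by simp
  qed simp
  ultimately show ?thesis
    by simp
qed

lemma cpt_mod [cpt_intros]: "cpt f \<Longrightarrow> cpt g \<Longrightarrow> cpt (\<lambda>x. f x mod g x :: nat)"
  unfolding minus_div_mult_eq_mod[symmetric] by (intro cpt_intros)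

lemma dc_odd [cpt_intros]: "cpt f \<Longrightarrow> dc (\<lambda>x. odd (f x :: nat))"
proof -
  assume *: "cpt f"
  have "(\<lambda>x. odd (f x)) = (\<lambda>x. f x div 2 * 2 \<noteq> f x)"
    by (rule ext) presburger
  then show ?thesis
    by (simp only:) (intro cpt_intros *)
qed

section \<open>Functions on lists\<close>

lemma enc_Nil: "enc [] = 0"
  by (simp add: enc_list_def)

lemma enc_Cons: "enc (x # xs) = Suc (prod_encode (enc x, enc xs))"
  by (simp add: enc_list_def)

lemma cpt_Cons [cpt_intros]: "cpt f \<Longrightarrow> cpt g \<Longrightarrow> cpt (\<lambda>x. f x # g x)"
proof -
  assume *: "cpt f" "cpt g"
  have "cpt (\<lambda>x. Suc (enc (f x, g x)))"
    by (intro cpt_intros *)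
  then have "cpt (\<lambda>x. enc (f x # g x))"
    by (simp add: enc_Cons enc_prod_def)
  then show ?thesis
    by (simp only: cpt_enc_iff)
qed

text \<open>Unlike \<open>nth\<close>, whose values beyond the end of the list are unspecified, this function is
  computable.\<close>

definition lk :: "'a::enc list \<Rightarrow> nat \<Rightarrow> 'a" where
  "lk xs i = (if i < length xs then xs ! i else denc 0)"

lemma lk_nth [simp]: "i < length xs \<Longrightarrow> lk xs i = xs ! i"
  by (simp add: lk_def)

lemma prod_decode_0: "prod_decode 0 = (0, 0)"
  by (simp add: prod_decode_def prod_decode_aux.simps)

lemma cpt_tl [cpt_intros]: "cpt f \<Longrightarrow> cpt (\<lambda>x. tl (f x))"
proof -
  assume *: "cpt f"
  \<comment> \<open>A nonempty list is coded by the successor of a pair. For the empty list,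
    truncated subtraction gives 0, the code of the pair \<open>(0, 0)\<close>, whose second
    component is again the code of the empty list.\<close>
  have "tl xs = denc (snd (denc (enc xs - 1) :: nat \<times> nat))" for xs :: "'b list"
  proof (cases xs)
    case Nil
    then show ?thesis
      by (metis denc_enc denc_nat_def denc_prod_def diff_0_eq_0 enc_Nil list.sel(2) prod_decode_0 snd_conv)
  qed (simp add: enc_Cons denc_prod_def)
  then show ?thesis
    by (simp only:) (intro cpt_intros *)
qed

text \<open>The default value \<open>denc 0\<close> of \<open>lk\<close> is what the arithmetic
  decoding yields on the empty list.\<close>

lemma cpt_lk_0: "cpt f \<Longrightarrow> cpt (\<lambda>x. lk (f x) 0)"
proof -
  assume *: "cpt f"
  have "lk xs 0 = denc (fst (denc (enc xs - 1) :: nat \<times> nat))" for xs :: "'b list"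
    by (cases xs) (simp_all add: enc_Cons denc_prod_def enc_Nil prod_decode_0 lk_def)
  then show ?thesis
    by (simp only:) (intro cpt_intros *)
qed

lemma cpt_drop [cpt_intros]: "cpt n \<Longrightarrow> cpt f \<Longrightarrow> cpt (\<lambda>x. drop (n x) (f x))"
proof -
  assume *: "cpt n" "cpt f"
  have "drop m xs = rec_nat xs (\<lambda>_ r. tl r) m" for m and xs :: "'b list"
    by (induction m) (auto simp: drop_Suc tl_drop[symmetric])
  then show ?thesis
    by (simp only:) (intro cpt_intros *)
qed

lemma cpt_lk [cpt_intros]: "cpt f \<Longrightarrow> cpt n \<Longrightarrow> cpt (\<lambda>x. lk (f x) (n x))"
proof -
  assume *: "cpt f" "cpt n"
  have "lk xs m = lk (drop m xs) 0" for m and xs :: "'b list"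
    by (simp add: lk_def)
  then show ?thesis
    using cpt_lk_0[OF cpt_drop[OF *(2,1)]] by simp
qed

lemma cpt_length [cpt_intros]: "cpt f \<Longrightarrow> cpt (\<lambda>x. length (f x))"
proof -
  assume *: "cpt f"
  have "length xs = (LEAST n. drop n xs = [])" for xs :: "'b list"
    by (rule Least_equality[symmetric]) auto
  moreover have "cpt (\<lambda>x. LEAST n. drop n (f x) = [])"
    by (rule cpt_Least) (intro cpt_intros cpt_comp[OF *], auto)
  ultimately show ?thesis
    by simp
qed

lemma foldl_rec_nat: "foldl f a xs = rec_nat a (\<lambda>i r. f r (lk xs i)) (length xs)"
proof -
  have "rec_nat a (\<lambda>i r. f r (lk xs i)) n = foldl f a (take n xs)" if "n \<le> length xs" for n
    using that by (induction n) (simp_all add: take_Suc_conv_app_nth)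
  then show ?thesis
    by simp
qed

lemma cpt_foldl [cpt_intros]:
  assumes "cpt (\<lambda>p. f (fst p) (fst (snd p)) (snd (snd p)))" "cpt a" "cpt xs"
  shows "cpt (\<lambda>x. foldl (\<lambda>r y. f r y x) (a x) (xs x))"
  unfolding foldl_rec_nat
  by (intro cpt_intros assms cpt_comp[OF assms(3)]
      cpt_comp[OF assms(1), of "\<lambda>p. (fst (snd p), lk (xs (snd (snd p))) (fst p), snd (snd p))", simplified])

lemma cpt_rev [cpt_intros]: "cpt f \<Longrightarrow> cpt (\<lambda>x. rev (f x))"
proof -
  assume *: "cpt f"
  have "foldl (\<lambda>r y. y # r) ys xs = rev xs @ ys" for xs ys :: "'b list"
    by (induction xs arbitrary: ys) auto
  from this[of "[]"] have "rev xs = foldl (\<lambda>r y. y # r) [] xs" for xs :: "'b list"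
    by simp
  then show ?thesis
    by (simp only:) (intro cpt_intros *)
qed

lemma cpt_append [cpt_intros]: "cpt f \<Longrightarrow> cpt g \<Longrightarrow> cpt (\<lambda>x. f x @ g x)"
proof -
  assume *: "cpt f" "cpt g"
  have "xs @ ys = foldl (\<lambda>r y. y # r) ys (rev xs)" for xs ys :: "'b list"
    by (induction xs) auto
  then show ?thesis
    by (simp only:) (intro cpt_intros *)
qed

lemma cpt_map [cpt_intros]:
  assumes "cpt (\<lambda>p. f (fst p) (snd p))" "cpt xs"
  shows "cpt (\<lambda>x. map (\<lambda>y. f y x) (xs x))"
proof -
  have "foldl (\<lambda>r y. r @ [g y]) zs ys = zs @ map g ys" for g :: "'a \<Rightarrow> 'c" and ys zs
    by (induction ys arbitrary: zs) auto
  from this[of _ "[]"] have "map g ys = foldl (\<lambda>r y. r @ [g y]) [] ys" for g :: "'a \<Rightarrow> 'c" and ys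
    by simp
  then show ?thesis
    by (simp only:) (intro cpt_intros assms
      cpt_comp[OF assms(1), of "\<lambda>p. (fst (snd p), snd (snd p))", simplified])
qed

lemma cpt_concat [cpt_intros]: "cpt f \<Longrightarrow> cpt (\<lambda>x. concat (f x))"
proof -
  assume *: "cpt f"
  have "foldl (@) ys xss = ys @ concat xss" for xss and ys :: "'b list"
    by (induction xss arbitrary: ys) auto
  from this[of "[]"] have "concat xss = foldl (\<lambda>r y. r @ y) [] xss" for xss :: "'b list list"
    by simp
  then show ?thesis
    by (simp only:) (intro cpt_intros *)
qed

lemma filter_eq_concat: "filter P xs = concat (map (\<lambda>x. if P x then [x] else []) xs)"
  by (induction xs) auto

lemma cpt_filter [cpt_intros]:
  assumes "dc (\<lambda>p. P (fst p) (snd p))" "cpt xs"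
  shows "cpt (\<lambda>x. filter (\<lambda>y. P y x) (xs x))"
  unfolding filter_eq_concat by (intro cpt_intros assms dc_comp[OF assms(1), of "\<lambda>p. (fst p, snd p)", simplified])

lemma cpt_upt [cpt_intros]: "cpt f \<Longrightarrow> cpt (\<lambda>x. [0..<f x])"
proof -
  assume *: "cpt f"
  have "[0..<n] = rec_nat [] (\<lambda>m r. r @ [m]) n" for n
    by (induction n) auto
  then show ?thesis
    by (simp only:) (intro cpt_intros *)
qed

lemma cpt_replicate [cpt_intros]: "cpt n \<Longrightarrow> cpt f \<Longrightarrow> cpt (\<lambda>x. replicate (n x) (f x))"
proof -
  assume *: "cpt n" "cpt f"
  have "replicate m y = rec_nat [] (\<lambda>_ r. y # r) m" for m and y :: 'b
    by (induction m) auto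
  then show ?thesis
    by (simp only:) (intro cpt_intros * cpt_comp[OF *(2)])
qed

lemma cpt_take [cpt_intros]: "cpt n \<Longrightarrow> cpt f \<Longrightarrow> cpt (\<lambda>x. take (n x) (f x))"
proof -
  assume *: "cpt n" "cpt f"
  have "take m xs = map (lk xs) [0..<if m < length xs then m else length xs]" for m and xs :: "'b list"
    by (rule nth_equalityI) (auto simp: lk_def)
  moreover have "cpt (\<lambda>x. map (\<lambda>i. lk (f x) i) [0..<if n x < length (f x) then n x else length (f x)])"
    by (intro cpt_intros * cpt_comp[OF *(2)])
  ultimately show ?thesis
    by simp
qed

lemma dc_member [cpt_intros]: "cpt f \<Longrightarrow> cpt g \<Longrightarrow> dc (\<lambda>x. f x \<in> set (g x))"
proof -
  assume *: "cpt f" "cpt g"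
  have "y \<in> set ys \<longleftrightarrow> (\<exists>i<length ys. lk ys i = y)" for y and ys :: "'b list"
    unfolding in_set_conv_nth by (intro ex_cong) auto
  then show ?thesis
    by (simp only:) (intro cpt_intros cpt_comp[OF *(1)] cpt_comp[OF *(2)] *)
qed

lemma dc_Ball_list [cpt_intros]:
  assumes "cpt xs" "dc (\<lambda>p. P (fst p) (snd p))"
  shows "dc (\<lambda>x. \<forall>y \<in> set (xs x). P y x)"
proof -
  have "(\<forall>y \<in> set ys. P y x) \<longleftrightarrow> (\<forall>i<length ys. P (lk ys i) x)" for x ys
    by (metis in_set_conv_nth lk_nth)
  then show ?thesis
    by (simp only:) (intro cpt_intros assms cpt_comp[OF assms(1)]
      dc_comp[OF assms(2), of "\<lambda>p. (lk (xs (snd p)) (fst p), snd p)", simplified])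
qed

lemma dc_Bex_list [cpt_intros]:
  assumes "cpt xs" "dc (\<lambda>p. P (fst p) (snd p))"
  shows "dc (\<lambda>x. \<exists>y \<in> set (xs x). P y x)"
  using dc_Not[OF dc_Ball_list[of xs "\<lambda>y x. \<not> P y x"]] assms by (simp add: dc_Not)

subsection \<open>Recursively enumerable predicates\<close>

definition re :: "('a::enc \<Rightarrow> bool) \<Rightarrow> bool" where
  "re P \<longleftrightarrow> (\<exists>Q. dc Q \<and> (\<forall>x. P x \<longleftrightarrow> (\<exists>n :: nat. Q (n, x))))"

named_theorems re_intros

lemma reE:
  assumes "re P"
  obtains Q where "dc (\<lambda>p. Q (fst p) (snd p))" "\<And>x. P x \<longleftrightarrow> (\<exists>n :: nat. Q n x)"
proof -
  obtain Q where "dc Q" "\<forall>x. P x \<longleftrightarrow> (\<exists>n :: nat. Q (n, x))"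
    using assms by (auto simp: re_def)
  then show thesis
    by (intro that[of "\<lambda>n x. Q (n, x)"]) auto
qed

lemma reI: "dc (\<lambda>p. Q (fst p) (snd p)) \<Longrightarrow> (\<And>x. P x \<longleftrightarrow> (\<exists>n :: nat. Q n x)) \<Longrightarrow> re P"
  unfolding re_def by (intro exI[of _ "\<lambda>p. Q (fst p) (snd p)"]) simp

lemma re_dc: "dc P \<Longrightarrow> re P"
  by (rule reI[of "\<lambda>n. P"]) (auto intro: dc_comp[OF _ cpt_snd[OF cpt_id]])

lemma re_comp: "re P \<Longrightarrow> cpt f \<Longrightarrow> re (\<lambda>x. P (f x))"
proof (elim reE)
  fix Q assume *: "cpt f" "dc (\<lambda>p. Q (fst p) (snd p))" "\<And>x. P x \<longleftrightarrow> (\<exists>n :: nat. Q n x)"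
  show ?thesis
    by (rule reI[of "\<lambda>n x. Q n (f x)"])
      (use *(3) in \<open>auto intro!: cpt_intros cpt_comp[OF *(1)] dc_comp[OF *(2), of "\<lambda>p. (fst p, f (snd p))", simplified]\<close>)
qed

text \<open>One search number codes both the witness \<open>y\<close> and the stage at which
  \<open>P y x\<close> is confirmed.\<close>

lemma re_Ex [re_intros]:
  fixes P :: "'b::enc \<Rightarrow> 'a::enc \<Rightarrow> bool"
  assumes "re (\<lambda>p. P (fst p) (snd p))"
  shows "re (\<lambda>x. \<exists>y. P y x)"
  using assms
proof (elim reE)
  fix Q assume *: "dc (\<lambda>p. Q (fst p) (snd p))" "\<And>p. P (fst p) (snd p) \<longleftrightarrow> (\<exists>n :: nat. Q n p)"
  show ?thesis
  proof (rule reI)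
    show "dc (\<lambda>p. (\<lambda>n x. Q (fst (denc n :: nat \<times> 'b)) (snd (denc n :: nat \<times> 'b), x)) (fst p) (snd p))"
      by (intro cpt_intros dc_comp[OF *(1), of "\<lambda>p. (fst (denc (fst p) :: nat \<times> 'b), snd (denc (fst p) :: nat \<times> 'b), snd p)", simplified])
    show "(\<exists>y. P y x) \<longleftrightarrow> (\<exists>n. Q (fst (denc n :: nat \<times> 'b)) (snd (denc n :: nat \<times> 'b), x))" for x
    proof -
      have "Q n (y, x) \<Longrightarrow> \<exists>n. Q (fst (denc n :: nat \<times> 'b)) (snd (denc n :: nat \<times> 'b), x)" for n y
        by (rule exI[of _ "enc (n, y)"]) (simp only: denc_enc fst_conv snd_conv)
      then show ?thesis
        using *(2) by fastforce
    qed
  qed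
qed

lemma re_conj [re_intros]: "re P \<Longrightarrow> re Q \<Longrightarrow> re (\<lambda>x. P x \<and> Q x)"
proof (elim reE)
  fix A B
  assume *: "dc (\<lambda>p. A (fst p) (snd p))" "\<And>x. P x \<longleftrightarrow> (\<exists>n :: nat. A n x)"
    "dc (\<lambda>p. B (fst p) (snd p))" "\<And>x. Q x \<longleftrightarrow> (\<exists>n :: nat. B n x)"
  have "re (\<lambda>x. \<exists>n m. A n x \<and> B m x)"
    by (intro re_intros re_dc cpt_intros dc_comp[OF *(1), of "\<lambda>p. (fst (snd p), snd (snd p))", simplified]
      dc_comp[OF *(3), of "\<lambda>p. (fst p, snd (snd p))", simplified])
  then show ?thesis
    by (simp add: *)
qed

lemma re_disj [re_intros]: "re P \<Longrightarrow> re Q \<Longrightarrow> re (\<lambda>x. P x \<or> Q x)"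
proof (elim reE)
  fix A B
  assume *: "dc (\<lambda>p. A (fst p) (snd p))" "\<And>x. P x \<longleftrightarrow> (\<exists>n :: nat. A n x)"
    "dc (\<lambda>p. B (fst p) (snd p))" "\<And>x. Q x \<longleftrightarrow> (\<exists>n :: nat. B n x)"
  have "re (\<lambda>x. \<exists>n. A n x \<or> B n x)"
    by (intro re_intros re_dc cpt_intros *)
  then show ?thesis
    by (simp add: * ex_disj_distrib)
qed

lemma re_imp [re_intros]: "dc P \<Longrightarrow> re Q \<Longrightarrow> re (\<lambda>x. P x \<longrightarrow> Q x)"
  unfolding imp_conv_disj by (rule re_disj[OF re_dc[OF dc_Not]])

text \<open>The finitely many stages that confirm the instances are guessed together, as a
  list.\<close>

lemma re_All_less [re_intros]:
  fixes P :: "nat \<Rightarrow> 'a::enc \<Rightarrow> bool"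
  assumes "cpt b" "re (\<lambda>p. P (fst p) (snd p))"
  shows "re (\<lambda>x. \<forall>y<b x. P y x)"
  using assms(2)
proof (elim reE)
  fix Q assume *: "dc (\<lambda>p. Q (fst p) (snd p))" "\<And>p. P (fst p) (snd p) \<longleftrightarrow> (\<exists>n :: nat. Q n p)"
  have "re (\<lambda>x. \<exists>ns. \<forall>y<b x. Q (lk ns y) (y, x))"
    by (intro re_intros re_dc cpt_intros cpt_comp[OF assms(1)]
        dc_comp[OF *(1), of "\<lambda>p. (lk (fst (snd p)) (fst p), fst p, snd (snd p))", simplified])
  moreover have "(\<exists>ns. \<forall>y<b x. Q (lk ns y) (y, x)) \<longleftrightarrow> (\<forall>y<b x. P y x)" for x
  proof
    assume "\<forall>y<b x. P y x"
    then obtain f where "\<forall>y<b x. Q (f y) (y, x)"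
      using *(2) by (simp add: split_paired_all) metis
    then show "\<exists>ns. \<forall>y<b x. Q (lk ns y) (y, x)"
      by (intro exI[of _ "map f [0..<b x]"]) simp
  qed (use *(2) in force)
  ultimately show ?thesis
    by simp
qed

lemma re_Ball_list [re_intros]:
  assumes "cpt xs" "re (\<lambda>p. P (fst p) (snd p))"
  shows "re (\<lambda>x. \<forall>y \<in> set (xs x). P y x)"
proof -
  have "(\<forall>y \<in> set ys. P y x) \<longleftrightarrow> (\<forall>i<length ys. P (lk ys i) x)" for x ys
    by (metis in_set_conv_nth lk_nth)
  then show ?thesis
    by (simp only:) (intro re_intros cpt_intros assms cpt_comp[OF assms(1)]
      re_comp[OF assms(2), of "\<lambda>p. (lk (xs (snd p)) (fst p), snd p)", simplified])
qed

text \<open>The search runs over pairs of a stage and a candidate value; it succeeds because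
  \<open>f\<close> is total.\<close>

lemma cpt_graph:
  fixes f :: "'a::enc \<Rightarrow> 'b::enc"
  assumes "re (\<lambda>p. f (snd p) = fst p)"
  shows "cpt f"
  using assms
proof (elim reE)
  fix Q assume *: "dc (\<lambda>p. Q (fst p) (snd p))" "\<And>p. f (snd p) = fst p \<longleftrightarrow> (\<exists>n :: nat. Q n p)"
  let ?Q = "\<lambda>(n :: nat) (x :: 'a). Q (fst (denc n :: nat \<times> 'b)) (snd (denc n :: nat \<times> 'b), x)"
  let ?n = "\<lambda>x. LEAST n. ?Q n x"
  have ex: "\<exists>n. ?Q n x" for x
  proof -
    obtain n where "Q n (f x, x)"
      using *(2)[of "(f x, x)"] by auto
    then show ?thesis
      by (intro exI[of _ "enc (n, f x)"]) (simp only: denc_enc fst_conv snd_conv)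
  qed
  have "cpt (\<lambda>x. snd (denc (?n x) :: nat \<times> 'b))"
    by (intro cpt_intros cpt_Least ex
      dc_comp[OF *(1), of "\<lambda>p. (fst (denc (fst p) :: nat \<times> 'b), snd (denc (fst p) :: nat \<times> 'b), snd p)", simplified])
  moreover have "snd (denc (?n x) :: nat \<times> 'b) = f x" for x
    using LeastI_ex[OF ex, of x] *(2)[of "(snd (denc (?n x) :: nat \<times> 'b), x)"] by auto
  ultimately show ?thesis
    by simp
qed

text \<open>Both enumerations are run in parallel up to the first stage that confirms either side.
  \<open>A\<close> and \<open>B\<close> may overlap; the value then reports which of them was
  confirmed, with priority for \<open>A\<close>.\<close>

lemma re_decide:
  assumes "re A" "re B" "\<And>x. A x \<or> B x"
  obtains f :: "'a::enc \<Rightarrow> nat" where "cpt f" "\<forall>x. f x = 1 \<and> A x \<or> f x = 0 \<and> B x"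
  using assms(1,2)
proof (elim reE)
  fix P Q
  assume *: "dc (\<lambda>p. P (fst p) (snd p))" "\<And>x. A x \<longleftrightarrow> (\<exists>n :: nat. P n x)"
    "dc (\<lambda>p. Q (fst p) (snd p))" "\<And>x. B x \<longleftrightarrow> (\<exists>n :: nat. Q n x)"
  let ?n = "\<lambda>x. LEAST n. P n x \<or> Q n x"
  have ex: "\<exists>n. P n x \<or> Q n x" for x
    using assms(3)[of x] * by auto
  show thesis
  proof (rule that)
    show "cpt (\<lambda>x. of_bool (P (?n x) x) :: nat)"
      by (intro cpt_intros dc_comp[OF *(1), of "\<lambda>x. (?n x, x)", simplified] cpt_Least * ex)
    show "\<forall>x. of_bool (P (?n x) x) = (1 :: nat) \<and> A x \<or> of_bool (P (?n x) x) = (0 :: nat) \<and> B x"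
    proof
      show "of_bool (P (?n x) x) = (1 :: nat) \<and> A x \<or> of_bool (P (?n x) x) = (0 :: nat) \<and> B x" for x
        using LeastI_ex[OF ex, of x] * by auto
    qed
  qed
qed

text \<open>The graph of \<open>F\<close> is recursively enumerable: a value is certified by a finite set of pairs
  that contains with each pair the pairs of its recursive calls.\<close>

lemma cpt_wf_recursion:
  fixes F :: "'a::enc \<Rightarrow> 'b::enc" and m :: "'a \<Rightarrow> nat"
  assumes calls: "cpt calls" and G: "cpt (\<lambda>p. G (fst p) (snd p))"
    and F: "\<And>x. F x = G x (map F (calls x))"
    and wf: "\<And>x y. y \<in> set (calls x) \<Longrightarrow> m y < m x"
  shows "cpt F"
proof -
  define D :: "('a \<times> 'b) list \<Rightarrow> bool" where
    "D L \<longleftrightarrow> (\<forall>p \<in> set L. \<exists>zs. length zs = length (calls (fst p)) \<and> snd p = G (fst p) zs \<and>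
       (\<forall>t<length zs. (lk (calls (fst p)) t, lk zs t) \<in> set L))" for L
  have sound: "z = F x" if "D L" "(x, z) \<in> set L" for L x z
    using that(2)
  proof (induction "m x" arbitrary: x z rule: less_induct)
    case less
    obtain zs where zs: "length zs = length (calls x)" "z = G x zs"
      "\<forall>t<length zs. (lk (calls x) t, lk zs t) \<in> set L"
      using \<open>D L\<close> less.prems unfolding D_def by force
    have "zs ! t = F (calls x ! t)" if "t < length zs" for t
      using less.hyps[of "calls x ! t" "zs ! t"] zs(1,3) that wf by simp
    then have "zs = map F (calls x)"
      using zs(1) by (intro nth_equalityI) auto
    then show ?case
      using zs(2) F by simp
  qed
  have complete: "\<exists>L. D L \<and> (x, F x) \<in> set L" for x
  proof (induction "m x" arbitrary: x rule: less_induct)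
    case less
    have "\<forall>y. \<exists>L. y \<in> set (calls x) \<longrightarrow> D L \<and> (y, F y) \<in> set L"
      using less wf by blast
    then obtain l where l: "\<And>y. y \<in> set (calls x) \<Longrightarrow> D (l y) \<and> (y, F y) \<in> set (l y)"
      by metis
    let ?L = "(x, F x) # concat (map l (calls x))"
    have "\<exists>zs. length zs = length (calls (fst p)) \<and> snd p = G (fst p) zs \<and>
       (\<forall>t<length zs. (lk (calls (fst p)) t, lk zs t) \<in> set ?L)" if p: "p \<in> set ?L" for p
    proof (cases "p = (x, F x)")
      case True
      have "(lk (calls x) t, lk (map F (calls x)) t) \<in> set ?L" if "t < length (calls x)" for t
        using that l[of "calls x ! t"] by force
      then show ?thesis
        using True F by (intro exI[of _ "map F (calls x)"]) simp
    next
      case False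
      then obtain y where y: "y \<in> set (calls x)" "p \<in> set (l y)"
        using p by auto
      then obtain zs where "length zs = length (calls (fst p))" "snd p = G (fst p) zs"
        "\<forall>t<length zs. (lk (calls (fst p)) t, lk zs t) \<in> set (l y)"
        using l[OF y(1)] unfolding D_def by blast
      with y(1) show ?thesis
        by (intro exI[of _ zs]) auto
    qed
    then have "D ?L"
      unfolding D_def by blast
    then show ?case
      by (intro exI[of _ ?L]) simp
  qed
  have "re (\<lambda>p. \<exists>L. D L \<and> (snd p, fst p) \<in> set L)"
    unfolding D_def
    by (intro re_intros re_dc cpt_intros cpt_comp[OF calls]
      cpt_comp[OF G, of "\<lambda>p. (fst (fst (snd p)), fst p)", simplified])
  moreover have "(\<exists>L. D L \<and> (x, z) \<in> set L) \<longleftrightarrow> F x = z" for x z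
    using sound complete by metis
  ultimately show ?thesis
    by (intro cpt_graph) simp
qed

subsection \<open>Infinite products\<close>

text \<open>The first \<open>i + 1\<close> factors have total length greater than \<open>i\<close>
  as long as none is empty. With empty factors the letter read may be unspecified.\<close>

definition prodw :: "(nat \<Rightarrow> 'l list) \<Rightarrow> 'l word" where
  "prodw x i = concat (map x [0..<Suc i]) ! i"

definition off :: "(nat \<Rightarrow> 'l list) \<Rightarrow> nat \<Rightarrow> nat" where
  "off x n = (\<Sum>i<n. length (x i))"

lemma off_0 [simp]: "off x 0 = 0"
  by (simp add: off_def)

lemma off_Suc [simp]: "off x (Suc n) = off x n + length (x n)"
  by (simp add: off_def)

lemma off_eq_length: "off x n = length (concat (map x [0..<n]))"
  by (induction n) auto

lemma off_cong: "(\<And>i. length (x i) = length (y i)) \<Longrightarrow> off x = off y"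
  by (simp add: off_def fun_eq_iff)

lemma off_mono: "i \<le> j \<Longrightarrow> off x i \<le> off x j"
  unfolding off_def by (rule sum_mono2) auto

lemma le_off: "(\<And>i. x i \<noteq> []) \<Longrightarrow> n \<le> off x n"
proof (induction n)
  case (Suc n)
  have "length (x n) > 0"
    using Suc.prems by simp
  then show ?case
    using Suc.IH[OF Suc.prems] by (simp only: off_Suc)
qed simp

lemma concat_nth_off:
  assumes "i < n" "j < length (x i)"
  shows "concat (map x [0..<n]) ! (off x i + j) = x i ! j"
  using assms
proof (induction n)
  case (Suc n)
  show ?case
  proof (cases "i = n")
    case True
    then show ?thesis
      using Suc.prems by (simp add: nth_append off_eq_length)
  next
    case False
    then have "i < n"
      using Suc.prems by simp
    moreover have "off x i + j < off x n"
      using off_mono[of "Suc i" n x] \<open>i < n\<close> Suc.prems by simp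
    ultimately show ?thesis
      using Suc by (simp add: nth_append off_eq_length)
  qed
qed simp

lemma prodw_off:
  assumes "\<And>i. x i \<noteq> []" "j < length (x i)"
  shows "prodw x (off x i + j) = x i ! j"
proof -
  have "i \<le> off x i"
    by (rule le_off) (rule assms)
  then show ?thesis
    unfolding prodw_def by (intro concat_nth_off) (use assms in auto)
qed

lemma off_cases:
  assumes "\<And>i. x i \<noteq> []"
  obtains i j where "n = off x i + j" "j < length (x i)"
proof -
  have "\<exists>i j. n = off x i + j \<and> j < length (x i)"
  proof (induction n)
    case 0
    then show ?case
      using assms[of 0] by (intro exI[of _ 0]) auto
  next
    case (Suc n)
    then obtain i j where ij: "n = off x i + j" "j < length (x i)"
      by blast
    show ?case
    proof (cases "Suc j < length (x i)")
      case True
      then show ?thesis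
        using ij by (intro exI[of _ i] exI[of _ "Suc j"]) auto
    next
      case False
      then show ?thesis
        using ij assms[of "Suc i"] by (intro exI[of _ "Suc i"] exI[of _ 0]) auto
    qed
  qed
  then show ?thesis
    using that by blast
qed

lemma prodw_eqI:
  assumes "\<And>i. x i \<noteq> []" "\<And>i j. j < length (x i) \<Longrightarrow> w (off x i + j) = x i ! j"
  shows "w = prodw x"
proof
  fix n
  obtain i j where "n = off x i + j" "j < length (x i)"
    by (rule off_cases[of x n]) (rule assms(1))
  then show "w n = prodw x n"
    using assms prodw_off[OF assms(1)] by simp
qed

lemma prefix_prodw:
  assumes "\<And>i. x i \<noteq> []"
  shows "prefix (off x n) (prodw x) = concat (map x [0..<n])"
proof (rule nth_equalityI)
  show "length (prefix (off x n) (prodw x)) = length (concat (map x [0..<n]))"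
    by (simp add: off_eq_length)
  fix k assume "k < length (prefix (off x n) (prodw x))"
  then have k: "k < off x n"
    by simp
  obtain i j where ij: "k = off x i + j" "j < length (x i)"
    by (rule off_cases[of x k]) (rule assms)
  have "i < n"
    using k ij off_mono[of n i x] by (meson le_add1 le_trans not_le)
  then show "prefix (off x n) (prodw x) ! k = concat (map x [0..<n]) ! k"
    using ij k concat_nth_off[of i n j x] prodw_off[of x j i] assms by simp
qed

lemma prodw_eq_if_prefix:
  assumes "\<And>i. x i \<noteq> []" "\<And>n. prefix (off x n) w = concat (map x [0..<n])"
  shows "w = prodw x"
proof
  fix n
  have "n < off x (Suc n)"
    using le_off[of x "Suc n", OF assms(1)] by simp
  then have "w n = prefix (off x (Suc n)) w ! n" "prodw x n = prefix (off x (Suc n)) (prodw x) ! n"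
    by simp_all
  then show "w n = prodw x n"
    by (simp only: assms(2) prefix_prodw[OF assms(1)])
qed

definition block :: "(nat \<Rightarrow> 'l list) \<Rightarrow> nat \<Rightarrow> nat \<Rightarrow> 'l list" where
  "block x i j = concat (map x [i..<j])"

lemma block_append: "i \<le> j \<Longrightarrow> j \<le> k \<Longrightarrow> block x i j @ block x j k = block x i k"
proof -
  assume "i \<le> j" "j \<le> k"
  then have "[i..<k] = [i..<j] @ [j..<k]"
    by (metis le_Suc_ex upt_add_eq_append)
  then show ?thesis
    by (simp add: block_def)
qed

lemma block_nonempty: "(\<And>i. x i \<noteq> []) \<Longrightarrow> i < j \<Longrightarrow> block x i j \<noteq> []"
  by (auto simp: block_def upt_conv_Cons)

lemma prodw_regroup:
  assumes "\<And>i. x i \<noteq> []" "strict_mono k" "k 0 = (0 :: nat)"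
  shows "prodw x = prodw (\<lambda>i. block x (k i) (k (Suc i)))"
proof (rule prodw_eq_if_prefix)
  let ?y = "\<lambda>i. block x (k i) (k (Suc i))"
  have less: "k i < k (Suc i)" for i
    using assms(2) by (simp add: strict_mono_def)
  show "?y i \<noteq> []" for i
    by (rule block_nonempty) (use assms less in auto)
  have eq: "concat (map ?y [0..<n]) = concat (map x [0..<k n])" for n
  proof (induction n)
    case (Suc n)
    have "concat (map x [0..<k (Suc n)]) = block x 0 (k n) @ block x (k n) (k (Suc n))"
      using less[of n] by (subst block_append) (simp_all add: block_def)
    with Suc show ?case
      by (simp add: block_def)
  qed (simp add: assms)
  have "off ?y n = off x (k n)" for n
    by (simp only: off_eq_length eq)
  then show "prefix (off ?y n) (prodw x) = concat (map ?y [0..<n])" for n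
    using prefix_prodw[of x "k n"] assms(1) eq by simp
qed

section \<open>Finite-index congruences and Ramsey factorizations\<close>

definition lasso :: "'l list \<Rightarrow> 'l list \<Rightarrow> nat \<Rightarrow> 'l list" where
  "lasso s e i = (if i = 0 then s else e)"

lemma lasso_nonempty [simp]: "s \<noteq> [] \<Longrightarrow> e \<noteq> [] \<Longrightarrow> lasso s e i \<noteq> []"
  by (simp add: lasso_def)

text \<open>\<open>E\<close> is a congruence of finite index that saturates \<open>P\<close>, as in
  the recognition of omega-languages by finite semigroups. Finite index is expressed by a map
  \<open>t\<close> with finitely many values whose kernel refines \<open>E\<close>. No quotient has
  to be formed, and pairs and power sets of such values serve conjunction and projection.\<close>

locale omega_congruence =
  fixes E :: "'l list \<Rightarrow> 'l list \<Rightarrow> bool" and P :: "'l word \<Rightarrow> bool"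
  assumes refl: "E u u"
    and sym: "E u v \<Longrightarrow> E v u"
    and trans: "E u v \<Longrightarrow> E v w \<Longrightarrow> E u w"
    and append: "E u v \<Longrightarrow> E u' v' \<Longrightarrow> E (u @ u') (v @ v')"
    and finite_index: "\<exists>t :: 'l list \<Rightarrow> nat. finite (range t) \<and> (\<forall>u v. t u = t v \<longrightarrow> E u v)"
    and prodw_imp: "(\<And>i. x i \<noteq> []) \<Longrightarrow> (\<And>i. y i \<noteq> []) \<Longrightarrow> (\<And>i. E (x i) (y i)) \<Longrightarrow>
      P (prodw x) \<Longrightarrow> P (prodw y)"
begin

lemma prodw_cong:
  "(\<And>i. x i \<noteq> []) \<Longrightarrow> (\<And>i. y i \<noteq> []) \<Longrightarrow> (\<And>i. E (x i) (y i)) \<Longrightarrow> P (prodw x) \<longleftrightarrow> P (prodw y)"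
  using prodw_imp[of x y] prodw_imp[of y x] sym by blast

text \<open>A pair \<open>i < j\<close> is coloured by the value of \<open>t\<close> on
  \<open>block z i j\<close>. On an infinite homogeneous set, the blocks between cut points and the
  concatenations of adjacent ones are all equivalent, so their class is idempotent.\<close>

lemma ramsey_factorization:
  assumes z: "\<And>i. z i \<noteq> []"
  obtains m n where "0 < m" "m < n" "E (block z 0 m @ block z m n) (block z 0 m)"
    "E (block z m n @ block z m n) (block z m n)"
    "P (prodw z) \<longleftrightarrow> P (prodw (lasso (block z 0 m) (block z m n)))"
proof -
  obtain t :: "'l list \<Rightarrow> nat" where t: "finite (range t)" "\<And>u v. t u = t v \<Longrightarrow> E u v"
    using finite_index by blast
  obtain N where N: "\<And>u. t u < N"
    using t(1) finite_nat_set_iff_bounded by (metis rangeI)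
  \<comment> \<open>Cut points are positive, which keeps the initial block nonempty.\<close>
  have "\<exists>Y c. Y \<subseteq> {0<..} \<and> infinite Y \<and> c < N \<and>
      (\<forall>i\<in>Y. \<forall>j\<in>Y. i \<noteq> j \<longrightarrow> (\<lambda>S. t (block z (Min S) (Max S))) {i, j} = c)"
    by (rule Ramsey2) (use N in \<open>auto simp: infinite_Ioi\<close>)
  then obtain Y c where Y: "Y \<subseteq> {0<..}" "infinite Y"
    "\<And>i j. i \<in> Y \<Longrightarrow> j \<in> Y \<Longrightarrow> i < j \<Longrightarrow> t (block z i j) = c"
    by (metis (no_types, lifting) Max_insert Max_singleton Min_insert Min_singleton finite.intros
        insert_not_empty max.absorb2 min.absorb1 order.strict_implies_order less_irrefl)
  define k where "k = enumerate Y"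
  have kY: "k i \<in> Y" for i
    unfolding k_def by (rule enumerate_in_set[OF Y(2)])
  have k: "strict_mono k"
    unfolding k_def using Y(2) by (simp add: strict_mono_enumerate)
  have less: "k i < k j" if "i < j" for i j
    using k that by (simp add: strict_mono_def)
  have k0: "0 < k i" for i
    using kY[of i] Y(1) by auto
  have blocks: "E (block z (k i) (k j)) (block z (k i') (k j'))" if "i < j" "i' < j'" for i j i' j'
    by (rule t(2)) (simp add: Y(3) kY less that)
  \<comment> \<open>The initial block extends to \<open>k 1\<close> instead of \<open>k 0\<close>:
    it then ends with a homogeneous block and absorbs \<open>?f\<close>.\<close>
  let ?a = "block z 0 (k 1)" and ?f = "block z (k 1) (k 2)"
  have ff: "E (block z (k i) (k j) @ ?f) (block z (k i) (k j))" if "i < j" for i j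
  proof -
    have "E (block z (k i) (k j) @ ?f) (block z (k i) (k j) @ block z (k j) (k (Suc j)))"
      by (intro append refl blocks) auto
    also have "block z (k i) (k j) @ block z (k j) (k (Suc j)) = block z (k i) (k (Suc j))"
      using less[of i j] less[of j "Suc j"] that by (intro block_append) auto
    finally show ?thesis
      using blocks[of i "Suc j" i j] that trans by auto
  qed
  have "E (block z 0 (k 0) @ block z (k 0) (k 1) @ ?f) (block z 0 (k 0) @ block z (k 0) (k 1))"
    by (intro append refl ff) auto
  then have af: "E (?a @ ?f) ?a"
    using block_append[of 0 "k 0" "k 1" z] less[of 0 1] by (metis append_assoc le0 less_imp_le zero_less_one)
  \<comment> \<open>The cut points are 0, \<open>k 1\<close>, \<open>k 2\<close>, and so on;
    \<open>k 0\<close> is skipped because it lies inside \<open>?a\<close>.\<close>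
  define l where "l i = (if i = 0 then 0 else k i)" for i
  have l: "strict_mono l"
    unfolding strict_mono_Suc_iff l_def using k0 less by auto
  have "P (prodw z) \<longleftrightarrow> P (prodw (\<lambda>i. block z (l i) (l (Suc i))))"
    using prodw_regroup[of z l, OF z l] by (simp add: l_def)
  also have "\<dots> \<longleftrightarrow> P (prodw (lasso ?a ?f))"
  proof (rule prodw_cong)
    show "block z (l i) (l (Suc i)) \<noteq> []" for i
      by (rule block_nonempty[OF z]) (use l in \<open>simp add: strict_mono_def\<close>)
    show "lasso ?a ?f i \<noteq> []" for i
      by (intro lasso_nonempty block_nonempty[OF z] k0 less) auto
    show "E (block z (l i) (l (Suc i))) (lasso ?a ?f i)" for i
      by (cases i) (auto simp: l_def lasso_def refl intro!: blocks)
  qed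
  finally show thesis
    using that[of "k 1" "k 2"] k0 less[of 1 2] af ff[of 1 2] by auto
qed

end

lemma omega_congruence_of_type:
  fixes t :: "'l list \<Rightarrow> 'c"
  assumes "finite (range t)" "\<And>u v. t (u @ v) = m (t u) (t v)"
    "\<And>x y. (\<And>i. x i \<noteq> []) \<Longrightarrow> (\<And>i. y i \<noteq> []) \<Longrightarrow> (\<And>i. t (x i) = t (y i)) \<Longrightarrow> P (prodw x) \<Longrightarrow> P (prodw y)"
  shows "omega_congruence (\<lambda>u v. t u = t v) P"
proof
  obtain f :: "'c \<Rightarrow> nat" where f: "inj_on f (range t)"
    using finite_imp_inj_to_nat_seg[OF assms(1)] by blast
  show "\<exists>t' :: 'l list \<Rightarrow> nat. finite (range t') \<and> (\<forall>u v. t' u = t' v \<longrightarrow> t u = t v)"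
  proof (intro exI conjI)
    show "finite (range (f \<circ> t))"
      using assms(1) by (metis finite_imageI image_comp)
    show "\<forall>u v. (f \<circ> t) u = (f \<circ> t) v \<longrightarrow> t u = t v"
      using f by (simp add: inj_on_def)
  qed
  show "P (prodw y)" if "\<And>i. x i \<noteq> []" "\<And>i. y i \<noteq> []" "\<And>i. t (x i) = t (y i)" "P (prodw x)" for x y
    by (rule assms(3)[OF that])
qed (use assms(2) in auto)

section \<open>Occurrences of letters and of ordered pairs of letters\<close>

lemma range_prodw:
  assumes "\<And>i. x i \<noteq> []"
  shows "range (prodw x) = (\<Union>i. set (x i))"
proof (intro equalityI subsetI)
  fix c assume "c \<in> range (prodw x)"
  then obtain n where n: "c = prodw x n" by blast
  obtain i j where "n = off x i + j" "j < length (x i)"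
    by (rule off_cases[of x n]) (rule assms)
  then show "c \<in> (\<Union>i. set (x i))"
    using n prodw_off[of x j i, OF assms] nth_mem[of j "x i"] by (metis UN_I UNIV_I)
next
  fix c assume "c \<in> (\<Union>i. set (x i))"
  then obtain i j where "j < length (x i)" "c = x i ! j"
    by (auto simp: in_set_conv_nth)
  then show "c \<in> range (prodw x)"
    using prodw_off[of x j i] assms by (metis rangeI)
qed

definition occ :: "('l \<Rightarrow> bool) \<Rightarrow> 'l list \<Rightarrow> bool" where
  "occ \<alpha> u \<longleftrightarrow> (\<exists>c \<in> set u. \<alpha> c)"

definition occ_pair :: "('l \<Rightarrow> bool) \<Rightarrow> ('l \<Rightarrow> bool) \<Rightarrow> 'l list \<Rightarrow> bool" where
  "occ_pair \<alpha> \<beta> u \<longleftrightarrow> (\<exists>j<length u. \<exists>i<j. \<alpha> (u ! i) \<and> \<beta> (u ! j))"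

lemma occ_append [simp]: "occ \<alpha> (u @ v) \<longleftrightarrow> occ \<alpha> u \<or> occ \<alpha> v"
  by (auto simp: occ_def)

lemma occ_nth: "occ \<alpha> u \<longleftrightarrow> (\<exists>i<length u. \<alpha> (u ! i))"
  unfolding occ_def by (metis in_set_conv_nth)

lemma occ_pair_append [simp]:
  "occ_pair \<alpha> \<beta> (u @ v) \<longleftrightarrow> occ_pair \<alpha> \<beta> u \<or> occ_pair \<alpha> \<beta> v \<or> occ \<alpha> u \<and> occ \<beta> v"
  (is "?L \<longleftrightarrow> ?R")
proof
  assume ?L
  then obtain i j where ij: "j < length u + length v" "i < j" "\<alpha> ((u @ v) ! i)" "\<beta> ((u @ v) ! j)"
    by (auto simp: occ_pair_def)
  consider "j < length u" | "i < length u" "length u \<le> j" | "length u \<le> i"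
    by linarith
  then show ?R
  proof cases
    case 1
    then show ?thesis using ij by (auto simp: occ_pair_def nth_append)
  next
    case 2
    then have "\<alpha> (u ! i)" "j - length u < length v" "\<beta> (v ! (j - length u))"
      using ij by (auto simp: nth_append)
    with 2 show ?thesis unfolding occ_nth by blast
  next
    case 3
    then have "occ_pair \<alpha> \<beta> v"
      using ij unfolding occ_pair_def
      by (intro exI[of _ "j - length u"] conjI exI[of _ "i - length u"]) (auto simp: nth_append)
    then show ?thesis by simp
  qed
next
  assume ?R
  then consider i j where "j < length u" "i < j" "\<alpha> (u ! i)" "\<beta> (u ! j)"
    | i j where "j < length v" "i < j" "\<alpha> (v ! i)" "\<beta> (v ! j)"
    | i j where "i < length u" "j < length v" "\<alpha> (u ! i)" "\<beta> (v ! j)"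
    by (auto simp: occ_pair_def occ_nth)
  then show ?L
  proof cases
    case (1 i j)
    then show ?thesis unfolding occ_pair_def
      by (intro exI[of _ j] conjI exI[of _ i]) (auto simp: nth_append)
  next
    case (2 i j)
    then show ?thesis unfolding occ_pair_def
      by (intro exI[of _ "length u + j"] conjI exI[of _ "length u + i"]) (auto simp: nth_append)
  next
    case (3 i j)
    then show ?thesis unfolding occ_pair_def
      by (intro exI[of _ "length u + j"] conjI exI[of _ i]) (auto simp: nth_append)
  qed
qed

lemma ex_prodw_iff:
  assumes "\<And>i. x i \<noteq> []"
  shows "(\<exists>n. \<alpha> (prodw x n)) \<longleftrightarrow> (\<exists>i. occ \<alpha> (x i))"
proof -
  have "(\<exists>n. \<alpha> (prodw x n)) \<longleftrightarrow> (\<exists>c \<in> range (prodw x). \<alpha> c)"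
    by blast
  also have "\<dots> \<longleftrightarrow> (\<exists>i. occ \<alpha> (x i))"
    by (simp add: range_prodw[OF assms] occ_def)
  finally show ?thesis .
qed

lemma ex_pair_prodw_iff:
  assumes "\<And>i. x i \<noteq> []"
  shows "(\<exists>n. \<exists>m<n. \<alpha> (prodw x m) \<and> \<beta> (prodw x n)) \<longleftrightarrow>
    (\<exists>i. occ_pair \<alpha> \<beta> (x i)) \<or> (\<exists>j. \<exists>i<j. occ \<alpha> (x i) \<and> occ \<beta> (x j))"
  (is "?L \<longleftrightarrow> ?R")
proof
  assume ?L
  then obtain m n where mn: "m < n" "\<alpha> (prodw x m)" "\<beta> (prodw x n)"
    by blast
  obtain i k where i: "m = off x i + k" "k < length (x i)"
    by (rule off_cases[of x m]) (rule assms)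
  obtain j l where j: "n = off x j + l" "l < length (x j)"
    by (rule off_cases[of x n]) (rule assms)
  have \<alpha>: "\<alpha> (x i ! k)" and \<beta>: "\<beta> (x j ! l)"
    using mn(2,3) prodw_off[of x] assms i j by simp_all
  have "i \<le> j"
  proof (rule ccontr)
    assume "\<not> i \<le> j"
    then show False
      using off_mono[of "Suc j" i x] i j mn(1) by simp
  qed
  then consider "i = j" "k < l" | "i < j"
    using mn(1) i(1) j(1) by (cases "i = j") auto
  then show ?R
  proof cases
    case 1
    then show ?thesis using \<alpha> \<beta> j unfolding occ_pair_def by blast
  next
    case 2
    then show ?thesis using \<alpha> \<beta> i(2) j(2) unfolding occ_nth by blast
  qed
next
  assume ?R
  then consider i k l where "l < length (x i)" "k < l" "\<alpha> (x i ! k)" "\<beta> (x i ! l)"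
    | i j k l where "i < j" "k < length (x i)" "l < length (x j)" "\<alpha> (x i ! k)" "\<beta> (x j ! l)"
    unfolding occ_pair_def occ_nth by blast
  then show ?L
  proof cases
    case (1 i k l)
    then show ?thesis
      using prodw_off[of x k i] prodw_off[of x l i] assms
      by (intro exI[of _ "off x i + l"] exI[of _ "off x i + k"]) simp
  next
    case (2 i j k l)
    then show ?thesis
      using prodw_off[of x k i] prodw_off[of x l j] assms off_mono[of "Suc i" j x]
      by (intro exI[of _ "off x j + l"] exI[of _ "off x i + k"]) simp
  qed
qed

text \<open>The two occurrence bits make the third component compositional, as a concatenation may
  split a pair.\<close>

definition order_type :: "('l \<Rightarrow> bool) \<Rightarrow> ('l \<Rightarrow> bool) \<Rightarrow> 'l list \<Rightarrow> bool \<times> bool \<times> bool" where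
  "order_type \<alpha> \<beta> u = (occ \<alpha> u, occ \<beta> u, occ_pair \<alpha> \<beta> u)"

text \<open>\<open>A\<close> decides \<open>P\<close> on ultimately periodic words given by linked
  pairs: \<open>s\<close> absorbs \<open>e\<close>, and \<open>e\<close> is idempotent. For such
  pairs all longer finite parts of the word are equivalent to \<open>s\<close> or \<open>e\<close>,
  which is what reduces a quantifier to finitely many labellings.\<close>

definition accurate :: "('l list \<Rightarrow> 'l list \<Rightarrow> bool) \<Rightarrow> ('l word \<Rightarrow> bool) \<Rightarrow> ('l list \<Rightarrow> 'l list \<Rightarrow> bool) \<Rightarrow> bool" where
  "accurate E P A \<longleftrightarrow> (\<forall>s e. s \<noteq> [] \<longrightarrow> e \<noteq> [] \<longrightarrow> E (s @ e) s \<longrightarrow> E (e @ e) e \<longrightarrow>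
     (A s e \<longleftrightarrow> P (prodw (lasso s e))))"

lemma omega_congruence_occ: "omega_congruence (\<lambda>u v. occ \<alpha> u = occ \<alpha> v) (\<lambda>w. \<exists>n. \<alpha> (w n))"
  by (rule omega_congruence_of_type[where m = "(\<or>)"]) (auto simp: ex_prodw_iff)

lemma accurate_occ: "accurate E (\<lambda>w. \<exists>n. \<alpha> (w n)) (\<lambda>s e. occ \<alpha> (s @ e))"
  unfolding accurate_def
proof (intro allI impI)
  fix s e :: "'a list" assume *: "s \<noteq> []" "e \<noteq> []"
  show "occ \<alpha> (s @ e) \<longleftrightarrow> (\<exists>n. \<alpha> (prodw (lasso s e) n))"
    unfolding ex_prodw_iff[of "lasso s e", OF lasso_nonempty[OF *]]
    by (auto simp: lasso_def split: if_splits intro: exI[of _ 0] exI[of _ 1])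
qed

lemma omega_congruence_occ_pair:
  "omega_congruence (\<lambda>u v. order_type \<alpha> \<beta> u = order_type \<alpha> \<beta> v) (\<lambda>w. \<exists>n. \<exists>m<n. \<alpha> (w m) \<and> \<beta> (w n))"
proof (rule omega_congruence_of_type[where
      m = "\<lambda>(a, b, c) (a', b', c'). (a \<or> a', b \<or> b', c \<or> c' \<or> a \<and> b')"])
  show "finite (range (order_type \<alpha> \<beta>))"
    by (rule finite_subset[OF subset_UNIV]) simp
qed (auto simp: ex_pair_prodw_iff order_type_def)

text \<open>Two copies of \<open>e\<close> are needed, since both letters may occur in
  \<open>e\<close> alone and there only in the wrong order. A pair split between any two blocks of
  the lasso also occurs between two of the first three.\<close>

lemma accurate_occ_pair:
  "accurate E (\<lambda>w. \<exists>n. \<exists>m<n. \<alpha> (w m) \<and> \<beta> (w n)) (\<lambda>s e. occ_pair \<alpha> \<beta> (s @ e @ e))"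
  unfolding accurate_def
proof (intro allI impI)
  fix s e :: "'a list" assume *: "s \<noteq> []" "e \<noteq> []"
  have l: "lasso s e 0 = s" "lasso s e 1 = e" "lasso s e 2 = e"
    by (simp_all add: lasso_def)
  have "(\<exists>i. occ_pair \<alpha> \<beta> (lasso s e i)) \<longleftrightarrow> occ_pair \<alpha> \<beta> s \<or> occ_pair \<alpha> \<beta> e"
    by (metis l lasso_def)
  moreover have "(\<exists>j. \<exists>i<j. occ \<alpha> (lasso s e i) \<and> occ \<beta> (lasso s e j)) \<longleftrightarrow> (occ \<alpha> s \<or> occ \<alpha> e) \<and> occ \<beta> e"
    (is "?L \<longleftrightarrow> ?R")
  proof
    show "?L \<Longrightarrow> ?R"
      by (auto simp: lasso_def split: if_splits)
    show "?R \<Longrightarrow> ?L"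
      using l by (metis lessI less_2_cases_iff pos2 zero_less_one one_less_numeral_iff semiring_norm(76))
  qed
  ultimately show "occ_pair \<alpha> \<beta> (s @ e @ e) \<longleftrightarrow> (\<exists>n. \<exists>m<n. \<alpha> (prodw (lasso s e) m) \<and> \<beta> (prodw (lasso s e) n))"
    unfolding ex_pair_prodw_iff[of "lasso s e", OF lasso_nonempty[OF *]] by auto
qed

section \<open>Boolean combinations of saturated properties\<close>

lemma omega_congruence_Not: "omega_congruence E P \<Longrightarrow> omega_congruence E (\<lambda>w. \<not> P w)"
proof -
  assume "omega_congruence E P"
  then interpret omega_congruence E P .
  show ?thesis
  proof
    show "\<not> P (prodw y)" if "\<And>i. x i \<noteq> []" "\<And>i. y i \<noteq> []" "\<And>i. E (x i) (y i)" "\<not> P (prodw x)" for x y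
      using prodw_cong[of x y] that by blast
  qed (fact refl sym trans append finite_index)+
qed

lemma accurate_Not: "accurate E P A \<Longrightarrow> accurate E (\<lambda>w. \<not> P w) (\<lambda>s e. \<not> A s e)"
  unfolding accurate_def by blast

lemma omega_congruence_conj:
  assumes "omega_congruence E P" "omega_congruence E' P'"
  shows "omega_congruence (\<lambda>u v. E u v \<and> E' u v) (\<lambda>w. P w \<and> P' w)"
proof -
  interpret E: omega_congruence E P by fact
  interpret E': omega_congruence E' P' by fact
  show ?thesis
  proof
    obtain t t' :: "'a list \<Rightarrow> nat" where t: "finite (range t)" "\<forall>u v. t u = t v \<longrightarrow> E u v"
      and t': "finite (range t')" "\<forall>u v. t' u = t' v \<longrightarrow> E' u v"
      using E.finite_index E'.finite_index by blast
    have "finite (range (\<lambda>u. prod_encode (t u, t' u)))"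
      by (rule finite_subset[of _ "prod_encode ` (range t \<times> range t')"]) (use t(1) t'(1) in auto)
    then show "\<exists>t :: 'a list \<Rightarrow> nat. finite (range t) \<and> (\<forall>u v. t u = t v \<longrightarrow> E u v \<and> E' u v)"
      using t(2) t'(2) by (intro exI[of _ "\<lambda>u. prod_encode (t u, t' u)"]) auto
    show "P (prodw y) \<and> P' (prodw y)" if "\<And>i. x i \<noteq> []" "\<And>i. y i \<noteq> []"
      "\<And>i. E (x i) (y i) \<and> E' (x i) (y i)" "P (prodw x) \<and> P' (prodw x)" for x y
      using E.prodw_imp[of x y] E'.prodw_imp[of x y] that by simp
    show "E u u \<and> E' u u" for u
      by (simp add: E.refl E'.refl)
    show "E v u \<and> E' v u" if "E u v \<and> E' u v" for u v
      using that by (simp add: E.sym E'.sym)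
    show "E u w \<and> E' u w" if "E u v \<and> E' u v" "E v w \<and> E' v w" for u v w
      using that E.trans[of u v w] E'.trans[of u v w] by simp
    show "E (u @ u') (v @ v') \<and> E' (u @ u') (v @ v')" if "E u v \<and> E' u v" "E u' v' \<and> E' u' v'" for u v u' v'
      using that by (simp add: E.append E'.append)
  qed
qed

lemma accurate_conj:
  "accurate E P A \<Longrightarrow> accurate E' P' A' \<Longrightarrow>
    accurate (\<lambda>u v. E u v \<and> E' u v) (\<lambda>w. P w \<and> P' w) (\<lambda>s e. A s e \<and> A' s e)"
  unfolding accurate_def by blast

subsection \<open>Projection\<close>

text \<open>A letter carries a list of marks. A first-order variable \<open>x\<close> is the mark \<open>2 x\<close>, a second-order
  variable \<open>X\<close> is the mark \<open>2 X + 1\<close>.\<close>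

type_synonym letter = "nat \<times> nat list"

definition marked :: "nat \<Rightarrow> letter \<Rightarrow> bool" where
  "marked X c \<longleftrightarrow> X \<in> set (snd c)"

text \<open>The new value overrides whatever the letter carried for \<open>X\<close>, so a
  quantifier may rebind a variable. Only membership in the list of marks counts, not order or
  repetition.\<close>

definition mark :: "nat \<Rightarrow> bool \<Rightarrow> letter \<Rightarrow> letter" where
  "mark X b c = (fst c, if b then X # snd c else filter (\<lambda>Y. Y \<noteq> X) (snd c))"

definition marks :: "nat \<Rightarrow> (nat \<Rightarrow> bool) \<Rightarrow> letter list \<Rightarrow> letter list" where
  "marks X B u = map (\<lambda>i. mark X (B i) (u ! i)) [0..<length u]"

definition markw :: "nat \<Rightarrow> (nat \<Rightarrow> bool) \<Rightarrow> letter word \<Rightarrow> letter word" where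
  "markw X B w = (\<lambda>n. mark X (B n) (w n))"

lemma length_marks [simp]: "length (marks X B u) = length u"
  by (simp add: marks_def)

lemma marks_eq_Nil [simp]: "marks X B u = [] \<longleftrightarrow> u = []"
  by (simp flip: length_0_conv)

lemma nth_marks: "i < length u \<Longrightarrow> marks X B u ! i = mark X (B i) (u ! i)"
  by (simp add: marks_def)

lemma marks_cong: "(\<And>i. i < length u \<Longrightarrow> B i = C i) \<Longrightarrow> marks X B u = marks X C u"
  by (auto simp: marks_def)

lemma marks_append: "marks X B (u @ v) = marks X B u @ marks X (\<lambda>i. B (length u + i)) v"
  by (rule nth_equalityI) (auto simp: nth_marks nth_append)

lemma marks_join: "\<exists>C. marks X C (u @ v) = marks X A u @ marks X B v"
proof
  let ?C = "\<lambda>i. if i < length u then A i else B (i - length u)"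
  show "marks X ?C (u @ v) = marks X A u @ marks X B v"
    unfolding marks_append by (auto intro!: arg_cong2[where f = "(@)"] marks_cong)
qed

lemma marks_block: "\<exists>C. marks X C (block x i j) = block (\<lambda>k. marks X (B k) (x k)) i j"
proof (cases "i \<le> j")
  case True
  then show ?thesis
  proof (induction rule: dec_induct)
    case (step j)
    then obtain C where C: "marks X C (block x i j) = block (\<lambda>k. marks X (B k) (x k)) i j"
      by blast
    obtain D where "marks X D (block x i j @ x j) = marks X C (block x i j) @ marks X (B j) (x j)"
      using marks_join by blast
    then show ?case
      using C step(1) by (intro exI[of _ D]) (simp add: block_def)
  qed (simp add: block_def)
qed (simp add: block_def)

lemma markw_prodw:
  assumes "\<And>i. x i \<noteq> []"
  shows "markw X B (prodw x) = prodw (\<lambda>i. marks X (\<lambda>j. B (off x i + j)) (x i))"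
proof (rule prodw_eqI)
  let ?y = "\<lambda>i. marks X (\<lambda>j. B (off x i + j)) (x i)"
  show "?y i \<noteq> []" for i
    using assms by simp
  show "markw X B (prodw x) (off ?y i + j) = ?y i ! j" if "j < length (?y i)" for i j
  proof -
    have "off ?y = off x"
      by (rule off_cong) simp
    then show ?thesis
      using that by (simp add: markw_def nth_marks prodw_off[of x j i] assms)
  qed
qed

lemma ex_markw_prodw:
  assumes "\<And>i. x i \<noteq> []"
  shows "\<exists>B. markw X B (prodw x) = prodw (\<lambda>i. marks X (C i) (x i))"
proof
  define z where "z i = map (C i) [0..<length (x i)]" for i
  have z: "off z = off x" "\<And>i. z i \<noteq> []"
    using assms by (auto simp: z_def intro!: off_cong)
  have "marks X (\<lambda>j. prodw z (off x i + j)) (x i) = marks X (C i) (x i)" for i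
  proof (rule marks_cong)
    fix j assume "j < length (x i)"
    then show "prodw z (off x i + j) = C i j"
      using prodw_off[of z j i] z by (simp add: z_def)
  qed
  then show "markw X (prodw z) (prodw x) = prodw (\<lambda>i. marks X (C i) (x i))"
    using markw_prodw[of x X "prodw z"] assms by simp
qed

text \<open>A back-and-forth condition: the labellings of \<open>u\<close> and of \<open>v\<close>
  realize the same classes of \<open>E\<close>. This is the power set construction that goes with
  projection.\<close>

definition lift :: "nat \<Rightarrow> (letter list \<Rightarrow> letter list \<Rightarrow> bool) \<Rightarrow> letter list \<Rightarrow> letter list \<Rightarrow> bool" where
  "lift X E u v \<longleftrightarrow> (\<forall>B. \<exists>C. E (marks X B u) (marks X C v)) \<and> (\<forall>C. \<exists>B. E (marks X B u) (marks X C v))"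

text \<open>It suffices to consider labellings of \<open>s\<close> and \<open>e\<close>, as \<open>s e\<^sup>n\<close> is equivalent to \<open>s\<close> and \<open>e\<^sup>n\<close>
  to \<open>e\<close> with respect to \<open>lift X E\<close>.\<close>

definition lift_accept :: "nat \<Rightarrow> (letter list \<Rightarrow> letter list \<Rightarrow> bool) \<Rightarrow> (letter list \<Rightarrow> letter list \<Rightarrow> bool) \<Rightarrow>
    letter list \<Rightarrow> letter list \<Rightarrow> bool" where
  "lift_accept X E A s e \<longleftrightarrow> (\<exists>B C. E (marks X B s @ marks X C e) (marks X B s) \<and>
     E (marks X C e @ marks X C e) (marks X C e) \<and> A (marks X B s) (marks X C e))"

text \<open>A labelling of a product, finite or infinite, is a family of labellings of its factors,
  and \<open>lift\<close> transfers these one factor at a time.\<close>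

lemma omega_congruence_lift:
  assumes "omega_congruence E P"
  shows "omega_congruence (lift X E) (\<lambda>w. \<exists>B. P (markw X B w))"
proof -
  interpret omega_congruence E P by fact
  show ?thesis
  proof
    show "lift X E u u" for u
      unfolding lift_def using refl by blast
    show "lift X E v u" if "lift X E u v" for u v
      using that sym unfolding lift_def by blast
    show "lift X E u w" if "lift X E u v" "lift X E v w" for u v w
      using that trans unfolding lift_def by meson
    show "lift X E (u @ u') (v @ v')" if uv: "lift X E u v" "lift X E u' v'" for u v u' v'
      unfolding lift_def
    proof (intro conjI allI)
      fix B
      obtain C where C: "E (marks X B u) (marks X C v)"
        using uv(1) unfolding lift_def by blast
      obtain C' where "E (marks X (\<lambda>i. B (length u + i)) u') (marks X C' v')"
        using uv(2) unfolding lift_def by blast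
      with C have "E (marks X B (u @ u')) (marks X C v @ marks X C' v')"
        unfolding marks_append by (rule append)
      then show "\<exists>C. E (marks X B (u @ u')) (marks X C (v @ v'))"
        using marks_join by metis
    next
      fix C
      obtain B where B: "E (marks X B u) (marks X C v)"
        using uv(1) unfolding lift_def by blast
      obtain B' where "E (marks X B' u') (marks X (\<lambda>i. C (length v + i)) v')"
        using uv(2) unfolding lift_def by blast
      with B have "E (marks X B u @ marks X B' u') (marks X C (v @ v'))"
        unfolding marks_append by (rule append)
      then show "\<exists>B. E (marks X B (u @ u')) (marks X C (v @ v'))"
        using marks_join by metis
    qed
    obtain t :: "letter list \<Rightarrow> nat" where t: "finite (range t)" "\<And>u v. t u = t v \<Longrightarrow> E u v"
      using finite_index by blast
    \<comment> \<open>The type of \<open>u\<close> after projection is the set of types of its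
      labellings, one of the finitely many subsets of \<open>range t\<close>;
      \<open>set_encode\<close> turns it into a number.\<close>
    let ?S = "\<lambda>u. range (\<lambda>B. t (marks X B u))"
    have S: "?S u \<subseteq> range t" "finite (?S u)" for u
      using t(1) by (auto intro: finite_subset[of _ "range t"])
    have "finite (range (\<lambda>u. set_encode (?S u)))"
      by (rule finite_subset[of _ "set_encode ` Pow (range t)"]) (use t(1) S in auto)
    moreover have "lift X E u v" if "set_encode (?S u) = set_encode (?S v)" for u v
    proof -
      have "?S u = ?S v"
        using that S(2) by (simp only: set_encode_eq)
      then have "\<forall>B. \<exists>C. t (marks X B u) = t (marks X C v)" "\<forall>C. \<exists>B. t (marks X B u) = t (marks X C v)"
        by (auto simp: set_eq_iff image_iff) metis
      then show ?thesis
        unfolding lift_def using t(2) by blast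
    qed
    ultimately show "\<exists>t :: letter list \<Rightarrow> nat. finite (range t) \<and> (\<forall>u v. t u = t v \<longrightarrow> lift X E u v)"
      by (intro exI[of _ "\<lambda>u. set_encode (?S u)"]) blast
  next
    fix x y :: "nat \<Rightarrow> letter list"
    assume x: "\<And>i. x i \<noteq> []" and y: "\<And>i. y i \<noteq> []" and E: "\<And>i. lift X E (x i) (y i)"
      and "\<exists>B. P (markw X B (prodw x))"
    then obtain B where "P (prodw (\<lambda>i. marks X (\<lambda>j. B (off x i + j)) (x i)))"
      by (auto simp: markw_prodw)
    moreover have "\<forall>i. \<exists>C. E (marks X (\<lambda>j. B (off x i + j)) (x i)) (marks X C (y i))"
      using E unfolding lift_def by blast
    then obtain C where "\<And>i. E (marks X (\<lambda>j. B (off x i + j)) (x i)) (marks X (C i) (y i))"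
      by metis
    ultimately have "P (prodw (\<lambda>i. marks X (C i) (y i)))"
      using prodw_imp[of "\<lambda>i. marks X (\<lambda>j. B (off x i + j)) (x i)" "\<lambda>i. marks X (C i) (y i)"] x y by simp
    then show "\<exists>B. P (markw X B (prodw y))"
      using ex_markw_prodw[of y X C] y by metis
  qed
qed

lemma lasso_marks:
  "(\<lambda>i. marks X (if i = 0 then B else C) (lasso s e i)) = lasso (marks X B s) (marks X C e)"
  by (auto simp: lasso_def)

lemma lift_idempotent_block:
  assumes "omega_congruence E P" "lift X E (s @ e) s" "lift X E (e @ e) e"
  shows "0 < m \<Longrightarrow> lift X E (block (lasso s e) 0 m) s"
    and "0 < m \<Longrightarrow> m < n \<Longrightarrow> lift X E (block (lasso s e) m n) e"
proof -
  interpret L: omega_congruence "lift X E" "\<lambda>w. \<exists>B. P (markw X B w)"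
    by (rule omega_congruence_lift) fact
  show "lift X E (block (lasso s e) 0 m) s" if "0 < m"
  proof -
    have "Suc 0 \<le> m" using that by simp
    then show ?thesis
    proof (induction rule: dec_induct)
      case base
      show ?case by (simp add: block_def lasso_def L.refl)
    next
      case (step m)
      have "lift X E (block (lasso s e) 0 m @ e) (s @ e)"
        by (intro L.append L.refl step.IH)
      moreover have "block (lasso s e) 0 (Suc m) = block (lasso s e) 0 m @ e"
        using step.hyps(1) lasso_def[of s e m] by (simp add: block_def)
      ultimately show ?case
        using L.trans[OF _ assms(2)] by metis
    qed
  qed
  show "lift X E (block (lasso s e) m n) e" if "0 < m" "m < n"
  proof -
    have "Suc m \<le> n" using that by simp
    then show ?thesis
    proof (induction rule: dec_induct)
      case base
      show ?case using that(1) by (simp add: block_def lasso_def L.refl)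
    next
      case (step n)
      have "lift X E (block (lasso s e) m n @ e) (e @ e)"
        by (intro L.append L.refl step.IH)
      moreover have "block (lasso s e) m (Suc n) = block (lasso s e) m n @ e"
        using step.hyps(1) lasso_def[of s e n] by (simp add: block_def)
      ultimately show ?case
        using L.trans[OF _ assms(3)] by metis
    qed
  qed
qed

text \<open>For the direction from right to left, Ramsey's theorem is applied to the labelled lasso.
  Its two blocks are labellings of finite parts of \<open>s e e ...\<close>, which are equivalent to
  \<open>s\<close> and \<open>e\<close> under \<open>lift X E\<close>, so the classes of these
  labellings also arise from labellings of \<open>s\<close> and \<open>e\<close> themselves.\<close>

lemma accurate_lift:
  assumes "omega_congruence E P" "accurate E P A"
  shows "accurate (lift X E) (\<lambda>w. \<exists>B. P (markw X B w)) (lift_accept X E A)"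
  unfolding accurate_def
proof (intro allI impI)
  interpret omega_congruence E P by fact
  fix s e :: "letter list"
  assume ne: "s \<noteq> []" "e \<noteq> []" and se: "lift X E (s @ e) s" and ee: "lift X E (e @ e) e"
  have l: "lasso s e i \<noteq> []" for i
    using ne by simp
  show "lift_accept X E A s e \<longleftrightarrow> (\<exists>B. P (markw X B (prodw (lasso s e))))"
  proof
    assume "lift_accept X E A s e"
    then obtain B C where BC: "E (marks X B s @ marks X C e) (marks X B s)"
      "E (marks X C e @ marks X C e) (marks X C e)" "A (marks X B s) (marks X C e)"
      unfolding lift_accept_def by blast
    then have "P (prodw (lasso (marks X B s) (marks X C e)))"
      using assms(2) ne unfolding accurate_def by simp
    moreover obtain D where "markw X D (prodw (lasso s e)) = prodw (\<lambda>i. marks X (if i = 0 then B else C) (lasso s e i))"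
      using ex_markw_prodw[of "lasso s e" X "\<lambda>i. if i = 0 then B else C"] l by blast
    ultimately show "\<exists>B. P (markw X B (prodw (lasso s e)))"
      using lasso_marks[of X B C s e] by metis
  next
    assume "\<exists>B. P (markw X B (prodw (lasso s e)))"
    then obtain B where B: "P (prodw (\<lambda>i. marks X (\<lambda>j. B (off (lasso s e) i + j)) (lasso s e i)))"
      using markw_prodw[of "lasso s e"] l by auto
    let ?z = "\<lambda>i. marks X (\<lambda>j. B (off (lasso s e) i + j)) (lasso s e i)"
    have z: "?z i \<noteq> []" for i
      using l by simp
    obtain m n where mn: "0 < m" "m < n" "E (block ?z 0 m @ block ?z m n) (block ?z 0 m)"
      "E (block ?z m n @ block ?z m n) (block ?z m n)"
      "P (prodw ?z) \<longleftrightarrow> P (prodw (lasso (block ?z 0 m) (block ?z m n)))"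
      by (rule ramsey_factorization[OF z])
    have "lift X E (block (lasso s e) 0 m) s" "lift X E (block (lasso s e) m n) e"
      using lift_idempotent_block[OF assms(1) se ee] mn(1,2) by blast+
    then obtain C D where CD: "E (block ?z 0 m) (marks X C s)" "E (block ?z m n) (marks X D e)"
      using marks_block[of X "lasso s e" _ _ "\<lambda>i j. B (off (lasso s e) i + j)"] unfolding lift_def by metis
    have 1: "E (marks X C s @ marks X D e) (marks X C s)"
      using append[OF CD] mn(3) CD(1) sym trans by blast
    have 2: "E (marks X D e @ marks X D e) (marks X D e)"
      using append[OF CD(2,2)] mn(4) CD(2) sym trans by blast
    have "P (prodw (lasso (marks X C s) (marks X D e)))"
    proof (rule prodw_imp)
      show "lasso (block ?z 0 m) (block ?z m n) i \<noteq> []" for i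
        using mn(1,2) z by (intro lasso_nonempty block_nonempty) auto
      show "lasso (marks X C s) (marks X D e) i \<noteq> []" for i
        using ne by simp
      show "E (lasso (block ?z 0 m) (block ?z m n) i) (lasso (marks X C s) (marks X D e) i)" for i
        using CD by (simp add: lasso_def)
      show "P (prodw (lasso (block ?z 0 m) (block ?z m n)))"
        using B mn(5) by simp
    qed
    then show "lift_accept X E A s e"
      using 1 2 assms(2) ne unfolding lift_accept_def accurate_def by (metis marks_eq_Nil)
  qed
qed

subsection \<open>Types of words with respect to a formula\<close>

definition single_type :: "nat \<Rightarrow> letter list \<Rightarrow> bool \<times> bool \<times> bool \<times> bool" where
  "single_type X u = (occ (marked X) u, order_type (marked X) (marked X) u)"

text \<open>A first-order variable is treated as a set variable for a singleton: at least one mark,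
  and no two.\<close>

definition single :: "nat \<Rightarrow> letter word \<Rightarrow> bool" where
  "single X w \<longleftrightarrow> (\<exists>n. marked X (w n)) \<and> \<not> (\<exists>n. \<exists>m<n. marked X (w m) \<and> marked X (w n))"

definition single_accept :: "nat \<Rightarrow> letter list \<Rightarrow> letter list \<Rightarrow> bool" where
  "single_accept X s e \<longleftrightarrow> occ (marked X) (s @ e) \<and> \<not> occ_pair (marked X) (marked X) (s @ e @ e)"

text \<open>The valuation is carried by the marks of the word. Atomic formulas are read
  existentially; this is the usual meaning when each free first-order variable is marked exactly
  once. On other words the value is merely conventional, but it is still saturated by
  \<open>equi\<close>, so the inductions below need no side condition.\<close>

primrec holds :: "nat mso \<Rightarrow> letter word \<Rightarrow> bool" where
  "holds (Less x y) w \<longleftrightarrow> (\<exists>n. \<exists>m<n. marked (2 * x) (w m) \<and> marked (2 * y) (w n))"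
| "holds (Equal x y) w \<longleftrightarrow> (\<exists>n. marked (2 * x) (w n) \<and> marked (2 * y) (w n))"
| "holds (Letter a x) w \<longleftrightarrow> (\<exists>n. marked (2 * x) (w n) \<and> fst (w n) = a)"
| "holds (Member x X) w \<longleftrightarrow> (\<exists>n. marked (2 * x) (w n) \<and> marked (2 * X + 1) (w n))"
| "holds (Neg \<psi>) w \<longleftrightarrow> \<not> holds \<psi> w"
| "holds (Conj \<psi> \<chi>) w \<longleftrightarrow> holds \<psi> w \<and> holds \<chi> w"
| "holds (Ex1 x \<psi>) w \<longleftrightarrow> (\<exists>B. single (2 * x) (markw (2 * x) B w) \<and> holds \<psi> (markw (2 * x) B w))"
| "holds (Ex2 X \<psi>) w \<longleftrightarrow> (\<exists>B. holds \<psi> (markw (2 * X + 1) B w))"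

text \<open>A relation instead of a function computing types: it can be decided on representatives,
  so that no class ever has to be written down as an object.\<close>

primrec equi :: "nat mso \<Rightarrow> letter list \<Rightarrow> letter list \<Rightarrow> bool" where
  "equi (Less x y) = (\<lambda>u v. order_type (marked (2 * x)) (marked (2 * y)) u = order_type (marked (2 * x)) (marked (2 * y)) v)"
| "equi (Equal x y) = (\<lambda>u v. occ (\<lambda>c. marked (2 * x) c \<and> marked (2 * y) c) u = occ (\<lambda>c. marked (2 * x) c \<and> marked (2 * y) c) v)"
| "equi (Letter a x) = (\<lambda>u v. occ (\<lambda>c. marked (2 * x) c \<and> fst c = a) u = occ (\<lambda>c. marked (2 * x) c \<and> fst c = a) v)"
| "equi (Member x X) = (\<lambda>u v. occ (\<lambda>c. marked (2 * x) c \<and> marked (2 * X + 1) c) u = occ (\<lambda>c. marked (2 * x) c \<and> marked (2 * X + 1) c) v)"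
| "equi (Neg \<psi>) = equi \<psi>"
| "equi (Conj \<psi> \<chi>) = (\<lambda>u v. equi \<psi> u v \<and> equi \<chi> u v)"
| "equi (Ex1 x \<psi>) = lift (2 * x) (\<lambda>u v. single_type (2 * x) u = single_type (2 * x) v \<and> equi \<psi> u v)"
| "equi (Ex2 X \<psi>) = lift (2 * X + 1) (equi \<psi>)"

primrec accept :: "nat mso \<Rightarrow> letter list \<Rightarrow> letter list \<Rightarrow> bool" where
  "accept (Less x y) = (\<lambda>s e. occ_pair (marked (2 * x)) (marked (2 * y)) (s @ e @ e))"
| "accept (Equal x y) = (\<lambda>s e. occ (\<lambda>c. marked (2 * x) c \<and> marked (2 * y) c) (s @ e))"
| "accept (Letter a x) = (\<lambda>s e. occ (\<lambda>c. marked (2 * x) c \<and> fst c = a) (s @ e))"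
| "accept (Member x X) = (\<lambda>s e. occ (\<lambda>c. marked (2 * x) c \<and> marked (2 * X + 1) c) (s @ e))"
| "accept (Neg \<psi>) = (\<lambda>s e. \<not> accept \<psi> s e)"
| "accept (Conj \<psi> \<chi>) = (\<lambda>s e. accept \<psi> s e \<and> accept \<chi> s e)"
| "accept (Ex1 x \<psi>) = lift_accept (2 * x) (\<lambda>u v. single_type (2 * x) u = single_type (2 * x) v \<and> equi \<psi> u v)
    (\<lambda>s e. single_accept (2 * x) s e \<and> accept \<psi> s e)"
| "accept (Ex2 X \<psi>) = lift_accept (2 * X + 1) (equi \<psi>) (accept \<psi>)"

lemma omega_congruence_single:
  "omega_congruence (\<lambda>u v. single_type X u = single_type X v) (single X)"
  using omega_congruence_conj[OF omega_congruence_occ omega_congruence_Not[OF omega_congruence_occ_pair],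
      of "marked X" "marked X" "marked X"]
  by (simp add: single_type_def single_def[abs_def])

lemma accurate_single: "accurate E (single X) (single_accept X)"
  using accurate_conj[OF accurate_occ[of E "marked X"] accurate_Not[OF accurate_occ_pair[of E "marked X" "marked X"]]]
  by (simp add: single_def[abs_def] single_accept_def[abs_def])

lemma omega_congruence_equi: "omega_congruence (equi \<psi>) (holds \<psi>)"
proof (induction \<psi>)
  case (Less x y)
  show ?case using omega_congruence_occ_pair by simp
next
  case (Equal x y)
  show ?case using omega_congruence_occ by simp
next
  case (Letter a x)
  show ?case using omega_congruence_occ by simp
next
  case (Member x X)
  show ?case using omega_congruence_occ by simp
next
  case (Neg \<psi>)
  then show ?case using omega_congruence_Not by simp
next
  case (Conj \<psi> \<chi>)
  then show ?case using omega_congruence_conj by simp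
next
  case (Ex1 x \<psi>)
  show ?case
    using omega_congruence_lift[OF omega_congruence_conj[OF omega_congruence_single Ex1]] by simp
next
  case (Ex2 X \<psi>)
  then show ?case using omega_congruence_lift by simp
qed

lemma accurate_accept: "accurate (equi \<psi>) (holds \<psi>) (accept \<psi>)"
proof (induction \<psi>)
  case (Less x y)
  show ?case using accurate_occ_pair by simp
next
  case (Equal x y)
  show ?case using accurate_occ by simp
next
  case (Letter a x)
  show ?case using accurate_occ by simp
next
  case (Member x X)
  show ?case using accurate_occ by simp
next
  case (Neg \<psi>)
  then show ?case using accurate_Not by simp
next
  case (Conj \<psi> \<chi>)
  then show ?case using accurate_conj by simp
next
  case (Ex1 x \<psi>)
  show ?case
    using accurate_lift[OF omega_congruence_conj[OF omega_congruence_single omega_congruence_equi]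
        accurate_conj[OF accurate_single Ex1]] by simp
next
  case (Ex2 X \<psi>)
  then show ?case using accurate_lift[OF omega_congruence_equi] by simp
qed

lemma marked_mark: "marked Y (mark X b c) \<longleftrightarrow> (if Y = X then b else marked Y c)"
  by (auto simp: marked_def mark_def)

lemma fst_mark [simp]: "fst (mark X b c) = fst c"
  by (simp add: mark_def)

lemma odd_neq_even: "Suc (2 * m) \<noteq> 2 * n" "2 * n \<noteq> Suc (2 * m)"
  by presburger+

lemma holds_iff_sat:
  assumes "\<And>n. fst (w n) = W n" "\<And>x n. x \<in> free1 \<psi> \<Longrightarrow> marked (2 * x) (w n) \<longleftrightarrow> n = v x"
    "\<And>X n. X \<in> free2 \<psi> \<Longrightarrow> marked (2 * X + 1) (w n) \<longleftrightarrow> n \<in> V X"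
  shows "holds \<psi> w \<longleftrightarrow> sat W v V \<psi>"
  using assms
proof (induction \<psi> arbitrary: w v V)
  case (Neg \<psi>)
  from Neg.IH[of w v V] Neg.prems show ?case by simp
next
  case (Conj \<psi> \<chi>)
  from Conj.IH(1)[of w v V] Conj.IH(2)[of w v V] Conj.prems show ?case by simp
next
  case (Ex1 x \<psi>)
  have IH: "holds \<psi> (markw (2 * x) B w) \<longleftrightarrow> sat W (v(x := n)) V \<psi>" if "\<And>m. B m \<longleftrightarrow> m = n" for B n
    by (rule Ex1.IH) (use Ex1.prems that in \<open>auto simp: markw_def marked_mark odd_neq_even\<close>)
  have single: "single (2 * x) (markw (2 * x) B w) \<longleftrightarrow> (\<exists>n. \<forall>m. B m \<longleftrightarrow> m = n)" for B
  proof -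
    have "single (2 * x) (markw (2 * x) B w) \<longleftrightarrow> (\<exists>n. B n) \<and> \<not> (\<exists>n. \<exists>m<n. B m \<and> B n)"
      by (simp add: single_def markw_def marked_mark)
    also have "\<dots> \<longleftrightarrow> (\<exists>n. B n \<and> (\<forall>m. B m \<longrightarrow> m = n))"
      by (metis linorder_neqE_nat less_irrefl)
    finally show ?thesis
      by auto
  qed
  show ?case
  proof
    assume "holds (Ex1 x \<psi>) w"
    then show "sat W v V (Ex1 x \<psi>)"
      using single IH by auto
  next
    assume "sat W v V (Ex1 x \<psi>)"
    then obtain n where "sat W (v(x := n)) V \<psi>" by auto
    then show "holds (Ex1 x \<psi>) w"
      using single[of "\<lambda>m. m = n"] IH[of "\<lambda>m. m = n" n] by auto
  qed
next
  case (Ex2 X \<psi>)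
  have IH: "holds \<psi> (markw (2 * X + 1) B w) \<longleftrightarrow> sat W v (V(X := {n. B n})) \<psi>" for B
    by (rule Ex2.IH) (use Ex2.prems in \<open>auto simp: markw_def marked_mark odd_neq_even\<close>)
  show ?case
  proof
    assume "holds (Ex2 X \<psi>) w"
    then show "sat W v V (Ex2 X \<psi>)"
      using IH by auto
  next
    assume "sat W v V (Ex2 X \<psi>)"
    then obtain M where "sat W v (V(X := M)) \<psi>" by auto
    then show "holds (Ex2 X \<psi>) w"
      using IH[of "\<lambda>n. n \<in> M"] by auto
  qed
qed auto

subsection \<open>Ultimately periodic words\<close>

definition pow :: "nat \<Rightarrow> 'l list \<Rightarrow> 'l list" where
  "pow n u = concat (replicate n u)"

lemma pow_0 [simp]: "pow 0 u = []"
  by (simp add: pow_def)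

lemma pow_Suc: "pow (Suc n) u = u @ pow n u"
  by (simp add: pow_def)

lemma pow_add: "pow (m + n) u = pow m u @ pow n u"
  by (simp add: pow_def replicate_add)

lemma pow_Suc_right: "pow (Suc n) u = pow n u @ u"
  using pow_add[of n 1 u] by (simp add: pow_def)

lemma pow_mult: "pow (m * n) u = pow m (pow n u)"
  by (induction m) (simp_all add: pow_add pow_Suc)

lemma pow_shift: "a @ pow n (b @ a) = pow n (a @ b) @ a"
  by (induction n) (simp_all add: pow_Suc)

lemma pow_nonempty: "u \<noteq> [] \<Longrightarrow> 0 < n \<Longrightarrow> pow n u \<noteq> []"
  by (cases n) (simp_all add: pow_Suc)

lemma concat_lasso: "concat (map (lasso s e) [0..<Suc n]) = s @ pow n e"
proof (induction n)
  case (Suc n)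
  then show ?case
    using lasso_def[of s e "Suc n"] by (simp add: pow_Suc_right)
qed (simp add: lasso_def)

lemma prodw_lasso_eqI:
  assumes "s \<noteq> []" "e \<noteq> []" "\<And>n. \<exists>m. prefix m w = s @ pow n e"
  shows "w = prodw (lasso s e)"
proof (rule prodw_eq_if_prefix)
  show "lasso s e i \<noteq> []" for i
    using assms by simp
  show "prefix (off (lasso s e) n) w = concat (map (lasso s e) [0..<n])" for n
  proof (cases n)
    case (Suc i)
    obtain m where m: "prefix m w = s @ pow i e"
      using assms(3) by blast
    then have "m = length (s @ pow i e)"
      by (metis diff_zero subsequence_length)
    then show ?thesis
      using m by (simp only: off_eq_length Suc concat_lasso)
  qed (simp add: off_def)
qed

lemma prefix_take: "m \<le> n \<Longrightarrow> prefix m w = take m (prefix n w)"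
  by (rule nth_equalityI) simp_all

lemma prefix_lasso:
  assumes "s \<noteq> []" "e \<noteq> []"
  shows "prefix (length (s @ pow n e)) (prodw (lasso s e)) = s @ pow n e"
  using prefix_prodw[of "lasso s e" "Suc n"] assms
  by (simp only: off_eq_length concat_lasso) simp

lemma prodw_lasso_shift:
  assumes "s \<noteq> []" "a @ b \<noteq> []"
  shows "prodw (lasso s (a @ b)) = prodw (lasso (s @ a) (b @ a))"
proof (rule prodw_lasso_eqI)
  fix n
  \<comment> \<open>The required prefix is obtained from one with \<open>n + 1\<close> periods by
    cutting off the last \<open>b\<close>.\<close>
  have "pow (Suc n) (a @ b) = a @ pow n (b @ a) @ b"
    by (simp add: pow_Suc_right pow_shift)
  then have "prefix (length (s @ pow (Suc n) (a @ b))) (prodw (lasso s (a @ b))) = (s @ a @ pow n (b @ a)) @ b"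
    using prefix_lasso[OF assms, of "Suc n"] by simp
  then have "prefix (length (s @ a @ pow n (b @ a))) (prodw (lasso s (a @ b))) = s @ a @ pow n (b @ a)"
    by (subst prefix_take[of _ "length (s @ pow (Suc n) (a @ b))"])
      (simp_all add: pow_Suc_right pow_shift)
  then show "\<exists>m. prefix m (prodw (lasso s (a @ b))) = (s @ a) @ pow n (b @ a)"
    by auto
qed (use assms in auto)

lemma prodw_lasso_pow:
  assumes "s \<noteq> []" "e \<noteq> []" "0 < n"
  shows "prodw (lasso s (pow n e)) = prodw (lasso s e)"
proof (rule prodw_lasso_eqI[symmetric])
  fix m
  show "\<exists>l. prefix l (prodw (lasso s e)) = s @ pow m (pow n e)"
    using prefix_lasso[OF assms(1,2), of "m * n"] by (auto simp: pow_mult)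
qed (use assms pow_nonempty in auto)

section \<open>Idempotent powers\<close>

context omega_congruence
begin

lemma idempotent_power: "\<exists>n>0. E (pow n u @ pow n u) (pow n u)"
proof -
  obtain t :: "'l list \<Rightarrow> nat" where t: "finite (range t)" "\<And>u v. t u = t v \<Longrightarrow> E u v"
    using finite_index by blast
  have "finite (range (\<lambda>i. t (pow i u)))"
    by (rule finite_subset[OF _ t(1)]) auto
  then have "\<not> inj (\<lambda>i. t (pow i u))"
    using range_inj_infinite by blast
  then obtain i j where "i < j" "t (pow i u) = t (pow j u)"
    unfolding inj_on_def by (metis linorder_neqE_nat)
  then obtain d where d: "0 < d" "E (pow (i + d) u) (pow i u)"
    using t(2) sym by (metis less_imp_add_positive)
  have "E (pow (i + m + c * d) u) (pow (i + m) u)" for m c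
  proof (induction c)
    case (Suc c)
    have "E (pow (i + d) u @ pow (m + c * d) u) (pow i u @ pow (m + c * d) u)"
      by (intro append refl d)
    then have "E (pow (i + m + Suc c * d) u) (pow (i + m + c * d) u)"
      by (simp add: pow_add[symmetric] ac_simps)
    then show ?case
      using Suc.IH trans by blast
  qed (simp add: refl)
  \<comment> \<open>The powers of \<open>u\<close> are periodic from exponent \<open>i\<close> on
    with period \<open>d\<close>. The exponent \<open>Suc i * d\<close> is a multiple of
    \<open>d\<close> and at least \<open>i\<close>, so doubling it keeps the class.\<close>
  from this[of "Suc i * d - i" "Suc i"] have "E (pow (Suc i * d + Suc i * d) u) (pow (Suc i * d) u)"
    using d(1) by (cases d) simp_all
  then show ?thesis
    using d(1) by (intro exI[of _ "Suc i * d"]) (simp add: pow_add)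
qed

lemma lasso_cong:
  assumes "s \<noteq> []" "e \<noteq> []" "s' \<noteq> []" "e' \<noteq> []" "E s s'" "E e e'"
  shows "P (prodw (lasso s e)) \<longleftrightarrow> P (prodw (lasso s' e'))"
  by (rule prodw_cong) (use assms in \<open>auto simp: lasso_def\<close>)

end

text \<open>Padding \<open>u\<close> with \<open>N\<close> letters in front pushes its occurrence
  beyond position \<open>N\<close>. Hence every word occurs infinitely often.\<close>

lemma factor_beyond:
  assumes "\<forall>u. factor u X"
  shows "\<exists>i j. N \<le> i \<and> i \<le> j \<and> subsequence X i j = u"
proof -
  obtain i j where ij: "replicate N undefined @ u @ [undefined] = subsequence X i j"
    using assms unfolding factor_def by metis
  have len: "j - i = N + length u + 1"
    using arg_cong[OF ij, of length] by simp
  have "subsequence X (i + N) (i + N + length u) = u"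
  proof (rule nth_equalityI)
    fix m assume "m < length (subsequence X (i + N) (i + N + length u))"
    then have m: "m < length u" by simp
    have "subsequence X i j ! (N + m) = u ! m"
      unfolding ij[symmetric] using m by (simp add: nth_append)
    then show "subsequence X (i + N) (i + N + length u) ! m = u ! m"
      using m len by (simp add: ac_simps)
  qed simp
  then show ?thesis
    by (intro exI[of _ "i + N"] exI[of _ "i + N + length u"]) simp
qed

lemma subsequence_join: "i \<le> j \<Longrightarrow> j \<le> k \<Longrightarrow> subsequence X i j @ subsequence X j k = subsequence X i k"
  unfolding subsequence_def by (metis le_Suc_ex map_append upt_add_eq_append)

section \<open>Morphic images of words with all factors\<close>

definition subst_word :: "('b \<Rightarrow> 'l list) \<Rightarrow> 'b list \<Rightarrow> 'l list" where
  "subst_word f u = concat (map f u)"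

lemma subst_word_Nil [simp]: "subst_word f [] = []"
  by (simp add: subst_word_def)

lemma subst_word_append [simp]: "subst_word f (u @ v) = subst_word f u @ subst_word f v"
  by (simp add: subst_word_def)

lemma subst_word_pow: "subst_word f (pow n u) = pow n (subst_word f u)"
  by (induction n) (simp_all add: pow_Suc)

context omega_congruence
begin

text \<open>The hypothesis \<open>return\<close> says that the type of \<open>s\<close> lies in the minimal ideal of the monoid of
  types of the words \<open>subst_word f v\<close>. Then \<open>e\<close> is the unit of a maximal subgroup of this ideal.\<close>

lemma disjunctive_periodic:
  fixes f :: "'b \<Rightarrow> 'l list"
  assumes disj: "\<forall>u. factor u X"
    and w: "\<And>n. prefix (length (subst_word f (prefix n X))) w = subst_word f (prefix n X)"
    and s: "s = subst_word f (prefix u X)" "s \<noteq> []"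
    and return: "\<And>v. \<exists>v'. E (s @ subst_word f v @ subst_word f v') s"
    and e: "e = pow k s" "0 < k" "E (e @ e) e"
  shows "P w \<longleftrightarrow> P (prodw (lasso e e))"
proof -
  let ?M = "range (subst_word f)"
  have M: "x @ y \<in> ?M" if "x \<in> ?M" "y \<in> ?M" for x y
    using that by (auto simp flip: subst_word_append)
  have "e = subst_word f (pow k (prefix u X))"
    by (simp add: e(1) s(1) subst_word_pow)
  then have eM: "e \<in> ?M" by blast
  have e_ne: "e \<noteq> []"
    using e(1,2) s(2) pow_nonempty[of s k] by simp
  \<comment> \<open>As \<open>e\<close> ends with \<open>s\<close>, it inherits the return property
    of \<open>s\<close>.\<close>
  have R: "\<exists>y\<in>?M. E (e @ x @ y) e" if x: "x \<in> ?M" for x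
  proof -
    obtain y where "y \<in> ?M" "E (s @ x @ y) s"
      using return x by blast
    moreover have "e = pow (k - 1) s @ s"
      using e by (metis Suc_diff_1 pow_Suc_right)
    ultimately show ?thesis
      using append[OF refl, of "s @ x @ y" s "pow (k - 1) s"] by auto
  qed
  \<comment> \<open>From \<open>s \<sim> s e y\<close> follows
    \<open>e s \<sim> e s e y = s e e y \<sim> s e y \<sim> s\<close>, because \<open>e\<close>, a
    power of \<open>s\<close>, commutes with \<open>s\<close>.\<close>
  have es: "E (e @ s) s"
  proof -
    obtain y where y: "E (s @ e @ y) s"
      using return eM by blast
    have "E (e @ s) (e @ s @ e @ y)"
      by (intro append refl sym[OF y])
    also have "e @ s @ e @ y = s @ (e @ e) @ y"
      unfolding e(1) by (metis append.assoc pow_Suc pow_Suc_right)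
    finally have "E (e @ s) (s @ (e @ e) @ y)" .
    moreover have "E (s @ (e @ e) @ y) (s @ e @ y)"
      by (intro append refl e)
    ultimately show ?thesis
      using y trans by blast
  qed
  \<comment> \<open>Some power \<open>i\<close> of \<open>e x e\<close> is idempotent, with
    \<open>e i \<sim> i \<sim> i e\<close>. The return property gives \<open>y\<close> with
    \<open>i y \<sim> e\<close>, whence
    \<open>i \<sim> i e \<sim> i i y \<sim> i y \<sim> e\<close>.\<close>
  have group: "\<exists>n>0. E (pow n (e @ x @ e)) e" if x: "x \<in> ?M" for x
  proof -
    obtain n where n: "n > 0" "E (pow n (e @ x @ e) @ pow n (e @ x @ e)) (pow n (e @ x @ e))"
      using idempotent_power by blast
    let ?i = "pow n (e @ x @ e)"
    obtain m where m: "n = Suc m"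
      using n(1) by (cases n) auto
    have "?i \<in> ?M"
    proof -
      obtain v where "subst_word f v = e @ x @ e"
        using M[OF eM M[OF x eM]] by auto
      then have "?i = subst_word f (pow n v)"
        by (simp add: subst_word_pow)
      then show ?thesis by blast
    qed
    then obtain y where y: "E (e @ ?i @ y) e"
      using R by blast
    have "E (e @ ?i) ?i"
      using append[OF e(3) refl, of "x @ e @ pow m (e @ x @ e)"] by (simp add: m pow_Suc)
    then have "E (e @ ?i @ y) (?i @ y)"
      using append[OF _ refl, of "e @ ?i" ?i y] by simp
    then have iy: "E (?i @ y) e"
      using y sym trans by blast
    have "E (?i @ e) ((?i @ ?i) @ y)"
      using append[OF refl sym[OF iy], of ?i] by simp
    then have "E (?i @ e) e"
      using append[OF n(2) refl, of y] iy trans by blast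
    moreover have "E (?i @ e) ?i"
      using append[OF refl e(3), of "pow m (e @ x @ e) @ e @ x"] by (simp add: m pow_Suc_right)
    ultimately have "E ?i e"
      using sym trans by blast
    then show ?thesis
      using n(1) by blast
  qed
  let ?z = "pow k (prefix u X)"
  \<comment> \<open>Cuts are chosen so that each block of the image contains \<open>e\<close>, the
    image of \<open>?z\<close>, and the first block starts with \<open>s\<close>.\<close>
  have "\<forall>N. \<exists>N'. N < N' \<and> u \<le> N' \<and> (\<exists>p q. subsequence X N N' = p @ ?z @ q)"
  proof
    fix N
    obtain i j where ij: "N \<le> i" "i \<le> j" "subsequence X i j = ?z"
      using factor_beyond[OF disj] by blast
    let ?N' = "Suc (j + u)"
    have "subsequence X N ?N' = subsequence X N i @ subsequence X i j @ subsequence X j ?N'"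
      using ij(1,2) by (simp add: subsequence_join)
    then show "\<exists>N'. N < N' \<and> u \<le> N' \<and> (\<exists>p q. subsequence X N N' = p @ ?z @ q)"
      using ij by (intro exI[of _ ?N']) auto
  qed
  then obtain nxt where nx: "\<And>N. N < nxt N" "\<And>N. u \<le> nxt N" "\<And>N. \<exists>p q. subsequence X N (nxt N) = p @ ?z @ q"
    by metis
  define h where "h i = (nxt ^^ i) 0" for i
  have h0: "h 0 = 0" and h: "h i < h (Suc i)" "u \<le> h (Suc i)" "\<exists>p q. subsequence X (h i) (h (Suc i)) = p @ ?z @ q" for i
    using nx by (simp_all add: h_def)
  have h_mono: "h i \<le> h j" if "i \<le> j" for i j
    using lift_Suc_mono_le[of h] h(1) that by (simp add: less_imp_le)
  define z where "z i = subst_word f (subsequence X (h i) (h (Suc i)))" for i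
  have z_split: "\<exists>p\<in>?M. \<exists>q\<in>?M. z i = p @ e @ q" for i
  proof -
    obtain p q where "subsequence X (h i) (h (Suc i)) = p @ ?z @ q"
      using h(3) by blast
    then have "z i = subst_word f p @ e @ subst_word f q"
      by (simp add: z_def e(1) s(1) subst_word_pow)
    then show ?thesis by blast
  qed
  have z_ne: "z i \<noteq> []" for i
    using z_split[of i] e_ne by auto
  have block: "block z i j = subst_word f (subsequence X (h i) (h j))" if "i \<le> j" for i j
    using that
  proof (induction rule: dec_induct)
    case (step j)
    have "subsequence X (h i) (h (Suc j)) = subsequence X (h i) (h j) @ subsequence X (h j) (h (Suc j))"
      using h_mono step(1) by (simp add: subsequence_join)
    then show ?case
      using step by (simp add: block_def z_def)
  qed (simp add: block_def)
  have "w = prodw z"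
  proof (rule prodw_eq_if_prefix)
    show "z i \<noteq> []" for i by (rule z_ne)
    show "prefix (off z n) w = concat (map z [0..<n])" for n
      using block[of 0 n] w[of "h n"] by (simp add: off_eq_length block_def h0)
  qed
  moreover obtain m n where mn: "0 < m" "m < n" "E (block z 0 m @ block z m n) (block z 0 m)"
    "E (block z m n @ block z m n) (block z m n)"
    "P (prodw z) \<longleftrightarrow> P (prodw (lasso (block z 0 m) (block z m n)))"
    by (rule ramsey_factorization[OF z_ne])
  moreover define t where "t = block z 0 m"
  obtain t' where t': "t' \<in> ?M" "t = s @ t'"
  proof
    obtain m' where "m = Suc m'" using mn(1) by (cases m) auto
    then have "prefix (h m) X = prefix u X @ subsequence X u (h m)"
      using h(2)[of m'] by (simp add: subsequence_join)
    then show "t = s @ subst_word f (subsequence X u (h m))"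
      by (simp add: t_def block h0 s(1))
  qed blast
  have et: "E (e @ t) t"
    using append[OF es refl, of t'] t' by simp
  have t_ne: "t \<noteq> []"
    using t' s by simp
  have sM: "s \<in> ?M"
    using s by blast
  have tM: "t \<in> ?M"
    using M sM t' by simp
  obtain p q where pq: "p \<in> ?M" "q \<in> ?M" "block z m n = p @ e @ q"
  proof -
    obtain p q where pq: "p \<in> ?M" "q \<in> ?M" "z m = p @ e @ q"
      using z_split by blast
    have "block z m n = z m @ block z (Suc m) n"
      using mn(2) by (simp add: block_def upt_conv_Cons)
    moreover have "block z (Suc m) n \<in> ?M"
      using block[of "Suc m" n] mn(2) by simp
    ultimately show thesis
      using that[of p "q @ block z (Suc m) n"] pq M by simp
  qed
  \<comment> \<open>The period \<open>p e q\<close> is rotated to end with \<open>e\<close>;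
    doubling this \<open>e\<close> and rotating once more makes it \<open>e (q p) e\<close>, an
    element of the group.\<close>
  let ?a = "t @ p @ e" and ?b = "q @ p @ e"
  have "prodw (lasso t (p @ e @ q)) = prodw (lasso ?a ?b)"
    using prodw_lasso_shift[of t "p @ e" q] t_ne e_ne by simp
  moreover have "P (prodw (lasso ?a ?b)) \<longleftrightarrow> P (prodw (lasso (?a @ e) (?b @ e)))"
  proof (rule lasso_cong)
    show "E ?a (?a @ e)" "E ?b (?b @ e)"
      using append[OF refl sym[OF e(3)], of "t @ p"] append[OF refl sym[OF e(3)], of "q @ p"] by simp_all
  qed (use e_ne in auto)
  moreover have "prodw (lasso (?a @ e) (?b @ e)) = prodw (lasso ?a (e @ ?b))"
    using prodw_lasso_shift[of ?a e ?b] e_ne by simp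
  moreover have "P (prodw (lasso ?a (e @ ?b))) \<longleftrightarrow> P (prodw (lasso ?a e))"
  proof -
    obtain j where j: "j > 0" "E (pow j (e @ (q @ p) @ e)) e"
      using group[OF M[OF pq(2,1)]] by blast
    have "P (prodw (lasso ?a (pow j (e @ (q @ p) @ e)))) \<longleftrightarrow> P (prodw (lasso ?a e))"
      by (rule lasso_cong) (use e_ne j refl pow_nonempty[of "e @ (q @ p) @ e" j] in auto)
    then show ?thesis
      using prodw_lasso_pow[of ?a "e @ (q @ p) @ e" j] j(1) e_ne by simp
  qed
  \<comment> \<open>The return property gives a right inverse \<open>c\<close> of \<open>?a\<close>,
    that is \<open>?a c \<sim> e\<close>. Up to padding of \<open>c\<close> with \<open>e\<close>,
    some power of \<open>c ?a\<close> is equivalent to \<open>e\<close>, so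
    \<open>?a e e ...\<close> may be replaced by
    \<open>?a (c ?a) (c ?a) ... = (?a c) (?a c) ...\<close>, and this by
    \<open>e e ...\<close>.\<close>
  moreover have "P (prodw (lasso ?a e)) \<longleftrightarrow> P (prodw (lasso e e))"
  proof -
    have "?a \<in> ?M"
      by (intro M tM pq eM)
    then obtain c where c: "c \<in> ?M" "E (e @ ?a @ c) e"
      using R by blast
    have "E (?a @ c) (e @ ?a @ c)"
      using append[OF sym[OF et] refl, of "p @ e @ c"] by simp
    then have ac: "E (?a @ c) e"
      using c(2) trans by blast
    let ?c = "e @ c @ e"
    obtain j where j: "j > 0" "E (pow j (e @ (c @ e @ t @ p) @ e)) e"
      using group[OF M[OF c(1) M[OF eM M[OF tM pq(1)]]]] by blast
    have "P (prodw (lasso ?a e)) \<longleftrightarrow> P (prodw (lasso ?a (pow j (?c @ ?a))))"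
    proof (rule lasso_cong)
      show "E e (pow j (?c @ ?a))"
        by (rule sym) (use j(2) in simp)
      show "pow j (?c @ ?a) \<noteq> []"
        by (rule pow_nonempty) (use e_ne j(1) in auto)
    qed (use e_ne in \<open>auto simp: refl\<close>)
    also have "prodw (lasso ?a (pow j (?c @ ?a))) = prodw (lasso ?a (?c @ ?a))"
      using e_ne j by (intro prodw_lasso_pow) auto
    also have "\<dots> = prodw (lasso (?a @ ?c) (?a @ ?c))"
      using e_ne by (intro prodw_lasso_shift) auto
    also have "P \<dots> \<longleftrightarrow> P (prodw (lasso e e))"
    proof -
      have "E (?a @ ?c) ((?a @ c) @ e)"
        using append[OF append[OF refl e(3), of "t @ p"] refl, of "c @ e"] by simp
      then have "E (?a @ ?c) (e @ e)"
        using append[OF ac refl, of e] trans by blast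
      then have "E (?a @ ?c) e"
        using e(3) trans by blast
      then show ?thesis
        by (intro lasso_cong) (use e_ne in auto)
    qed
    finally show ?thesis .
  qed
  ultimately show ?thesis
    using pq(3) t_def by simp
qed

end

subsection \<open>Runs of automata along a disjunctive word\<close>

text \<open>States are served one after another: the word for the next state \<open>q\<close> is
  chosen for the state that \<open>q\<close> has become after the word built so far. This state is
  still in \<open>C\<close>, and earlier hits persist under prolongation.\<close>

lemma uniform_hit:
  fixes act :: "nat \<Rightarrow> 'b list \<Rightarrow> nat"
  assumes "finite S" "S \<subseteq> C" "\<And>q v. q \<in> C \<Longrightarrow> act q v \<in> C"
    and "\<And>q v v'. H q v \<Longrightarrow> H q (v @ v')" "\<And>q v v'. H (act q v) v' \<Longrightarrow> H q (v @ v')"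
    and "\<And>q. q \<in> C \<Longrightarrow> \<exists>v. H q v"
  shows "\<exists>z. \<forall>q\<in>S. H q z"
  using assms(1,2)
proof (induction S)
  case (insert q S)
  then obtain z where z: "\<forall>q\<in>S. H q z"
    by auto
  have "act q z \<in> C"
    using insert.prems assms(3) by simp
  then obtain v where "H (act q z) v"
    using assms(6) by blast
  then show ?case
    using z assms(4,5) by (intro exI[of _ "z @ v"]) auto
qed simp

text \<open>These are the states of terminal strongly connected components.\<close>

definition bottom :: "(nat \<Rightarrow> 'b list \<Rightarrow> nat) \<Rightarrow> nat \<Rightarrow> bool" where
  "bottom act q \<longleftrightarrow> (\<forall>v. \<exists>v'. act (act q v) v' = q)"

lemma bottom_act:
  assumes "\<And>q v v'. act q (v @ v') = act (act q v) v'" "bottom act q"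
  shows "bottom act (act q v)"
  unfolding bottom_def
proof
  fix v1
  obtain v2 where "act (act q (v @ v1)) v2 = q"
    using assms(2) unfolding bottom_def by blast
  then show "\<exists>v'. act (act (act q v) v1) v' = act q v"
    by (intro exI[of _ "v2 @ v"]) (simp add: assms(1))
qed

text \<open>A reachable state is taken whose own set of reachable states is as small as possible. No
  further word can shrink this set, so it always retains the state itself.\<close>

lemma bottom_reachable:
  assumes act: "\<And>q v v'. act q (v @ v') = act (act q v) v'"
    and fin: "finite (range (act q))"
  shows "\<exists>v. bottom act (act q v)"
proof -
  let ?R = "\<lambda>q. range (act q)"
  obtain v where v: "\<And>v'. card (?R (act q v)) \<le> card (?R (act q v'))"
    using exists_least_iff[of "\<lambda>n. \<exists>v. n = card (?R (act q v))"] by (metis not_less)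
  have "bottom act (act q v)"
    unfolding bottom_def
  proof
    fix v1
    have "?R (act (act q v) v1) \<subseteq> ?R (act q v)" "?R (act q v) \<subseteq> ?R q"
      by (auto simp flip: act)
    moreover have "card (?R (act q v)) \<le> card (?R (act (act q v) v1))"
      using v[of "v @ v1"] by (simp add: act)
    ultimately have "?R (act (act q v) v1) = ?R (act q v)"
      using fin by (meson card_seteq finite_subset)
    \<comment> \<open>Nothing is assumed about \<open>act q []\<close>, but
      \<open>v @ [] = v\<close> shows that the empty word fixes every state of the form
      \<open>act q v\<close>.\<close>
    moreover have "act q v \<in> ?R (act q v) \<or> act q v = act (act q v) []"
      using act[of q v "[]"] by auto
    then have "act q v \<in> ?R (act q v)"
      by auto
    ultimately show "\<exists>v'. act (act (act q v) v1) v' = act q v"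
      by (metis rangeE)
  qed
  then show ?thesis by blast
qed

text \<open>The state in which the run arrives at an occurrence of \<open>z\<close> is not known in
  advance, so one word \<open>z\<close> must work for all states of \<open>Q\<close>.\<close>

lemma eventually_bottom:
  assumes disj: "\<forall>u. factor u X"
    and act: "\<And>q v v'. act q (v @ v') = act (act q v) v'"
    and Q: "finite Q" "\<And>q v. q \<in> Q \<Longrightarrow> act q v \<in> Q" and q: "q \<in> Q"
  shows "\<exists>u. \<forall>u'\<ge>u. bottom act (act q (prefix u' X))"
proof -
  have "\<exists>z. \<forall>q\<in>Q. bottom act (act q z)"
  proof (rule uniform_hit[of Q Q act "\<lambda>q v. bottom act (act q v)"])
    show "\<exists>v. bottom act (act q v)" if "q \<in> Q" for q
      by (rule bottom_reachable[OF act]) (use Q that in \<open>auto intro: finite_subset\<close>)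
    show "bottom act (act q (v @ v'))" if "bottom act (act q v)" for q v v'
      unfolding act by (rule bottom_act[OF act that])
  qed (use Q act in auto)
  then obtain z where z: "\<And>q. q \<in> Q \<Longrightarrow> bottom act (act q z)"
    by blast
  obtain i j where ij: "i \<le> j" "subsequence X i j = z"
    using factor_beyond[OF disj] by blast
  have "bottom act (act q (prefix u' X))" if "j \<le> u'" for u'
  proof -
    have "prefix u' X = prefix i X @ z @ subsequence X j u'"
      using ij(1) that by (simp add: subsequence_join flip: ij(2))
    then show ?thesis
      using bottom_act[OF act z] Q(2) q by (simp add: act)
  qed
  then show ?thesis by blast
qed

subsection \<open>Numerical representation of automata\<close>

definition run :: "nat list list \<Rightarrow> nat \<Rightarrow> nat list \<Rightarrow> nat" where
  "run tab q w = foldl (\<lambda>q i. lk (lk tab q) i) q w"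

definition table :: "nat \<Rightarrow> nat \<Rightarrow> nat list list \<Rightarrow> bool" where
  "table k n tab \<longleftrightarrow> length tab = n \<and> (\<forall>r \<in> set tab. length r = k \<and> (\<forall>q \<in> set r. q < n))"

definition bits :: "nat \<Rightarrow> nat list \<Rightarrow> bool" where
  "bits n v \<longleftrightarrow> length v = n \<and> (\<forall>b \<in> set v. b < 2)"

definition dcode :: "nat \<Rightarrow> nat \<Rightarrow> nat list list \<Rightarrow> nat list \<Rightarrow> nat" where
  "dcode n st tab fin = enc [n, st, enc tab, enc fin]"

lemma run_Nil [simp]: "run tab q [] = q"
  by (simp add: run_def)

lemma run_append [simp]: "run tab q (u @ v) = run tab (run tab q u) v"
  by (simp add: run_def)

lemma run_Cons: "run tab q (i # u) = run tab (lk (lk tab q) i) u"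
  by (simp add: run_def)

lemma table_step: "table k n tab \<Longrightarrow> q < n \<Longrightarrow> i < k \<Longrightarrow> lk (lk tab q) i < n"
  unfolding table_def by (metis lk_nth nth_mem)

lemma run_less: "table k n tab \<Longrightarrow> q < n \<Longrightarrow> set u \<subseteq> {..<k} \<Longrightarrow> run tab q u < n"
  by (induction u arbitrary: q) (auto simp: run_Cons table_step)

lemma lk_bits: "bits n v \<Longrightarrow> q < n \<Longrightarrow> lk v q = 0 \<or> lk v q = 1"
  using less_2_cases[of "v ! q"] nth_mem[of q v] by (auto simp: bits_def)

text \<open>With absorbing final states, acceptance means that a final state is visited.\<close>

definition absorb :: "nat \<Rightarrow> nat list list \<Rightarrow> nat list \<Rightarrow> nat list list" where
  "absorb k tab fin = map (\<lambda>q. if lk fin q = 1 then replicate k q else lk tab q) [0..<length tab]"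

lemma table_absorb: "table k n tab \<Longrightarrow> table k n (absorb k tab fin)"
  by (auto simp: table_def absorb_def)

lemma ex_le_Suc_iff: "(\<exists>i\<le>Suc m. P i) \<longleftrightarrow> P 0 \<or> (\<exists>i\<le>m. P (Suc i))"
  by (metis Suc_le_mono le0 not0_implies_Suc)

lemma run_absorb:
  assumes "table k n tab" "q < n" "set u \<subseteq> {..<k}"
  shows "lk fin (run (absorb k tab fin) q u) = 1 \<longleftrightarrow> (\<exists>i\<le>length u. lk fin (run tab q (take i u)) = 1)"
  using assms(2,3)
proof (induction u arbitrary: q)
  case (Cons a u)
  have row: "lk (lk (absorb k tab fin) q) a = (if lk fin q = 1 then q else lk (lk tab q) a)"
    using assms(1) Cons.prems by (auto simp: absorb_def table_def)
  have less: "lk (lk tab q) a < n"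
    using Cons.prems table_step[OF assms(1)] by simp
  have split: "(\<exists>i\<le>length (a # u). lk fin (run tab q (take i (a # u))) = 1) \<longleftrightarrow>
      lk fin q = 1 \<or> (\<exists>i\<le>length u. lk fin (run tab (lk (lk tab q) a) (take i u)) = 1)"
    by (simp add: ex_le_Suc_iff run_Cons)
  show ?case
  proof (cases "lk fin q = 1")
    case True
    have "lk fin (run (absorb k tab fin) q u) = 1"
      using Cons True by (auto intro: exI[of _ 0])
    then show ?thesis
      unfolding split using True row by (simp add: run_Cons)
  next
    case False
    then show ?thesis
      unfolding split using Cons less row by (simp add: run_Cons)
  qed
qed simp

lemma code_dfa_eq:
  "code_dfa num A = dcode (size_of A) (start A)
     (map (\<lambda>q. map (\<lambda>i. delta A q (inv num i)) [0..<card (UNIV :: 'a::finite set)]) [0..<size_of A])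
     (map (\<lambda>q. if q \<in> final A then 1 else 0) [0..<size_of A])" for num :: "'a::finite \<Rightarrow> nat"
  by (simp add: code_dfa_def dcode_def enc_list_def o_def del: list_encode.simps cong: map_cong)

lemma dfa_numerical:
  fixes num :: "'a::finite \<Rightarrow> nat"
  assumes num: "numbering num" and A: "A \<in> dfas"
  obtains n st tab fin where "st < n" "table (card (UNIV :: 'a set)) n tab" "bits n fin"
    "code_dfa num A = dcode n st tab fin"
    "\<forall>w. w \<in> lang A \<longleftrightarrow> lk fin (run tab st (map num w)) = 1"
proof
  let ?k = "card (UNIV :: 'a set)" and ?n = "size_of A"
  let ?tab = "map (\<lambda>q. map (\<lambda>i. delta A q (inv num i)) [0..<?k]) [0..<?n]"
  let ?fin = "map (\<lambda>q. if q \<in> final A then 1 else 0 :: nat) [0..<?n]"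
  have inv: "inv num (num a) = a" "num a < ?k" for a
    using num by (auto simp: numbering_def bij_betw_def)
  show "start A < ?n" "table ?k ?n ?tab" "bits ?n ?fin"
    using A by (auto simp: dfas_def table_def bits_def)
  show "code_dfa num A = dcode ?n (start A) ?tab ?fin"
    by (rule code_dfa_eq)
  have run: "foldl (delta A) q w < ?n \<and> run ?tab q (map num w) = foldl (delta A) q w" if "q < ?n" for q w
    using that
  proof (induction w arbitrary: q)
    case (Cons a w)
    have "delta A q a < ?n"
      using A Cons.prems by (auto simp: dfas_def)
    then show ?case
      using Cons by (simp add: run_Cons inv)
  qed simp
  show "\<forall>w. w \<in> lang A \<longleftrightarrow> lk ?fin (run ?tab (start A) (map num w)) = 1"
    using run[of "start A"] \<open>start A < ?n\<close> by (simp add: lang_def)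
qed

lemma numerical_dfa:
  fixes num :: "'a::finite \<Rightarrow> nat"
  assumes num: "numbering num" and "st < n" "table (card (UNIV :: 'a set)) n tab" "bits n fin"
  obtains A where "A \<in> dfas" "code_dfa num A = dcode n st tab fin"
    "\<And>w. w \<in> lang A \<longleftrightarrow> lk fin (run tab st (map num w)) = 1"
proof
  let ?k = "card (UNIV :: 'a set)"
  have inv: "num (inv num i) = i" if "i < ?k" for i
    using num that unfolding numbering_def by (metis bij_betw_def f_inv_into_f lessThan_iff)
  have num_less: "num a < ?k" for a
    using num by (auto simp: numbering_def bij_betw_def)
  let ?A = "\<lparr>size_of = n, start = st, delta = \<lambda>q a. lk (lk tab q) (num a), final = {q. q < n \<and> lk fin q = 1}\<rparr> :: 'a dfa"
  show "?A \<in> dfas"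
    using assms num_less table_step by (auto simp: dfas_def)
  have "map (\<lambda>q. map (\<lambda>i. lk (lk tab q) (num (inv num i))) [0..<?k]) [0..<n] = tab"
    using assms(3) inv by (auto simp: table_def list_eq_iff_nth_eq)
  moreover have "map (\<lambda>q. if q < n \<and> lk fin q = 1 then 1 else 0) [0..<n] = fin"
    using assms(4) lk_bits[OF assms(4)] by (auto simp: bits_def list_eq_iff_nth_eq) 
  ultimately show "code_dfa num ?A = dcode n st tab fin"
    by (simp add: code_dfa_eq)
  have run: "foldl (delta ?A) q w = run tab q (map num w)" for q w
    by (induction w arbitrary: q) (simp_all add: run_Cons)
  have "run tab st (map num w) < n" for w
    by (rule run_less) (use assms num_less in auto)
  then show "w \<in> lang ?A \<longleftrightarrow> lk fin (run tab st (map num w)) = 1" for w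
    using run by (simp add: lang_def)
qed

locale disjunctive_image =
  fixes num :: "'a::finite \<Rightarrow> nat" and \<phi> :: "nat list \<Rightarrow> 'a list" and X :: "nat word"
  assumes num: "numbering num"
    and morphism: "morphism \<phi>"
    and computable_\<phi>: "computable (\<lambda>\<alpha>. code_word num (\<phi> [\<alpha>]))"
    and RR: "RR_decidable num {\<phi> [\<alpha>] | \<alpha>. True}"
    and computable_X: "computable X"
    and disjunctive: "\<forall>u. factor u X"
    and infinite: "infinite_image \<phi> X"
begin

definition k :: nat where "k = card (UNIV :: 'a set)"

definition img :: "nat \<Rightarrow> nat list" where "img \<alpha> = map num (\<phi> [\<alpha>])"

definition word :: "nat word" where "word = num \<circ> image_word \<phi> X"

abbreviation images :: "nat list \<Rightarrow> nat list" where "images \<equiv> subst_word img"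

definition len :: "nat \<Rightarrow> nat" where "len n = length (images (prefix n X))"

definition rr :: "nat \<Rightarrow> nat" where
  "rr = (SOME f. computable f \<and> (\<forall>A \<in> dfas. f (code_dfa num A) = (if {\<phi> [\<alpha>] | \<alpha>. True} \<inter> lang A \<noteq> {} then 1 else 0)))"

lemma rr: "computable rr" "A \<in> dfas \<Longrightarrow> rr (code_dfa num A) = (if {\<phi> [\<alpha>] | \<alpha>. True} \<inter> lang A \<noteq> {} then 1 else 0)"
  using someI_ex[OF RR[unfolded RR_decidable_def decidable_problem_def]] unfolding rr_def by blast+

lemma rr_eq_0:
  assumes "st < n" "table k n tab" "bits n fin"
  shows "rr (dcode n st tab fin) = 0 \<longleftrightarrow> (\<forall>\<alpha>. lk fin (run tab st (img \<alpha>)) \<noteq> 1)"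
proof -
  obtain A where "A \<in> dfas" "code_dfa num A = dcode n st tab fin"
    "\<And>w. w \<in> lang A \<longleftrightarrow> lk fin (run tab st (map num w)) = 1"
    using numerical_dfa[OF num assms(1)] assms(2,3) unfolding k_def by metis
  then show ?thesis
    using rr(2)[of A] by (auto simp: img_def)
qed

lemma images_eq: "images u = map num (\<phi> u)"
proof (induction u)
  case Nil
  then show ?case
    using morphism by (simp add: morphism_def)
next
  case (Cons \<alpha> u)
  have "\<phi> (\<alpha> # u) = \<phi> [\<alpha>] @ \<phi> u"
    using morphism unfolding morphism_def by (metis append_Cons append_Nil)
  then show ?case
    using Cons by (simp add: subst_word_def img_def)
qed

lemma img_less: "set (img \<alpha>) \<subseteq> {..<k}"
  using num by (auto simp: img_def k_def numbering_def bij_betw_def)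

lemma images_less: "set (images u) \<subseteq> {..<k}"
  using num by (auto simp: images_eq k_def numbering_def bij_betw_def)

lemma prefix_word: "prefix (len n) word = images (prefix n X)"
  using prefix_image_word[OF morphism, of X n]
  by (simp add: len_def images_eq word_def subsequence_def flip: map_map)

lemma len_unbounded: "\<exists>n. m < len n"
  using infinite by (simp add: infinite_image_def len_def images_eq)

lemma len_mono: "i \<le> j \<Longrightarrow> len i \<le> len j"
proof -
  assume "i \<le> j"
  then have "prefix j X = prefix i X @ subsequence X i j"
    by (simp add: subsequence_join)
  then show ?thesis
    by (simp add: len_def)
qed

lemma prefix_word_take: "m \<le> len n \<Longrightarrow> prefix m word = take m (images (prefix n X))"
  by (simp add: prefix_take[of m "len n"] prefix_word)

section \<open>Certificates for runs along the image word\<close>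

definition inside :: "nat \<Rightarrow> nat list \<Rightarrow> nat \<Rightarrow> bool" where
  "inside n cv q \<longleftrightarrow> q < n \<and> lk cv q = 1"

text \<open>\<open>cv\<close> is the characteristic vector of a set of states. With its complement
  as final states, the oracle tells whether some \<open>img \<alpha>\<close> leads from
  \<open>c\<close> out of the set; the answer 0 excludes this.\<close>

definition invariant :: "nat \<Rightarrow> nat list list \<Rightarrow> nat list \<Rightarrow> bool" where
  "invariant n tab cv \<longleftrightarrow> bits n cv \<and>
     (\<forall>c<n. lk cv c = 1 \<longrightarrow> rr (dcode n c tab (map (\<lambda>b. 1 - b) cv)) = 0)"

definition avoids :: "nat \<Rightarrow> nat list list \<Rightarrow> nat list \<Rightarrow> nat list \<Rightarrow> bool" where
  "avoids n tab fin cv \<longleftrightarrow> (\<forall>c<n. lk cv c = 1 \<longrightarrow> rr (dcode n c (absorb k tab fin) fin) = 0)"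

definition visited :: "nat list list \<Rightarrow> nat \<Rightarrow> nat \<Rightarrow> nat" where
  "visited tab st u = run tab st (images (prefix u X))"

lemma invariant_iff:
  assumes "table k n tab"
  shows "invariant n tab cv \<longleftrightarrow> bits n cv \<and> (\<forall>c. inside n cv c \<longrightarrow> (\<forall>\<alpha>. inside n cv (run tab c (img \<alpha>))))"
proof -
  have "rr (dcode n c tab (map (\<lambda>b. 1 - b) cv)) = 0 \<longleftrightarrow> (\<forall>\<alpha>. inside n cv (run tab c (img \<alpha>)))"
    if "bits n cv" "c < n" for c
  proof -
    have "bits n (map (\<lambda>b. 1 - b) cv)"
      using that by (auto simp: bits_def)
    moreover have less: "run tab c (img \<alpha>) < n" for \<alpha>
      using run_less[OF assms that(2) img_less] .
    moreover have "lk (map (\<lambda>b. 1 - b) cv) q \<noteq> 1 \<longleftrightarrow> lk cv q = 1" if "q < n" for q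
      using lk_bits[OF \<open>bits n cv\<close> that] \<open>bits n cv\<close> that by (auto simp: bits_def)
    ultimately show ?thesis
      using rr_eq_0[OF that(2) assms] by (simp add: inside_def)
  qed
  then show ?thesis
    unfolding invariant_def inside_def by blast
qed

lemma avoids_iff:
  assumes "table k n tab" "bits n fin"
  shows "avoids n tab fin cv \<longleftrightarrow> (\<forall>c. inside n cv c \<longrightarrow> (\<forall>\<alpha>. \<forall>i\<le>length (img \<alpha>). lk fin (run tab c (take i (img \<alpha>))) \<noteq> 1))"
proof -
  have "rr (dcode n c (absorb k tab fin) fin) = 0 \<longleftrightarrow>
      (\<forall>\<alpha>. \<forall>i\<le>length (img \<alpha>). lk fin (run tab c (take i (img \<alpha>))) \<noteq> 1)" if "c < n" for c
    using rr_eq_0[OF that table_absorb[OF assms(1)] assms(2)] run_absorb[OF assms(1) that img_less] by simp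
  then show ?thesis
    unfolding avoids_def inside_def by blast
qed

lemma inside_images:
  assumes "table k n tab" "invariant n tab cv" "inside n cv c"
  shows "inside n cv (run tab c (images v))"
proof (induction v rule: rev_induct)
  case (snoc \<alpha> v)
  then show ?case
    using assms(1,2) by (simp add: invariant_iff[OF assms(1)]) (simp add: subst_word_def)
qed (use assms in simp)

lemma visited_append: "i \<le> j \<Longrightarrow> visited tab st j = run tab (visited tab st i) (images (subsequence X i j))"
  unfolding visited_def by (simp add: subsequence_join flip: run_append subst_word_append)

lemma visited_less: "table k n tab \<Longrightarrow> st < n \<Longrightarrow> visited tab st u < n"
  unfolding visited_def by (rule run_less) (auto intro: images_less[THEN subsetD, THEN lessThan_iff[THEN iffD1]])

definition trapped :: "nat \<Rightarrow> nat \<Rightarrow> nat list list \<Rightarrow> nat list \<Rightarrow> nat \<Rightarrow> bool" where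
  "trapped n st tab cv u \<longleftrightarrow> invariant n tab cv \<and> lk cv (visited tab st u) = 1"

text \<open>The set may contain states that the run does not reach; it suffices that it is closed
  and that each of its states leads back to the visited one. The return paths are explicit
  witnesses, which makes the condition recursively enumerable.\<close>

definition recurrent :: "nat \<Rightarrow> nat \<Rightarrow> nat list list \<Rightarrow> nat list \<Rightarrow> nat \<Rightarrow> bool" where
  "recurrent n st tab cv u \<longleftrightarrow> trapped n st tab cv u \<and>
     (\<forall>c<n. lk cv c = 1 \<longrightarrow> (\<exists>v. run tab c (images v) = visited tab st u))"

text \<open>The witness consists of the states reachable from a state in a terminal strongly connected
  component.\<close>

lemma recurrent_exists:
  assumes "table k n tab" "st < n"
  obtains cv u where "recurrent n st tab cv u" "m < len u"
    "\<forall>c. inside n cv c \<longrightarrow> (\<exists>v. run tab (visited tab st u) (images v) = c)"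
proof -
  let ?act = "\<lambda>q v. run tab q (images v)"
  have "\<exists>u. \<forall>u'\<ge>u. bottom ?act (?act st (prefix u' X))"
    by (rule eventually_bottom[OF disjunctive, where Q = "{..<n}"])
      (use assms run_less images_less in auto)
  then obtain u where u: "\<And>u'. u' \<ge> u \<Longrightarrow> bottom ?act (visited tab st u')"
    unfolding visited_def by blast
  obtain l where "m < len l"
    using len_unbounded by blast
  then have l: "m < len (max u l)"
    using len_mono[of l "max u l"] by simp
  \<comment> \<open>From \<open>u\<close> on the run is in a terminal component, and from
    \<open>l\<close> on the image is longer than \<open>m\<close>.\<close>
  let ?u = "max u l"
  let ?q = "visited tab st ?u"
  let ?C = "range (?act ?q)"
  have bot: "bottom ?act ?q"
    by (rule u) simp
  have q: "?q < n"
    by (rule visited_less) fact+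
  define cv :: "nat list" where "cv = map (\<lambda>c. of_bool (c \<in> ?C)) [0..<n]"
  have lt: "?act c v < n" if "c < n" for c v
    using run_less[OF assms(1) that images_less] .
  have cv: "inside n cv c \<longleftrightarrow> c \<in> ?C" for c
    using lt[OF q] by (auto simp: inside_def cv_def simp del: One_nat_def)
  have "bits n cv"
    by (auto simp: bits_def cv_def)
  moreover have "run tab c (img \<alpha>) \<in> ?C" if c: "c \<in> ?C" for c \<alpha>
  proof -
    obtain v where "c = ?act ?q v" using c by blast
    then have "run tab c (img \<alpha>) = ?act ?q (v @ [\<alpha>])"
      by simp (simp add: subst_word_def)
    then show ?thesis by blast
  qed
  ultimately have "invariant n tab cv"
    unfolding invariant_iff[OF assms(1)] cv by blast
  moreover have "?q \<in> ?C"
    by (rule range_eqI[of _ _ "[]"]) simp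
  then have "lk cv ?q = 1"
    using cv inside_def by blast
  moreover have "\<exists>v. ?act c v = ?q" if "c < n" "lk cv c = 1" for c
  proof -
    have "c \<in> ?C"
      using that cv inside_def by blast
    then show ?thesis
      using bot unfolding bottom_def by blast
  qed
  ultimately have "recurrent n st tab cv ?u"
    by (simp add: recurrent_def trapped_def)
  then show thesis
    by (rule that[OF _ l]) (use cv in auto)
qed

definition hits :: "nat list list \<Rightarrow> nat list \<Rightarrow> nat \<Rightarrow> nat list \<Rightarrow> bool" where
  "hits tab fin q v \<longleftrightarrow> (\<exists>i\<le>length (images v). lk fin (run tab q (take i (images v))) = 1)"

text \<open>The position \<open>u\<close> is a parameter because prefix realizability must also
  inspect the shorter prefixes, about which this condition says nothing.\<close>

definition finite_cert :: "nat \<Rightarrow> nat \<Rightarrow> nat list list \<Rightarrow> nat list \<Rightarrow> nat \<Rightarrow> bool" where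
  "finite_cert n st tab fin u \<longleftrightarrow> (\<exists>cv. trapped n st tab cv u \<and> avoids n tab fin cv)"

definition infinite_cert :: "nat \<Rightarrow> nat \<Rightarrow> nat list list \<Rightarrow> nat list \<Rightarrow> bool" where
  "infinite_cert n st tab fin \<longleftrightarrow> (\<exists>cv u v. recurrent n st tab cv u \<and> hits tab fin (visited tab st u) v)"

lemma hits_append: "hits tab fin q v \<Longrightarrow> hits tab fin q (v @ v')"
  unfolding hits_def
proof (elim exE conjE)
  fix i assume "i \<le> length (images v)" "lk fin (run tab q (take i (images v))) = 1"
  then show "\<exists>i\<le>length (images (v @ v')). lk fin (run tab q (take i (images (v @ v')))) = 1"
    by (intro exI[of _ i]) simp
qed

lemma hits_after: "hits tab fin (run tab q (images v)) v' \<Longrightarrow> hits tab fin q (v @ v')"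
  unfolding hits_def
proof (elim exE conjE)
  fix i assume "i \<le> length (images v')" "lk fin (run tab (run tab q (images v)) (take i (images v'))) = 1"
  then show "\<exists>i\<le>length (images (v @ v')). lk fin (run tab q (take i (images (v @ v')))) = 1"
    by (intro exI[of _ "length (images v) + i"]) simp
qed

lemma avoids_hits:
  assumes "table k n tab" "bits n fin" "invariant n tab cv" "inside n cv q" "avoids n tab fin cv"
  shows "\<not> hits tab fin q v"
  using assms(4)
proof (induction v arbitrary: q)
  case Nil
  \<comment> \<open>The initial state is tested by the empty prefix of any image; letter
    \<open>0\<close> is an arbitrary choice.\<close>
  then have "lk fin (run tab q (take 0 (img 0))) \<noteq> 1"
    using assms(5) unfolding avoids_iff[OF assms(1,2)] by blast
  then show ?case
    by (simp add: hits_def)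
next
  case (Cons \<alpha> v)
  have eq: "images (\<alpha> # v) = img \<alpha> @ images v"
    by (simp add: subst_word_def)
  have "inside n cv (run tab q (img \<alpha>))"
    using Cons.prems assms(3) unfolding invariant_iff[OF assms(1)] by blast
  then have IH: "\<not> hits tab fin (run tab q (img \<alpha>)) v"
    by (rule Cons.IH)
  show ?case
  proof
    assume "hits tab fin q (\<alpha> # v)"
    then obtain i where i: "i \<le> length (img \<alpha>) + length (images v)"
      "lk fin (run tab q (take i (img \<alpha> @ images v))) = 1"
      unfolding hits_def eq by auto
    show False
    proof (cases "i \<le> length (img \<alpha>)")
      case True
      then show False
        using i Cons.prems assms(5) unfolding avoids_iff[OF assms(1,2)] by auto
    next
      case False
      then have "hits tab fin (run tab q (img \<alpha>)) v"
        unfolding hits_def using i by (intro exI[of _ "i - length (img \<alpha>)"]) auto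
      then show False using IH by simp
    qed
  qed
qed

lemma finite_cert_sound:
  assumes "table k n tab" "st < n" "bits n fin" "finite_cert n st tab fin u" "len u \<le> m"
  shows "lk fin (run tab st (prefix m word)) \<noteq> 1"
proof
  assume m: "lk fin (run tab st (prefix m word)) = 1"
  obtain cv where cv: "invariant n tab cv" "lk cv (visited tab st u) = 1" "avoids n tab fin cv"
    using assms(4) by (auto simp: finite_cert_def trapped_def)
  have q: "inside n cv (visited tab st u)"
    using cv(2) visited_less[OF assms(1,2)] by (simp add: inside_def)
  obtain l where "m < len l"
    using len_unbounded by blast
  then have l: "m \<le> len (max u l)"
    using len_mono[of l "max u l"] by simp
  let ?v = "subsequence X u (max u l)"
  have split: "images (prefix (max u l) X) = images (prefix u X) @ images ?v"
    by (simp add: subsequence_join flip: subst_word_append)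
  have "hits tab fin (visited tab st u) ?v"
    unfolding hits_def
  proof (intro exI conjI)
    show "m - len u \<le> length (images ?v)"
      using l assms(5) arg_cong[OF split, of length] by (simp add: len_def)
    show "lk fin (run tab (visited tab st u) (take (m - len u) (images ?v))) = 1"
      using m assms(5) unfolding prefix_word_take[OF l] split visited_def by (simp add: len_def)
  qed
  then show False
    using avoids_hits[OF assms(1,3) cv(1) q cv(3)] by blast
qed

text \<open>Every state of the set returns to the visited state and from there reaches a final one.
  By \<open>uniform_hit\<close> a single word \<open>z\<close> forces such a visit from all of them,
  and \<open>z\<close> occurs infinitely often in \<open>X\<close>.\<close>

lemma infinite_cert_sound:
  assumes "table k n tab" "st < n" "infinite_cert n st tab fin"
  shows "infinite {m. lk fin (run tab st (prefix m word)) = 1}"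
proof -
  obtain cv u v where cv: "invariant n tab cv" "lk cv (visited tab st u) = 1"
    "\<And>c. inside n cv c \<Longrightarrow> \<exists>v. run tab c (images v) = visited tab st u" and v: "hits tab fin (visited tab st u) v"
    using assms(3) by (auto simp: infinite_cert_def recurrent_def trapped_def inside_def)
  have q: "inside n cv (visited tab st u)"
    using cv(2) visited_less[OF assms(1,2)] by (simp add: inside_def)
  have "\<exists>z. \<forall>c\<in>{c. inside n cv c}. hits tab fin c z"
  proof (rule uniform_hit[of _ "{c. inside n cv c}" "\<lambda>q v. run tab q (images v)"])
    show "finite {c. inside n cv c}"
      by (rule finite_subset[of _ "{..<n}"]) (auto simp: inside_def)
    show "\<exists>v. hits tab fin c v" if "c \<in> {c. inside n cv c}" for c
      using cv(3)[of c] that v hits_after by (metis mem_Collect_eq)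
  qed (auto intro: hits_append hits_after inside_images[OF assms(1) cv(1)])
  then obtain z where z: "\<And>c. inside n cv c \<Longrightarrow> hits tab fin c z"
    by blast
  have "\<exists>m>M. lk fin (run tab st (prefix m word)) = 1" for M
  proof -
    obtain l where l: "M < len l"
      using len_unbounded by blast
    obtain i j where ij: "max u l \<le> i" "i \<le> j" "subsequence X i j = z"
      using factor_beyond[OF disjunctive] by blast
    have "inside n cv (visited tab st i)"
      using visited_append[of u i tab st] inside_images[OF assms(1) cv(1) q] ij(1) by simp
    then obtain r where r: "r \<le> length (images z)" "lk fin (run tab (visited tab st i) (take r (images z))) = 1"
      using z unfolding hits_def by blast
    have split: "images (prefix j X) = images (prefix i X) @ images z"
      using ij(2) by (simp add: subsequence_join flip: subst_word_append ij(3))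
    have "len i + r \<le> len j"
      using r(1) by (simp add: len_def split)
    then have "lk fin (run tab st (prefix (len i + r) word)) = 1"
      using r(2) by (simp add: prefix_word_take split visited_def) (simp add: len_def)
    moreover have "M < len i + r"
      using l len_mono[of l i] ij(1) by simp
    ultimately show ?thesis by blast
  qed
  then show ?thesis
    unfolding infinite_nat_iff_unbounded by simp
qed

text \<open>The set given by \<open>recurrent_exists\<close> contains only states reachable from the
  visited one. If no final state can be hit from there, then none is hit along any
  \<open>img \<alpha>\<close> from any state of the set.\<close>

lemma finite_or_infinite_cert:
  assumes "table k n tab" "st < n" "bits n fin"
  shows "(\<exists>u. finite_cert n st tab fin u) \<or> infinite_cert n st tab fin"
proof -
  obtain cv u where cv: "recurrent n st tab cv u" "0 < len u"
    "\<forall>c. inside n cv c \<longrightarrow> (\<exists>v. run tab (visited tab st u) (images v) = c)"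
    by (rule recurrent_exists[OF assms(1,2), of 0])
  show ?thesis
  proof (cases "\<exists>v. hits tab fin (visited tab st u) v")
    case True
    then show ?thesis
      using cv(1) unfolding infinite_cert_def by blast
  next
    case False
    have "avoids n tab fin cv"
      unfolding avoids_iff[OF assms(1,3)]
    proof (intro allI impI notI)
      fix c \<alpha> i
      assume c: "inside n cv c" and i: "i \<le> length (img \<alpha>)" "lk fin (run tab c (take i (img \<alpha>))) = 1"
      obtain v where "run tab (visited tab st u) (images v) = c"
        using cv(3) c by blast
      moreover have "hits tab fin c [\<alpha>]"
        using i by (auto simp: hits_def subst_word_def)
      ultimately show False
        using False hits_after by blast
    qed
    then show ?thesis
      using cv(1) unfolding finite_cert_def recurrent_def by blast
  qed
qed

subsection \<open>The realizability problems\<close>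

lemma cpt_img [cpt_intros]: "cpt f \<Longrightarrow> cpt (\<lambda>x. img (f x))"
proof (rule cpt_comp[of img])
  show "cpt img"
    using computable_\<phi> by (simp add: cpt_def code_word_def img_def enc_list_def o_def)
qed

lemma cpt_X [cpt_intros]: "cpt f \<Longrightarrow> cpt (\<lambda>x. X (f x))"
  by (rule cpt_comp[OF cpt_computable[OF computable_X]])

lemma cpt_rr [cpt_intros]: "cpt f \<Longrightarrow> cpt (\<lambda>x. rr (f x))"
  by (rule cpt_comp[OF cpt_computable[OF rr(1)]])

lemma cpt_prefix [cpt_intros]: "cpt f \<Longrightarrow> cpt (\<lambda>x. prefix (f x) X)"
  unfolding subsequence_def by (intro cpt_intros)

lemma cpt_images [cpt_intros]: "cpt f \<Longrightarrow> cpt (\<lambda>x. images (f x))"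
  unfolding subst_word_def by (intro cpt_intros)

lemma cpt_len [cpt_intros]: "cpt f \<Longrightarrow> cpt (\<lambda>x. len (f x))"
  unfolding len_def by (intro cpt_intros)

lemma cpt_run [cpt_intros]:
  assumes "cpt tab" "cpt q" "cpt w"
  shows "cpt (\<lambda>x. run (tab x) (q x) (w x))"
proof -
  have "cpt (\<lambda>p. run (fst p) (fst (snd p)) (snd (snd p)))"
    unfolding run_def by (intro cpt_intros)
  from cpt_comp[OF this, of "\<lambda>x. (tab x, q x, w x)"] show ?thesis
    by (simp add: cpt_Pair assms)
qed

lemma cpt_visited [cpt_intros]:
  assumes "cpt tab" "cpt q" "cpt u"
  shows "cpt (\<lambda>x. visited (tab x) (q x) (u x))"
  unfolding visited_def by (intro cpt_intros assms)

lemma cpt_dcode [cpt_intros]: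
  assumes "cpt n" "cpt st" "cpt tab" "cpt fin"
  shows "cpt (\<lambda>x. dcode (n x) (st x) (tab x) (fin x))"
  unfolding dcode_def by (intro cpt_intros assms)

lemma cpt_absorb [cpt_intros]:
  assumes "cpt tab" "cpt fin"
  shows "cpt (\<lambda>x. absorb k (tab x) (fin x))"
proof -
  have "cpt (\<lambda>p. absorb k (fst p) (snd p))"
    unfolding absorb_def by (intro cpt_intros)
  from cpt_comp[OF this, of "\<lambda>x. (tab x, fin x)"] show ?thesis
    by (simp add: cpt_Pair assms)
qed

lemma dc_table [cpt_intros]:
  assumes "cpt n" "cpt tab"
  shows "dc (\<lambda>x. table k (n x) (tab x))"
proof -
  have "dc (\<lambda>p. table k (fst p) (snd p))"
    unfolding table_def by (intro cpt_intros)
  from dc_comp[OF this, of "\<lambda>x. (n x, tab x)"] show ?thesis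
    by (simp add: cpt_Pair assms)
qed

lemma dc_bits [cpt_intros]:
  assumes "cpt n" "cpt v"
  shows "dc (\<lambda>x. bits (n x) (v x))"
proof -
  have "dc (\<lambda>p. bits (fst p) (snd p))"
    unfolding bits_def by (intro cpt_intros)
  from dc_comp[OF this, of "\<lambda>x. (n x, v x)"] show ?thesis
    by (simp add: cpt_Pair assms)
qed

lemma dc_invariant [cpt_intros]:
  assumes "cpt n" "cpt tab" "cpt cv"
  shows "dc (\<lambda>x. invariant (n x) (tab x) (cv x))"
proof -
  have "dc (\<lambda>p. invariant (fst p) (fst (snd p)) (snd (snd p)))"
    unfolding invariant_def by (intro cpt_intros)
  from dc_comp[OF this, of "\<lambda>x. (n x, tab x, cv x)"] show ?thesis
    by (simp add: cpt_Pair assms)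
qed

lemma dc_avoids [cpt_intros]:
  assumes "cpt n" "cpt tab" "cpt fin" "cpt cv"
  shows "dc (\<lambda>x. avoids (n x) (tab x) (fin x) (cv x))"
proof -
  have "dc (\<lambda>p. avoids (fst p) (fst (snd p)) (fst (snd (snd p))) (snd (snd (snd p))))"
    unfolding avoids_def by (intro cpt_intros)
  from dc_comp[OF this, of "\<lambda>x. (n x, tab x, fin x, cv x)"] show ?thesis
    by (simp add: cpt_Pair assms)
qed

lemma dc_trapped [cpt_intros]:
  assumes "cpt n" "cpt st" "cpt tab" "cpt cv" "cpt u"
  shows "dc (\<lambda>x. trapped (n x) (st x) (tab x) (cv x) (u x))"
  unfolding trapped_def by (intro cpt_intros assms)

lemma re_recurrent:
  assumes "cpt n" "cpt st" "cpt tab" "cpt cv" "cpt u"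
  shows "re (\<lambda>x. recurrent (n x) (st x) (tab x) (cv x) (u x))"
proof -
  have "re (\<lambda>p. recurrent (fst p) (fst (snd p)) (fst (snd (snd p))) (fst (snd (snd (snd p)))) (snd (snd (snd (snd p)))))"
    unfolding recurrent_def
    by (intro re_intros cpt_intros; rule re_dc; intro cpt_intros)
  from re_comp[OF this, of "\<lambda>x. (n x, st x, tab x, cv x, u x)"] show ?thesis
    by (simp add: cpt_Pair assms)
qed

lemma re_finite_cert:
  assumes "cpt n" "cpt st" "cpt tab" "cpt fin" "cpt u"
  shows "re (\<lambda>x. finite_cert (n x) (st x) (tab x) (fin x) (u x))"
proof -
  have "re (\<lambda>p. finite_cert (fst p) (fst (snd p)) (fst (snd (snd p))) (fst (snd (snd (snd p)))) (snd (snd (snd (snd p)))))"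
    unfolding finite_cert_def
    by (intro re_intros; rule re_dc; intro cpt_intros)
  from re_comp[OF this, of "\<lambda>x. (n x, st x, tab x, fin x, u x)"] show ?thesis
    by (simp add: cpt_Pair assms)
qed

lemma re_infinite_cert:
  assumes "cpt n" "cpt st" "cpt tab" "cpt fin"
  shows "re (\<lambda>x. infinite_cert (n x) (st x) (tab x) (fin x))"
proof -
  have *: "hits tab fin q v \<longleftrightarrow> (\<exists>i<Suc (length (images v)). lk fin (run tab q (take i (images v))) = 1)" for tab fin q v
    by (simp add: hits_def less_Suc_eq_le)
  have "re (\<lambda>p. infinite_cert (fst p) (fst (snd p)) (fst (snd (snd p))) (snd (snd (snd p))))"
    unfolding infinite_cert_def *
    by (intro re_intros re_recurrent cpt_intros; rule re_dc; intro cpt_intros)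
  from re_comp[OF this, of "\<lambda>x. (n x, st x, tab x, fin x)"] show ?thesis
    by (simp add: cpt_Pair assms)
qed

text \<open>The search must end on every number, so numbers that do not code an automaton are
  assigned to the negative side.\<close>

lemma decidable_dfa_problem:
  assumes "re (\<lambda>x. A (fst x) (fst (snd x)) (fst (snd (snd x))) (snd (snd (snd x))))"
    and "re (\<lambda>x. B (fst x) (fst (snd x)) (fst (snd (snd x))) (snd (snd (snd x))))"
    and "\<And>n st tab fin. st < n \<Longrightarrow> table k n tab \<Longrightarrow> bits n fin \<Longrightarrow> A n st tab fin \<or> B n st tab fin"
    and "\<And>D n st tab fin. st < n \<Longrightarrow> table k n tab \<Longrightarrow> bits n fin \<Longrightarrow>
      (\<And>w. w \<in> lang D \<longleftrightarrow> lk fin (run tab st (map num w)) = 1) \<Longrightarrow>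
      (A n st tab fin \<longrightarrow> P D) \<and> (B n st tab fin \<longrightarrow> \<not> P D)"
  shows "decidable_problem (code_dfa num) dfas P"
proof -
  let ?l = "denc :: nat \<Rightarrow> nat list"
  let ?n = "\<lambda>x. lk (?l x) 0" and ?st = "\<lambda>x. lk (?l x) 1"
    and ?tab = "\<lambda>x. denc (lk (?l x) 2) :: nat list list" and ?fin = "\<lambda>x. denc (lk (?l x) 3) :: nat list"
  let ?v = "\<lambda>x. ?st x < ?n x \<and> table k (?n x) (?tab x) \<and> bits (?n x) (?fin x)"
  have *: "cpt (\<lambda>x. (?n x, ?st x, ?tab x, ?fin x))"
    by (intro cpt_intros)
  have A: "re (\<lambda>x. A (?n x) (?st x) (?tab x) (?fin x))" and B: "re (\<lambda>x. B (?n x) (?st x) (?tab x) (?fin x))"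
    using re_comp[OF assms(1) *] re_comp[OF assms(2) *] by simp_all
  have "re (\<lambda>x. ?v x \<and> A (?n x) (?st x) (?tab x) (?fin x))"
    by (intro re_conj re_dc[of ?v] A cpt_intros)
  moreover have "re (\<lambda>x. \<not> ?v x \<or> B (?n x) (?st x) (?tab x) (?fin x))"
    by (intro re_disj re_dc[of "\<lambda>x. \<not> ?v x"] B cpt_intros)
  moreover have "(?v x \<and> A (?n x) (?st x) (?tab x) (?fin x)) \<or> (\<not> ?v x \<or> B (?n x) (?st x) (?tab x) (?fin x))" for x
    using assms(3) by blast
  ultimately obtain f :: "nat \<Rightarrow> nat" where f: "cpt f"
    "\<forall>x. f x = 1 \<and> ?v x \<and> A (?n x) (?st x) (?tab x) (?fin x) \<or> f x = 0 \<and> (\<not> ?v x \<or> B (?n x) (?st x) (?tab x) (?fin x))"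
    by (rule re_decide)
  have "f (code_dfa num D) = (if P D then 1 else 0)" if D: "D \<in> dfas" for D
  proof -
    obtain n st tab fin where *: "st < n" "table (card (UNIV :: 'a set)) n tab" "bits n fin"
      "code_dfa num D = dcode n st tab fin"
      "\<forall>w. w \<in> lang D \<longleftrightarrow> lk fin (run tab st (map num w)) = 1"
      by (rule dfa_numerical[OF num D])
    have "?n (code_dfa num D) = n" "?st (code_dfa num D) = st" "?tab (code_dfa num D) = tab" "?fin (code_dfa num D) = fin"
      by (simp_all only: *(4) dcode_def denc_enc) (simp_all add: numeral_2_eq_2 numeral_3_eq_3)
    then show ?thesis
      using spec[OF f(2), of "code_dfa num D"] assms(4)[OF *(1) *(2)[folded k_def] *(3) *(5)[rule_format]] *(1,2,3)
      unfolding k_def by auto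
  qed
  then show ?thesis
    unfolding decidable_problem_def using f(1) by (auto simp: cpt_def)
qed

lemma Pref_iff: "prefix m (image_word \<phi> X) \<in> lang D \<longleftrightarrow> lk fin (run tab st (prefix m word)) = 1"
  if "\<And>w. w \<in> lang D \<longleftrightarrow> lk fin (run tab st (map num w)) = 1"
  using that by (simp add: word_def subsequence_def)

theorem Rp_decidable: "Rp_decidable num (image_word \<phi> X)"
  unfolding Rp_decidable_def
proof (rule decidable_dfa_problem)
  let ?A = "\<lambda>n st tab fin. \<exists>u i. lk fin (run tab st (take i (images (prefix u X)))) = 1"
  \<comment> \<open>The certificate excludes acceptance from length \<open>len u\<close> on; the
    finitely many shorter prefixes are checked directly.\<close>
  let ?B = "\<lambda>n st tab fin. \<exists>u. finite_cert n st tab fin u \<and>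
    (\<forall>i<Suc (len u). lk fin (run tab st (take i (images (prefix u X)))) \<noteq> 1)"
  show "re (\<lambda>x. ?A (fst x) (fst (snd x)) (fst (snd (snd x))) (snd (snd (snd x))))"
    by (intro re_intros; rule re_dc; intro cpt_intros)
  show "re (\<lambda>x. ?B (fst x) (fst (snd x)) (fst (snd (snd x))) (snd (snd (snd x))))"
    by (intro re_intros re_finite_cert cpt_intros; rule re_dc; intro cpt_intros)
  show "?A n st tab fin \<or> ?B n st tab fin" if v: "st < n" "table k n tab" "bits n fin" for n st tab fin
  proof (cases "?A n st tab fin")
    case False
    have "\<not> infinite_cert n st tab fin"
    proof
      assume "infinite_cert n st tab fin"
      then obtain m where "lk fin (run tab st (prefix m word)) = 1"
        using infinite_cert_sound[OF v(2,1)] infinite_imp_nonempty by blast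
      moreover obtain l where "m < len l"
        using len_unbounded by blast
      ultimately have "lk fin (run tab st (take m (images (prefix l X)))) = 1"
        using prefix_word_take[of m l] by simp
      then show False
        using False by blast
    qed
    then show ?thesis
      using finite_or_infinite_cert[OF v(2,1,3)] False by blast
  qed simp
  show "(?A n st tab fin \<longrightarrow> lang D \<inter> Pref (image_word \<phi> X) \<noteq> {}) \<and>
      (?B n st tab fin \<longrightarrow> \<not> lang D \<inter> Pref (image_word \<phi> X) \<noteq> {})"
    if *: "st < n" "table k n tab" "bits n fin" and D: "\<And>w. w \<in> lang D \<longleftrightarrow> lk fin (run tab st (map num w)) = 1"
    for D n st tab fin
  proof (intro conjI impI)
    assume "?A n st tab fin"
    then obtain u i where ui: "lk fin (run tab st (take i (images (prefix u X)))) = 1"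
      by blast
    have "take i (images (prefix u X)) = prefix (min i (len u)) word"
    proof (cases "i \<le> len u")
      case False
      then show ?thesis
        using prefix_word[of u] by (simp add: len_def)
    qed (simp add: prefix_word_take)
    then show "lang D \<inter> Pref (image_word \<phi> X) \<noteq> {}"
      using ui Pref_iff[OF D] unfolding Pref_def by (metis Int_iff empty_iff rangeI)
  next
    assume "?B n st tab fin"
    then obtain u where u: "finite_cert n st tab fin u"
      "\<And>i. i \<le> len u \<Longrightarrow> lk fin (run tab st (take i (images (prefix u X)))) \<noteq> 1"
      by (auto simp: less_Suc_eq_le)
    have "lk fin (run tab st (prefix m word)) \<noteq> 1" for m
      using u(2)[of m] finite_cert_sound[OF *(2,1,3) u(1), of m]
      by (cases "m \<le> len u") (auto simp: prefix_word_take)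
    then show "\<not> lang D \<inter> Pref (image_word \<phi> X) \<noteq> {}"
      using Pref_iff[OF D] unfolding Pref_def by auto
  qed
qed

theorem Rp_inf_decidable: "Rp_inf_decidable num (image_word \<phi> X)"
  unfolding Rp_inf_decidable_def
proof (rule decidable_dfa_problem)
  let ?B = "\<lambda>n st tab fin. \<exists>u. finite_cert n st tab fin u"
  show "re (\<lambda>x. infinite_cert (fst x) (fst (snd x)) (fst (snd (snd x))) (snd (snd (snd x))))"
    by (intro re_infinite_cert cpt_intros)
  show "re (\<lambda>x. ?B (fst x) (fst (snd x)) (fst (snd (snd x))) (snd (snd (snd x))))"
    by (intro re_intros re_finite_cert cpt_intros)
  show "infinite_cert n st tab fin \<or> ?B n st tab fin" if v: "st < n" "table k n tab" "bits n fin" for n st tab fin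
    using finite_or_infinite_cert[OF v(2,1,3)] by blast
  show "(infinite_cert n st tab fin \<longrightarrow> infinite (lang D \<inter> Pref (image_word \<phi> X))) \<and>
      (?B n st tab fin \<longrightarrow> \<not> infinite (lang D \<inter> Pref (image_word \<phi> X)))"
    if *: "st < n" "table k n tab" "bits n fin" and D: "\<And>w. w \<in> lang D \<longleftrightarrow> lk fin (run tab st (map num w)) = 1"
    for D n st tab fin
  proof -
    let ?S = "{m. lk fin (run tab st (prefix m word)) = 1}"
    have "inj (\<lambda>m. prefix m (image_word \<phi> X))"
      by (rule injI) (metis diff_zero subsequence_length)
    moreover have "lang D \<inter> Pref (image_word \<phi> X) = (\<lambda>m. prefix m (image_word \<phi> X)) ` ?S"
      using Pref_iff[OF D] unfolding Pref_def by auto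
    ultimately have "infinite (lang D \<inter> Pref (image_word \<phi> X)) \<longleftrightarrow> infinite ?S"
      by (metis finite_image_iff inj_on_subset subset_UNIV)
    moreover have "finite ?S" if "finite_cert n st tab fin u" for u
    proof (rule finite_subset)
      show "?S \<subseteq> {..<len u}"
        using finite_cert_sound[OF *(2,1,3) that] not_less by blast
    qed simp
    ultimately show ?thesis
      using infinite_cert_sound[OF *(2,1)] by blast
  qed
qed

end

subsection \<open>Decoding formulas\<close>

definition tag :: "nat \<Rightarrow> nat" where "tag n = lk (denc n :: nat list) 0"
definition arg1 :: "nat \<Rightarrow> nat" where "arg1 n = lk (denc n :: nat list) 1"
definition arg2 :: "nat \<Rightarrow> nat" where "arg2 n = lk (denc n :: nat list) 2"

lemma less_list_encode: "x \<in> set xs \<Longrightarrow> x < list_encode xs"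
proof (induction xs)
  case (Cons y ys)
  then show ?case
    using le_prod_encode_1[of y "list_encode ys"] le_prod_encode_2[of "list_encode ys" y] by auto
qed simp

text \<open>The default value 0 of \<open>lk\<close> is below \<open>n\<close> too: a nonzero tag
  excludes the empty list, whose code is 0.\<close>

lemma lk_less:
  assumes "tag n \<noteq> 0"
  shows "lk (denc n :: nat list) i < n"
proof -
  have d: "denc n = list_decode n"
    by (simp add: denc_list_def map_idI)
  have "0 < n"
    using assms by (cases n) (auto simp: tag_def lk_def denc_list_def)
  then show ?thesis
    using less_list_encode[of "list_decode n ! i" "list_decode n"] by (auto simp: lk_def d)
qed

lemma arg_less: "tag n \<noteq> 0 \<Longrightarrow> arg1 n < n" "tag n \<noteq> 0 \<Longrightarrow> arg2 n < n"
  unfolding arg1_def arg2_def by (rule lk_less, assumption)+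

text \<open>Numbers that are not codes are decoded as well, so that all functions below are total.\<close>

function decode :: "nat \<Rightarrow> nat mso" where
  "decode n =
    (if tag n = 1 then Equal (arg1 n) (arg2 n)
     else if tag n = 2 then Letter (arg1 n) (arg2 n)
     else if tag n = 3 then Member (arg1 n) (arg2 n)
     else if tag n = 4 then Neg (decode (arg1 n))
     else if tag n = 5 then Conj (decode (arg1 n)) (decode (arg2 n))
     else if tag n = 6 then Ex1 (arg1 n) (decode (arg2 n))
     else if tag n = 7 then Ex2 (arg1 n) (decode (arg2 n))
     else Less (arg1 n) (arg2 n))"
  by pat_completeness auto
termination
  by (relation "measure id") (auto intro: arg_less)

declare decode.simps [simp del]

lemma tag_list_encode [simp]:
  "tag (list_encode (x # xs)) = x" "arg1 (list_encode (x # y # xs)) = y" "arg2 (list_encode (x # y # z # xs)) = z"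
  by (simp_all add: tag_def arg1_def arg2_def denc_list_def numeral_2_eq_2 o_def del: list_encode.simps)

lemma decode_list_encode:
  "decode (list_encode [0, x, y]) = Less x y" "decode (list_encode [1, x, y]) = Equal x y"
  "decode (list_encode [2, x, y]) = Letter x y" "decode (list_encode [3, x, y]) = Member x y"
  "decode (list_encode [4, x]) = Neg (decode x)" "decode (list_encode [5, x, y]) = Conj (decode x) (decode y)"
  "decode (list_encode [6, x, y]) = Ex1 x (decode y)" "decode (list_encode [7, x, y]) = Ex2 x (decode y)"
  by (simp_all only: decode.simps[of "list_encode _"] tag_list_encode) simp_all

lemma decode_code [simp]: "decode (code_mso id \<psi>) = \<psi>"
  by (induction \<psi>) (simp_all only: code_mso.simps id_apply decode_list_encode)

lemma code_map_mso: "code_mso num \<psi> = code_mso id (map_mso num \<psi>)"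
  by (induction \<psi>) (simp_all del: list_encode.simps)

lemma free_map_mso: "free1 (map_mso f \<psi>) = free1 \<psi>" "free2 (map_mso f \<psi>) = free2 \<psi>"
  by (induction \<psi>) simp_all

lemma sat_map_mso: "inj f \<Longrightarrow> sat (f \<circ> W) v V (map_mso f \<psi>) \<longleftrightarrow> sat W v V \<psi>"
  by (induction \<psi> arbitrary: v V) (simp_all add: inj_eq)

subsection \<open>Computability of types\<close>

text \<open>Labellings of a word of length \<open>n\<close> are represented by the binary digits of
  the numbers below \<open>2 ^ n\<close>, which makes quantification over them bounded.\<close>

definition bitf :: "nat \<Rightarrow> nat \<Rightarrow> bool" where
  "bitf b i \<longleftrightarrow> odd (b div 2 ^ i)"

lemma bitf_exists: "\<exists>b<2 ^ n. \<forall>i<n. bitf b i \<longleftrightarrow> B i"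
proof -
  let ?S = "{i. i < n \<and> B i}"
  have "set_encode ?S \<le> (\<Sum>i<n. 2 ^ i)"
    unfolding set_encode_def by (rule sum_mono2) auto
  also have "\<dots> < (2 :: nat) ^ n"
    by (induction n) simp_all
  finally have "set_encode ?S < 2 ^ n" .
  moreover have "bitf (set_encode ?S) i \<longleftrightarrow> B i" if "i < n" for i
    using that set_encode_inverse[of ?S] by (auto simp: bitf_def set_decode_def set_eq_iff)
  ultimately show ?thesis
    by blast
qed

lemma ex_marks_iff: "(\<exists>B. Q (marks X B u)) \<longleftrightarrow> (\<exists>b<2 ^ length u. Q (marks X (bitf b) u))"
proof
  assume "\<exists>B. Q (marks X B u)"
  then obtain B where B: "Q (marks X B u)" by blast
  obtain b where "b < 2 ^ length u" "\<And>i. i < length u \<Longrightarrow> bitf b i \<longleftrightarrow> B i"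
    using bitf_exists[of "length u" B] by blast
  then show "\<exists>b<2 ^ length u. Q (marks X (bitf b) u)"
    using B marks_cong[of u "bitf b" B X] by auto
qed blast

lemma all_marks_iff: "(\<forall>B. Q (marks X B u)) \<longleftrightarrow> (\<forall>b<2 ^ length u. Q (marks X (bitf b) u))"
  using ex_marks_iff[of "\<lambda>u. \<not> Q u" X u] by blast

definition back_and_forth :: "nat \<Rightarrow> nat \<Rightarrow> (nat \<Rightarrow> nat \<Rightarrow> bool) \<Rightarrow> bool" where
  "back_and_forth m n R \<longleftrightarrow> (\<forall>b<m. \<exists>c<n. R b c) \<and> (\<forall>c<n. \<exists>b<m. R b c)"

lemma back_and_forth_cong:
  "(\<And>b c. b < m \<Longrightarrow> c < n \<Longrightarrow> R b c \<longleftrightarrow> R' b c) \<Longrightarrow> back_and_forth m n R \<longleftrightarrow> back_and_forth m n R'"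
  unfolding back_and_forth_def by blast

lemma lift_iff:
  "lift X E u v \<longleftrightarrow> back_and_forth (2 ^ length u) (2 ^ length v) (\<lambda>b c. E (marks X (bitf b) u) (marks X (bitf c) v))"
proof -
  have "(\<forall>B. \<exists>C. E (marks X B u) (marks X C v)) \<longleftrightarrow>
      (\<forall>b<2 ^ length u. \<exists>c<2 ^ length v. E (marks X (bitf b) u) (marks X (bitf c) v))"
    by (subst all_marks_iff[of "\<lambda>u. \<exists>C. E u (marks X C v)"]) (simp only: ex_marks_iff)
  moreover have "(\<forall>C. \<exists>B. E (marks X B u) (marks X C v)) \<longleftrightarrow>
      (\<forall>c<2 ^ length v. \<exists>b<2 ^ length u. E (marks X (bitf b) u) (marks X (bitf c) v))"
    by (subst all_marks_iff[of "\<lambda>v. \<exists>B. E (marks X B u) v"]) (simp only: ex_marks_iff[of "\<lambda>u. E u _"])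
  ultimately show ?thesis
    by (simp only: lift_def back_and_forth_def)
qed

lemma lift_accept_iff:
  "lift_accept X E A s e \<longleftrightarrow> (\<exists>b<2 ^ length s. \<exists>c<2 ^ length e.
     E (marks X (bitf b) s @ marks X (bitf c) e) (marks X (bitf b) s) \<and>
     E (marks X (bitf c) e @ marks X (bitf c) e) (marks X (bitf c) e) \<and>
     A (marks X (bitf b) s) (marks X (bitf c) e))"
proof -
  define Q where "Q s e \<longleftrightarrow> E (s @ e) s \<and> E (e @ e) e \<and> A s e" for s e
  have "lift_accept X E A s e \<longleftrightarrow> (\<exists>B. \<exists>C. Q (marks X B s) (marks X C e))"
    by (simp add: lift_accept_def Q_def)
  also have "\<dots> \<longleftrightarrow> (\<exists>b<2 ^ length s. \<exists>C. Q (marks X (bitf b) s) (marks X C e))"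
    by (rule ex_marks_iff[of "\<lambda>s. \<exists>C. Q s (marks X C e)"])
  also have "\<dots> \<longleftrightarrow> (\<exists>b<2 ^ length s. \<exists>c<2 ^ length e. Q (marks X (bitf b) s) (marks X (bitf c) e))"
    by (simp only: ex_marks_iff[of "Q _"])
  finally show ?thesis
    by (simp only: Q_def)
qed

lemma dc_bitf [cpt_intros]: "cpt b \<Longrightarrow> cpt i \<Longrightarrow> dc (\<lambda>x. bitf (b x) (i x))"
  unfolding bitf_def by (intro cpt_intros)

lemma cpt_marks [cpt_intros]:
  assumes "cpt X" "cpt b" "cpt u"
  shows "cpt (\<lambda>x. marks (X x) (bitf (b x)) (u x))"
proof -
  have "marks Y B v = map (\<lambda>i. mark Y (B i) (lk v i)) [0..<length v]" for Y B v
    by (simp add: marks_def)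
  then have "cpt (\<lambda>p. marks (fst p) (bitf (fst (snd p))) (snd (snd p)))"
    by (simp only: mark_def) (intro cpt_intros)
  from cpt_comp[OF this, of "\<lambda>x. (X x, b x, u x)"] show ?thesis
    by (simp add: cpt_Pair assms)
qed

lemma dc_marked [cpt_intros]: "cpt X \<Longrightarrow> cpt c \<Longrightarrow> dc (\<lambda>x. marked (X x) (c x))"
  unfolding marked_def by (intro cpt_intros)

lemma dc_occ [cpt_intros]:
  assumes "dc (\<lambda>p. \<alpha> (snd p) (fst p))" "cpt u"
  shows "dc (\<lambda>x. occ (\<alpha> x) (u x))"
  unfolding occ_def by (intro cpt_intros assms)

lemma dc_occ_pair_marked [cpt_intros]:
  assumes "cpt X" "cpt Y" "cpt u"
  shows "dc (\<lambda>x. occ_pair (marked (X x)) (marked (Y x)) (u x))"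
proof -
  have "occ_pair \<alpha> \<beta> v \<longleftrightarrow> (\<exists>j<length v. \<exists>i<j. \<alpha> (lk v i) \<and> \<beta> (lk v j))" for \<alpha> \<beta> and v :: "letter list"
    unfolding occ_pair_def
    by (rule ex_cong1, rule conj_cong[OF refl], rule ex_cong1, rule conj_cong[OF refl]) simp
  then have "dc (\<lambda>p. occ_pair (marked (fst p)) (marked (fst (snd p))) (snd (snd p)))"
    by (simp only:) (intro cpt_intros)
  from dc_comp[OF this, of "\<lambda>x. (X x, Y x, u x)"] show ?thesis
    by (simp add: cpt_Pair assms)
qed

lemma dc_order_type [cpt_intros]:
  assumes "cpt X" "cpt Y" "cpt u" "cpt v"
  shows "dc (\<lambda>x. order_type (marked (X x)) (marked (Y x)) (u x) = order_type (marked (X x)) (marked (Y x)) (v x))"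
proof -
  have "dc (\<lambda>p. order_type (marked (fst p)) (marked (fst (snd p))) (fst (snd (snd p))) =
      order_type (marked (fst p)) (marked (fst (snd p))) (snd (snd (snd p))))"
    unfolding order_type_def prod.inject by (intro cpt_intros)
  from dc_comp[OF this, of "\<lambda>x. (X x, Y x, u x, v x)"] show ?thesis
    by (simp add: cpt_Pair assms)
qed

lemma dc_single_type [cpt_intros]:
  assumes "cpt X" "cpt u" "cpt v"
  shows "dc (\<lambda>x. single_type (X x) (u x) = single_type (X x) (v x))"
proof -
  have "dc (\<lambda>p. single_type (fst p) (fst (snd p)) = single_type (fst p) (snd (snd p)))"
    unfolding single_type_def prod.inject by (intro cpt_intros)
  from dc_comp[OF this, of "\<lambda>x. (X x, u x, v x)"] show ?thesis
    by (simp add: cpt_Pair assms)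
qed

lemma dc_single_accept [cpt_intros]:
  assumes "cpt X" "cpt s" "cpt e"
  shows "dc (\<lambda>x. single_accept (X x) (s x) (e x))"
proof -
  have "dc (\<lambda>p. single_accept (fst p) (fst (snd p)) (snd (snd p)))"
    unfolding single_accept_def by (intro cpt_intros)
  from dc_comp[OF this, of "\<lambda>x. (X x, s x, e x)"] show ?thesis
    by (simp add: cpt_Pair assms)
qed

lemma cpt_tag [cpt_intros]: "cpt f \<Longrightarrow> cpt (\<lambda>x. tag (f x))"
  unfolding tag_def by (intro cpt_intros)

lemma cpt_arg1 [cpt_intros]: "cpt f \<Longrightarrow> cpt (\<lambda>x. arg1 (f x))"
  unfolding arg1_def by (intro cpt_intros)

lemma cpt_arg2 [cpt_intros]: "cpt f \<Longrightarrow> cpt (\<lambda>x. arg2 (f x))"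
  unfolding arg2_def by (intro cpt_intros)

type_synonym item = "nat \<times> letter list \<times> letter list"

definition var :: "nat \<Rightarrow> nat" where
  "var n = (if tag n = 6 then 2 * arg1 n else 2 * arg1 n + 1)"

text \<open>The recursive calls shared by \<open>equi\<close> and \<open>accept\<close>. For a
  quantifier, all pairs of labellings \<open>b\<close>, \<open>c\<close> are listed row by row, so
  that their result stands at index \<open>b * 2 ^ length v + c\<close>.\<close>

definition calls :: "item \<Rightarrow> item list" where
  "calls p = (let n = fst p; u = fst (snd p); v = snd (snd p) in
     if tag n = 4 then [(arg1 n, u, v)]
     else if tag n = 5 then [(arg1 n, u, v), (arg2 n, u, v)]
     else if tag n = 6 \<or> tag n = 7 then
       map (\<lambda>i. (arg2 n, marks (var n) (bitf (i div 2 ^ length v)) u, marks (var n) (bitf (i mod 2 ^ length v)) v))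
         [0..<2 ^ length u * 2 ^ length v]
     else [])"

lemma cpt_var [cpt_intros]: "cpt f \<Longrightarrow> cpt (\<lambda>x. var (f x))"
  unfolding var_def by (intro cpt_intros)

lemma cpt_calls: "cpt calls"
  unfolding calls_def Let_def by (intro cpt_intros)

lemma calls_less: "q \<in> set (calls p) \<Longrightarrow> fst q < fst p"
  using arg_less[of "fst p"] by (auto simp: calls_def Let_def split: if_splits)

lemma lk_map_calls:
  assumes "tag n = 6 \<or> tag n = 7" "b < 2 ^ length u" "c < 2 ^ length v"
  shows "lk (map F (calls (n, u, v))) (b * 2 ^ length v + c) = F (arg2 n, marks (var n) (bitf b) u, marks (var n) (bitf c) v)"
proof -
  have "b * 2 ^ length v + c < Suc b * 2 ^ length v"
    using assms(3) by simp
  also have "\<dots> \<le> 2 ^ length u * 2 ^ length v"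
    using assms(2) by (intro mult_le_mono1) simp
  finally have "b * 2 ^ length v + c < 2 ^ length u * 2 ^ length v" .
  then show ?thesis
    using assms by (auto simp: calls_def)
qed

definition equi_step :: "item \<Rightarrow> nat list \<Rightarrow> nat" where
  "equi_step p rs = (let n = fst p; u = fst (snd p); v = snd (snd p); x = arg1 n; y = arg2 n; X = var n in of_bool (
     if tag n = 1 then occ (\<lambda>c. marked (2 * x) c \<and> marked (2 * y) c) u = occ (\<lambda>c. marked (2 * x) c \<and> marked (2 * y) c) v
     else if tag n = 2 then occ (\<lambda>c. marked (2 * y) c \<and> fst c = x) u = occ (\<lambda>c. marked (2 * y) c \<and> fst c = x) v
     else if tag n = 3 then occ (\<lambda>c. marked (2 * x) c \<and> marked (2 * y + 1) c) u = occ (\<lambda>c. marked (2 * x) c \<and> marked (2 * y + 1) c) v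
     else if tag n = 4 then lk rs 0 = 1
     else if tag n = 5 then lk rs 0 = 1 \<and> lk rs 1 = 1
     else if tag n = 6 \<or> tag n = 7 then
       back_and_forth (2 ^ length u) (2 ^ length v) (\<lambda>b c.
         (tag n = 6 \<longrightarrow> single_type X (marks X (bitf b) u) = single_type X (marks X (bitf c) v)) \<and>
         lk rs (b * 2 ^ length v + c) = 1)
     else order_type (marked (2 * x)) (marked (2 * y)) u = order_type (marked (2 * x)) (marked (2 * y)) v))"

lemma cpt_equi_step: "cpt (\<lambda>p. equi_step (fst p) (snd p))"
  unfolding equi_step_def Let_def back_and_forth_def by (intro cpt_intros)

lemma equi_rec:
  "of_bool (equi (decode (fst p)) (fst (snd p)) (snd (snd p))) =
   equi_step p (map (\<lambda>p. of_bool (equi (decode (fst p)) (fst (snd p)) (snd (snd p)))) (calls p))"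
proof -
  obtain n u v where p: "p = (n, u, v)"
    by (metis prod_cases3)
  consider "tag n = 4" | "tag n = 5" | "tag n = 6" | "tag n = 7" | "tag n \<notin> {4, 5, 6, 7}"
    by blast
  then show ?thesis
  proof cases
    case 3
    then have d: "decode n = Ex1 (arg1 n) (decode (arg2 n))"
      by (simp add: decode.simps[of n])
    show ?thesis
      unfolding p equi_step_def Let_def fst_conv snd_conv d equi.simps lift_iff
      by (rule arg_cong[where f = of_bool], simp add: 3 var_def)
        (rule back_and_forth_cong, subst lk_map_calls, simp_all add: 3 var_def)
  next
    case 4
    then have d: "decode n = Ex2 (arg1 n) (decode (arg2 n))"
      by (simp add: decode.simps[of n])
    show ?thesis
      unfolding p equi_step_def Let_def fst_conv snd_conv d equi.simps lift_iff
      by (rule arg_cong[where f = of_bool], simp add: 4 var_def)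
        (rule back_and_forth_cong, subst lk_map_calls, simp_all add: 4 var_def)
  qed (simp_all add: p decode.simps[of n] equi_step_def Let_def calls_def)
qed

lemma dc_equi [cpt_intros]:
  assumes "cpt n" "cpt u" "cpt v"
  shows "dc (\<lambda>x. equi (decode (n x)) (u x) (v x))"
proof -
  have "dc (\<lambda>p. equi (decode (fst p)) (fst (snd p)) (snd (snd p)))"
    unfolding dc_def
    by (rule cpt_wf_recursion[OF cpt_calls cpt_equi_step equi_rec calls_less])
  from dc_comp[OF this, of "\<lambda>x. (n x, u x, v x)"] show ?thesis
    by (simp add: cpt_Pair assms)
qed

text \<open>Only values of \<open>accept\<close> come from the recursive calls; the equivalences are
  evaluated directly, as \<open>equi\<close> is already known to be decidable.\<close>

definition accept_step :: "item \<Rightarrow> nat list \<Rightarrow> nat" where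
  "accept_step p rs = (let n = fst p; s = fst (snd p); e = snd (snd p); x = arg1 n; y = arg2 n; X = var n in of_bool (
     if tag n = 1 then occ (\<lambda>c. marked (2 * x) c \<and> marked (2 * y) c) (s @ e)
     else if tag n = 2 then occ (\<lambda>c. marked (2 * y) c \<and> fst c = x) (s @ e)
     else if tag n = 3 then occ (\<lambda>c. marked (2 * x) c \<and> marked (2 * y + 1) c) (s @ e)
     else if tag n = 4 then lk rs 0 \<noteq> 1
     else if tag n = 5 then lk rs 0 = 1 \<and> lk rs 1 = 1
     else if tag n = 6 \<or> tag n = 7 then
       (\<exists>b<2 ^ length s. \<exists>c<2 ^ length e.
          (tag n = 6 \<longrightarrow> single_type X (marks X (bitf b) s @ marks X (bitf c) e) = single_type X (marks X (bitf b) s)) \<and>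
          equi (decode y) (marks X (bitf b) s @ marks X (bitf c) e) (marks X (bitf b) s) \<and>
          (tag n = 6 \<longrightarrow> single_type X (marks X (bitf c) e @ marks X (bitf c) e) = single_type X (marks X (bitf c) e)) \<and>
          equi (decode y) (marks X (bitf c) e @ marks X (bitf c) e) (marks X (bitf c) e) \<and>
          (tag n = 6 \<longrightarrow> single_accept X (marks X (bitf b) s) (marks X (bitf c) e)) \<and>
          lk rs (b * 2 ^ length e + c) = 1)
     else occ_pair (marked (2 * x)) (marked (2 * y)) (s @ e @ e)))"

lemma cpt_accept_step: "cpt (\<lambda>p. accept_step (fst p) (snd p))"
  unfolding accept_step_def Let_def by (intro cpt_intros)

lemma accept_rec:
  "of_bool (accept (decode (fst p)) (fst (snd p)) (snd (snd p))) =
   accept_step p (map (\<lambda>p. of_bool (accept (decode (fst p)) (fst (snd p)) (snd (snd p)))) (calls p))"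
proof -
  obtain n s e where p: "p = (n, s, e)"
    by (metis prod_cases3)
  consider "tag n = 4" | "tag n = 5" | "tag n = 6" | "tag n = 7" | "tag n \<notin> {4, 5, 6, 7}"
    by blast
  then show ?thesis
  proof cases
    case 3
    then have d: "decode n = Ex1 (arg1 n) (decode (arg2 n))"
      by (simp add: decode.simps[of n])
    show ?thesis
      unfolding p accept_step_def Let_def fst_conv snd_conv d accept.simps lift_accept_iff
      by (rule arg_cong[where f = of_bool], simp add: 3 var_def)
        (rule ex_cong1, rule conj_cong[OF refl], rule ex_cong1, rule conj_cong[OF refl],
          subst lk_map_calls, auto simp: 3 var_def)
  next
    case 4
    then have d: "decode n = Ex2 (arg1 n) (decode (arg2 n))"
      by (simp add: decode.simps[of n])
    show ?thesis
      unfolding p accept_step_def Let_def fst_conv snd_conv d accept.simps lift_accept_iff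
      by (rule arg_cong[where f = of_bool], simp add: 4 var_def)
        (rule ex_cong1, rule conj_cong[OF refl], rule ex_cong1, rule conj_cong[OF refl],
          subst lk_map_calls, auto simp: 4 var_def)
  qed (simp_all add: p decode.simps[of n] accept_step_def Let_def calls_def)
qed

lemma dc_accept [cpt_intros]:
  assumes "cpt n" "cpt s" "cpt e"
  shows "dc (\<lambda>x. accept (decode (n x)) (s x) (e x))"
proof -
  have "dc (\<lambda>p. accept (decode (fst p)) (fst (snd p)) (snd (snd p)))"
    unfolding dc_def
    by (rule cpt_wf_recursion[OF cpt_calls cpt_accept_step accept_rec calls_less])
  from dc_comp[OF this, of "\<lambda>x. (n x, s x, e x)"] show ?thesis
    by (simp add: cpt_Pair assms)
qed

subsection \<open>The monadic theory\<close>

definition unmarked :: "nat list \<Rightarrow> letter list" where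
  "unmarked u = map (\<lambda>i. (i, [])) u"

lemma unmarked_append [simp]: "unmarked (u @ v) = unmarked u @ unmarked v"
  by (simp add: unmarked_def)

lemma unmarked_eq_Nil [simp]: "unmarked u = [] \<longleftrightarrow> u = []"
  by (simp add: unmarked_def)

lemma length_unmarked [simp]: "length (unmarked u) = length u"
  by (simp add: unmarked_def)

lemma prefix_unmarked: "prefix n (\<lambda>i. (w i, [])) = unmarked (prefix n w)"
  by (simp add: unmarked_def subsequence_def o_def)

lemma unmarked_subst_word: "unmarked (subst_word f u) = subst_word (\<lambda>\<alpha>. unmarked (f \<alpha>)) u"
  by (induction u) (simp_all add: unmarked_def subst_word_def)

lemma cpt_unmarked [cpt_intros]: "cpt f \<Longrightarrow> cpt (\<lambda>x. unmarked (f x))"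
  unfolding unmarked_def by (intro cpt_intros)

lemma cpt_pow [cpt_intros]: "cpt n \<Longrightarrow> cpt f \<Longrightarrow> cpt (\<lambda>x. pow (n x) (f x))"
  unfolding pow_def by (intro cpt_intros)

text \<open>The entries of \<open>L\<close> are representatives of the types, on which the automaton \<open>tab\<close> acts.\<close>

definition type_automaton :: "nat \<Rightarrow> nat \<Rightarrow> nat \<Rightarrow> nat \<Rightarrow> nat list list \<Rightarrow> nat list list \<Rightarrow> bool" where
  "type_automaton k n N st tab L \<longleftrightarrow> st < N \<and> table k N tab \<and> lk L st = [] \<and>
     (\<forall>q<N. \<forall>i<k. equi (decode n) (unmarked (lk L q @ [i])) (unmarked (lk L (lk (lk tab q) i))))"

lemma dc_type_automaton:
  assumes "cpt k" "cpt n" "cpt N" "cpt st" "cpt tab" "cpt L"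
  shows "dc (\<lambda>x. type_automaton (k x) (n x) (N x) (st x) (tab x) (L x))"
proof -
  have "dc (\<lambda>p. type_automaton (fst p) (fst (snd p)) (fst (snd (snd p))) (fst (snd (snd (snd p))))
      (fst (snd (snd (snd (snd p))))) (snd (snd (snd (snd (snd p))))))"
    unfolding type_automaton_def table_def by (intro cpt_intros)
  from dc_comp[OF this, of "\<lambda>x. (k x, n x, N x, st x, tab x, L x)"] show ?thesis
    by (simp add: cpt_Pair assms)
qed

text \<open>Representatives and transitions are chosen noneffectively. Existence is enough, since a
  guessed automaton can be checked and the search is therefore bound to succeed.\<close>

lemma type_automaton_exists: "\<exists>N st tab L. type_automaton k n N st tab L"
proof -
  interpret omega_congruence "equi (decode n)" "holds (decode n)"
    by (rule omega_congruence_equi)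
  obtain t :: "letter list \<Rightarrow> nat" where t: "finite (range t)" "\<And>u v. t u = t v \<Longrightarrow> equi (decode n) u v"
    using finite_index by blast
  have "finite (range (t \<circ> unmarked))"
    by (rule finite_subset[OF _ t(1)]) auto
  from finite_list[OF this] obtain cs where cs: "set cs = range (t \<circ> unmarked)" ..
  \<comment> \<open>The entry in front gives the initial state exactly the representative
    \<open>[]\<close>; several states may represent the same class.\<close>
  let ?L = "[] # map (inv (t \<circ> unmarked)) cs"
  let ?N = "length ?L"
  have rep: "\<exists>q<?N. equi (decode n) (unmarked u) (unmarked (lk ?L q))" for u
  proof -
    let ?v = "inv (t \<circ> unmarked) ((t \<circ> unmarked) u)"
    have "?v \<in> set ?L"
      using cs by auto
    then obtain q where "q < ?N" "?L ! q = ?v"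
      by (metis in_set_conv_nth)
    moreover have "(t \<circ> unmarked) ?v = (t \<circ> unmarked) u"
      by (rule f_inv_into_f) simp
    ultimately show ?thesis
      using t(2)[of "unmarked u" "unmarked ?v"] by (intro exI[of _ q]) (simp only: o_apply lk_nth simp_thms)
  qed
  define g where "g u = (SOME q. q < ?N \<and> equi (decode n) (unmarked u) (unmarked (lk ?L q)))" for u
  have g: "g u < ?N" "equi (decode n) (unmarked u) (unmarked (lk ?L (g u)))" for u
    using someI_ex[OF rep[of u]] unfolding g_def by blast+
  let ?tab = "map (\<lambda>q. map (\<lambda>i. g (lk ?L q @ [i])) [0..<k]) [0..<?N]"
  have "table k ?N ?tab"
    using g(1) by (auto simp: table_def simp del: list.size)
  moreover have "equi (decode n) (unmarked (lk ?L q @ [i])) (unmarked (lk ?L (lk (lk ?tab q) i)))" if "q < ?N" "i < k" for q i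
  proof -
    have "lk (lk ?tab q) i = g (lk ?L q @ [i])"
      using that by (simp del: list.size upt_Suc)
    then show ?thesis
      using g(2)[of "lk ?L q @ [i]"] by (simp only:)
  qed
  moreover have "lk ?L 0 = []"
    by (simp add: lk_def)
  ultimately have "type_automaton k n ?N 0 ?tab ?L"
    unfolding type_automaton_def by (intro conjI allI impI) simp_all
  then show ?thesis by blast
qed

text \<open>Taken from the initial state, this says that the state reached determines the class of
  the word read.\<close>

lemma equi_run:
  assumes "type_automaton k n N st tab L" "q < N" "set u \<subseteq> {..<k}"
  shows "equi (decode n) (unmarked (lk L q @ u)) (unmarked (lk L (run tab q u)))"
  using assms(2,3)
proof (induction u arbitrary: q)
  interpret omega_congruence "equi (decode n)" "holds (decode n)"
    by (rule omega_congruence_equi)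
  case Nil
  show ?case by (simp add: refl)
next
  interpret omega_congruence "equi (decode n)" "holds (decode n)"
    by (rule omega_congruence_equi)
  case (Cons i u)
  let ?q = "lk (lk tab q) i"
  have tab: "table k N tab" and i: "i < k" "set u \<subseteq> {..<k}"
    using assms(1) Cons.prems by (auto simp: type_automaton_def)
  have "equi (decode n) (unmarked (lk L q @ [i])) (unmarked (lk L ?q))"
    using assms(1) Cons.prems(1) i unfolding type_automaton_def by blast
  from append[OF this refl, of "unmarked u"]
  have "equi (decode n) (unmarked (lk L q @ i # u)) (unmarked (lk L ?q @ u))"
    by (simp add: unmarked_def)
  moreover have "equi (decode n) (unmarked (lk L ?q @ u)) (unmarked (lk L (run tab ?q u)))"
    by (rule Cons.IH) (use table_step[OF tab Cons.prems(1) i(1)] i in auto)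
  ultimately show ?case
    using trans by (simp only: run_Cons)
qed

section \<open>Periodicity certificates and the decision of the theory\<close>

context disjunctive_image
begin

text \<open>Letters can be erased, so \<open>0 < len u\<close> is what makes \<open>e\<close>
  nonempty. Apart from \<open>recurrent\<close>, which is recursively enumerable, the conditions are
  decidable.\<close>

definition period_cert :: "nat \<Rightarrow> letter list \<Rightarrow> bool" where
  "period_cert n e \<longleftrightarrow> (\<exists>N st tab L cv u m. type_automaton k n N st tab L \<and> recurrent N st tab cv u \<and>
     0 < len u \<and> 0 < m \<and> e = pow m (unmarked (images (prefix u X))) \<and> equi (decode n) (e @ e) e)"

lemma re_period_cert: "re (\<lambda>p. period_cert (fst p) (snd p))"
  unfolding period_cert_def
  by (intro re_intros re_recurrent cpt_intros; rule re_dc; intro dc_type_automaton cpt_intros)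

lemma period_cert_exists: "\<exists>e. period_cert n e"
proof -
  interpret omega_congruence "equi (decode n)" "holds (decode n)"
    by (rule omega_congruence_equi)
  obtain N st tab L where A: "type_automaton k n N st tab L"
    using type_automaton_exists by blast
  then have tab: "table k N tab" "st < N"
    by (simp_all add: type_automaton_def)
  obtain cv u where u: "recurrent N st tab cv u" "0 < len u"
    "\<forall>c. inside N cv c \<longrightarrow> (\<exists>v. run tab (visited tab st u) (images v) = c)"
    by (rule recurrent_exists[OF tab, of 0])
  obtain m where "0 < m" "equi (decode n) (pow m (unmarked (images (prefix u X))) @ pow m (unmarked (images (prefix u X))))
      (pow m (unmarked (images (prefix u X))))"
    using idempotent_power by blast
  then show ?thesis
    unfolding period_cert_def using A u by blast
qed

lemma period_cert_sound:
  assumes "period_cert n e"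
  shows "holds (decode n) (\<lambda>i. (word i, [])) \<longleftrightarrow> accept (decode n) e e"
proof -
  interpret omega_congruence "equi (decode n)" "holds (decode n)"
    by (rule omega_congruence_equi)
  obtain N st tab L cv u m where *: "type_automaton k n N st tab L" "recurrent N st tab cv u"
     "0 < len u" "0 < m" "e = pow m (unmarked (images (prefix u X)))" "equi (decode n) (e @ e) e"
    using assms unfolding period_cert_def by blast
  have tab: "table k N tab" "st < N" and L: "lk L st = []"
    using *(1) by (simp_all add: type_automaton_def)
  let ?f = "\<lambda>\<alpha>. unmarked (img \<alpha>)"
  have f: "subst_word ?f v = unmarked (images v)" for v
    by (simp add: unmarked_subst_word)
  let ?s = "subst_word ?f (prefix u X)"
  have s: "?s \<noteq> []"
    using *(3) by (simp add: f len_def)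
  have eq: "equi (decode n) (unmarked (images v)) (unmarked (lk L (run tab st (images v))))" for v
    using equi_run[OF *(1) tab(2) images_less, of v] L by simp
  have "holds (decode n) (\<lambda>i. (word i, [])) \<longleftrightarrow> holds (decode n) (prodw (lasso e e))"
  proof (rule disjunctive_periodic[OF disjunctive, where f = ?f and u = u and k = m and s = ?s])
    show "prefix (length (subst_word ?f (prefix n X))) (\<lambda>i. (word i, [])) = subst_word ?f (prefix n X)" for n
      using prefix_word[of n] by (simp add: f len_def prefix_unmarked)
    show "\<exists>v'. equi (decode n) (?s @ subst_word ?f v @ subst_word ?f v') ?s" for v
    proof -
      have q: "inside N cv (visited tab st u)" "invariant N tab cv"
        using *(2) visited_less[OF tab] by (simp_all add: recurrent_def trapped_def inside_def)
      have "inside N cv (run tab (visited tab st u) (images v))"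
        by (rule inside_images[OF tab(1) q(2,1)])
      then obtain v' where v': "run tab (run tab (visited tab st u) (images v)) (images v') = visited tab st u"
        using *(2) unfolding recurrent_def inside_def by blast
      \<comment> \<open>Returning to the same state of the automaton of types means returning to the
        same class.\<close>
      have "run tab st (images (prefix u X @ v @ v')) = run tab st (images (prefix u X))"
        using v' by (simp add: visited_def)
      then have "equi (decode n) (unmarked (images (prefix u X @ v @ v'))) (unmarked (images (prefix u X)))"
        using eq[of "prefix u X @ v @ v'"] eq[of "prefix u X"] sym trans by metis
      then show ?thesis
        by (intro exI[of _ v']) (simp add: f)
    qed
    show "e = pow m ?s"
      using *(5) by (simp add: f)
  qed (use * s in auto)
  also have "\<dots> \<longleftrightarrow> accept (decode n) e e"
  proof -
    have "e \<noteq> []"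
      using *(4,5) s pow_nonempty by (metis f)
    then show ?thesis
      using accurate_accept *(6) unfolding accurate_def by blast
  qed
  finally show ?thesis .
qed

theorem MT_decidable: "MT_decidable num (image_word \<phi> X)"
proof -
  let ?A = "\<lambda>n. \<exists>e. period_cert n e \<and> accept (decode n) e e"
  let ?B = "\<lambda>n. \<exists>e. period_cert n e \<and> \<not> accept (decode n) e e"
  have *: "re (\<lambda>p. period_cert (snd p) (fst p))"
    using re_comp[OF re_period_cert, of "\<lambda>p. (snd p, fst p)"] by (simp add: cpt_Pair cpt_fst cpt_snd cpt_id)
  have "re ?A" "re ?B"
    by (intro re_Ex re_conj * re_dc cpt_intros)+
  moreover have "?A n \<or> ?B n" for n
    using period_cert_exists by blast
  ultimately obtain f :: "nat \<Rightarrow> nat" where f: "cpt f" "\<forall>n. f n = 1 \<and> ?A n \<or> f n = 0 \<and> ?B n"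
    by (rule re_decide)
  have inj: "inj num"
    using num by (simp add: numbering_def bij_betw_def)
  have "f (code_mso num \<psi>) = (if true_in (image_word \<phi> X) \<psi> then 1 else 0)" if \<psi>: "\<psi> \<in> sentences" for \<psi>
  proof -
    \<comment> \<open>Letters are replaced by their numbers, because decoding produces formulas over
      \<open>nat\<close>.\<close>
    let ?\<psi> = "map_mso num \<psi>"
    have free: "free1 ?\<psi> = {}" "free2 ?\<psi> = {}"
      using \<psi> by (simp_all add: sentences_def free_map_mso)
    have "holds ?\<psi> (\<lambda>i. (word i, [])) \<longleftrightarrow> sat word v V ?\<psi>" for v V
      by (rule holds_iff_sat) (simp_all add: free)
    then have "holds ?\<psi> (\<lambda>i. (word i, [])) \<longleftrightarrow> true_in (image_word \<phi> X) \<psi>"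
      unfolding true_in_def word_def sat_map_mso[OF inj] by blast
    moreover have "decode (code_mso num \<psi>) = ?\<psi>"
      by (subst code_map_mso) (rule decode_code)
    ultimately show ?thesis
      using spec[OF f(2), of "code_mso num \<psi>"] period_cert_sound[of "code_mso num \<psi>"] by auto
  qed
  then show ?thesis
    unfolding MT_decidable_def decidable_problem_def using f(1) by (auto simp: cpt_def)
qed

end

theorem theorem4:
  fixes num :: "'a::finite \<Rightarrow> nat"
    and \<phi> :: "nat list \<Rightarrow> 'a list"
    and W_inf :: "nat word"
  assumes "numbering num"
    and "morphism \<phi>"
    and "computable (\<lambda>\<alpha>. code_word num (\<phi> [\<alpha>]))"
    and "RR_decidable num {\<phi> [\<alpha>] | \<alpha>. True}"
    and "computable W_inf"
    and "\<forall>u. factor u W_inf"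
    and "infinite_image \<phi> W_inf"
  shows "Rp_decidable num (image_word \<phi> W_inf) \<and>
         Rp_inf_decidable num (image_word \<phi> W_inf) \<and>
         MT_decidable num (image_word \<phi> W_inf)"
proof -
  interpret disjunctive_image num \<phi> W_inf
    by standard fact+
  show ?thesis
    by (intro conjI Rp_decidable Rp_inf_decidable MT_decidable)
qed

end
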